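(* Let $T>0$, $\mu\ge0$ and a pipe network in which every inner node has at most $n$ incident edges be given. Then there exist a constant $C_T>0$ and constants $c_1(T),c_2(T),c_3(T),c_4(T)>0$ such that the following holds whenever $B_{\max},L_I,S_{\max},L_R>0$ satisfy $$B_{\max}\le c_1(T),\quad L_I\le c_2(T),\quad S_{\max}\le c_3(T),\quad L_R\le c_4(T).$$ Let initial data $y_\pm^e:[0,\ell^e]\to\mathbb R$, $e\in\mathcal E$, be given that are Lipschitz continuous with Lipschitz constant $L_I$, satisfy $\max_{e}\sup_{x}|y^e_\pm(x)|\le B_{\max}$, and are compatible with the coupling conditions at all inner nodes. Consider boundary conditions of one of the following two types. Case (i): $S_{\mathrm{out},e}(t,\nu)=u^e_{\mathrm{out}}(t)$ for $\nu\in\mathcal V_\partial$, $e\in\mathcal E(\nu)$, $t\in(0,T)$, where each $u^e_{\mathrm{out}}$ is Lipschitz continuous with Lipschitz constant $L_I$, $\max_e\sup_{t\in[0,T]}|u^e_{\mathrm{out}}(t)|\le B_{\max}$, and the data are $C^0$-compatible, i.e. $y^e_{\mathrm{out}}(\nu)=u^e_{\mathrm{out}}(0)$ for $\nu\in\mathcal V_\partial$, $e\in\mathcal E(\nu)$. Case (ii): at each boundary node $\nu\in\mathcal V_\partial$ either the mass flow is prescribed, $m(t,\nu)=m_b(t)$, or the specific enthalpy is prescribed, $h(t,\nu)=h_b(t)$, for $0\le t\le T$, where the functions $m_b,h_b$ (depending on $\nu$) are Lipschitz continuous with Lipschitz constant $L_I$, the initial data satisfy these boundary conditions at $t=0$ (i.e.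 $C^0$-compatibility), and for all $t\in[0,T]$ $$\tilde P^{-1}(-\tfrac18 S_{\max})(-\tfrac c8 S_{\max})\le -s^e(\nu)\,m_b(t)\le \tilde P^{-1}(\tfrac18 S_{\max})\tfrac c8 S_{\max},$$ $$\tfrac{c^2}{8}(-\tfrac14 S_{\max})^2+P'\big(\tilde P^{-1}(-\tfrac18S_{\max})\big)\le h_b(t)\le \tfrac{c^2}{8}(\tfrac14 S_{\max})^2+P'\big(\tilde P^{-1}(\tfrac18S_{\max})\big),$$ respectively, where $e$ is the edge incident to $\nu$. If $\mu>0$, assume in addition that the original system in Riemann invariants, with the same boundary data as for the observer (that is, $R_{\mathrm{out},e}(t,\nu)=u^e_{\mathrm{out}}(t)$ in Case (i), or the same conditions on $m$ or $h$ in Case (ii)), with the coupling conditions, and with its own initial data, has a unique solution $\mathcal R=((R_{+,e},R_{-,e}))_{e\in\mathcal E}$ on $[0,T]$ with $R_{\pm,e}\in C^0([0,T]\times[0,\ell^e])$, $|R_{\pm,e}|\le S_{\max}$, and $R_{\pm,e}$ Lipschitz continuous with respect to $x$ with Lipschitz constant bounded by $L_R$. Then the observer system for velocity measurements, on every edge $e\in\mathcal E$, $$\partial_s S_{\pm,e}(s,\xi_{\pm}(s))=\mp\,\sigma(S_{+,e},S_{-,e})(s,\xi_\pm(s))\pm\tfrac\mu2\big(R_{+,e}-R_{-,e}-(S_{+,e}-S_{-,e})\big)(s,\xi_\pm(s))$$ along the characteristics $\xi_\pm(s)=\xi^{\mathcal S_e}_\pm(s,x,t)$ (with no $\mathcal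 R$-term if $\mu=0$), together with the initial conditions $S_{\pm,e}(0,x)=y^e_\pm(x)$, the boundary conditions of Case (i) or Case (ii), and the coupling conditions at all inner nodes, admits a solution on $[0,T]$ satisfying $$\|S_{\pm,e}\|_{L^\infty([0,T]\times[0,\ell^e])}\le C_T\qquad\text{for all } e\in\mathcal E.$$
   Context: Pressure and Riemann invariants. $p:(0,\infty)\to\mathbb R$ is smooth with $p'>0$; $P$ is a smooth pressure potential with $p'(\rho)=\rho P''(\rho)$; $\gamma\ge0$ is the friction coefficient. Fix $\rho_{\mathrm{ref}}>0$, $c=\sqrt{p'(\rho_{\mathrm{ref}})}$ and $\tilde P(\rho)=\int_{\rho_{\mathrm{ref}}}^\rho \frac{\sqrt{p'(s)}}{cs}\,ds$ (strictly increasing, $\tilde P^{-1}$ its inverse). The original system is the barotropic Euler system $\partial_t\rho+\partial_x m=0$, $\partial_t v+\partial_x h=-\gamma|v|v$ with $m=\rho v$, $h=\frac12v^2+P'(\rho)$. The Riemann invariants of a state $(\rho,v)$ are $S_\pm=\tilde P(\rho)\pm \frac vc$; conversely $v=\frac c2(S_+-S_-)$, $\rho=\tilde P^{-1}(\frac12(S_++S_-))$, and $m,h$ are regarded as functions of $(S_+,S_-)$ in this way. $R_\pm$ denotes the Riemann invariants of the original system, $S_\pm$ those of the observer system. The eigenvalues are $\lambda_\pm(S_+,S_-)=v\pm\sqrt{p'(\rho)}$, and the friction term is $\sigma(S_+,S_-)=\gamma\frac c4|S_+-S_-|(S_+-S_-)$. Characteristics. For $\mathcal S_e=(S_{+,e},S_{-,e})$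 continuous on $[0,T]\times[0,\ell^e]$ and Lipschitz in $x$, $\xi_\pm^{\mathcal S_e}(\cdot,x,t)$ is defined by $\xi_\pm^{\mathcal S_e}(t,x,t)=x$, $\partial_s\xi_\pm^{\mathcal S_e}(s,x,t)=\lambda_\pm(\mathcal S_e(s,\xi_\pm^{\mathcal S_e}(s,x,t)))$, extended up to the boundary of $[0,T]\times[0,\ell^e]$. A solution of the observer system (resp. original system) is a family of functions, continuous on $[0,T]\times[0,\ell^e]$ and Lipschitz in $x$, satisfying the stated ordinary differential equations along all these characteristics. The original system in Riemann invariants is $\partial_sR_{\pm,e}(s,\xi_\pm(s))=\mp\sigma(R_{+,e},R_{-,e})(s,\xi_\pm(s))$ along its own characteristics $\xi_\pm=\xi_\pm^{\mathcal R_e}$. Network. A network is a finite directed connected graph with edge set $\mathcal E$ and vertex set $\mathcal V$, consisting of boundary nodes $\mathcal V_\partial$ (each incident to one edge) and inner nodes $\mathcal V\setminus\mathcal V_\partial$. Each edge $e$ is identified with $(0,\ell^e)$; $\mathcal E(\nu)$ is the set of edges incident to $\nu$; $s^e(\nu)=-1$ if $e$ starts at $\nu$ and $s^e(\nu)=1$ if $e$ ends at $\nu$. All pipes have the same diameter. The coupling conditions at an inner node $\nu$ are $\sum_{e\in\mathcal E(\nu)}m^e(\nu)s^e(\nu)=0$ and $h^e(\nu)=h^f(\nu)$ for all $e,f\in\mathcal E(\nu)$. The subscript "out" at a node $\nu$ denotes the Riemann invariant directed out of the node into the edge $e$: $S_{\mathrm{out},e}(t,\nu)=S_{+,e}(t,0)$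 if $e$ starts at $\nu$, and $S_{-,e}(t,\ell^e)$ if $e$ ends at $\nu$ (similarly for $R_{\mathrm{out},e}$, $y^e_{\mathrm{out}}$). The constants $C_T,c_i(T)$ may depend on $T$, the network, $p$, $\gamma$, $\rho_{\mathrm{ref}}$ and $\mu$. *)

theory Defs
  imports "HOL-Analysis.Analysis" "Graph_Theory.Digraph_Component"
begin

section \<open>Barotropic gas and Riemann invariants\<close>

text \<open>The set \<open>X\<close> is meant to be open, so that \<^const>\<open>deriv\<close> only depends on the values on \<open>X\<close>.\<close>

definition smooth_on :: "real set \<Rightarrow> (real \<Rightarrow> real) \<Rightarrow> bool" where
  "smooth_on X f \<longleftrightarrow> (\<forall>k. \<forall>x\<in>X. (deriv ^^ k) f differentiable (at x))"

definition pressure_law :: "(real \<Rightarrow> real) \<Rightarrow> bool" where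
  "pressure_law p \<longleftrightarrow> smooth_on {0<..} p \<and> (\<forall>\<rho>>0. deriv p \<rho> > 0)"

definition pressure_potential :: "(real \<Rightarrow> real) \<Rightarrow> (real \<Rightarrow> real) \<Rightarrow> bool" where
  "pressure_potential p P \<longleftrightarrow>
     smooth_on {0<..} P \<and> (\<forall>\<rho>>0. deriv p \<rho> = \<rho> * deriv (deriv P) \<rho>)"

definition sound_speed :: "(real \<Rightarrow> real) \<Rightarrow> real \<Rightarrow> real" where
  "sound_speed p \<rho>ref = sqrt (deriv p \<rho>ref)"

definition Ptilde :: "(real \<Rightarrow> real) \<Rightarrow> real \<Rightarrow> real \<Rightarrow> real" where
  "Ptilde p \<rho>ref \<rho> =
     (LBINT s=ereal \<rho>ref..ereal \<rho>. sqrt (deriv p s) / (sound_speed p \<rho>ref * s))"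

text \<open>Only meaningful on \<open>Ptilde p \<rho>ref ` {0<..}\<close>, which need not be the whole real line.\<close>

definition Ptilde_inv :: "(real \<Rightarrow> real) \<Rightarrow> real \<Rightarrow> real \<Rightarrow> real" where
  "Ptilde_inv p \<rho>ref = inv_into {0<..} (Ptilde p \<rho>ref)"

text \<open>A state is a pair \<open>(S\<^sub>+, S\<^sub>-)\<close> of Riemann invariants.\<close>

type_synonym state = "real \<times> real"

definition velocity :: "(real \<Rightarrow> real) \<Rightarrow> real \<Rightarrow> state \<Rightarrow> real" where
  "velocity p \<rho>ref S = sound_speed p \<rho>ref / 2 * (fst S - snd S)"

definition density :: "(real \<Rightarrow> real) \<Rightarrow> real \<Rightarrow> state \<Rightarrow> real" where
  "density p \<rho>ref S = Ptilde_inv p \<rho>ref ((fst S + snd S) / 2)"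

text \<open>The states for which a (positive) density with these Riemann invariants exists.\<close>

definition physical_states :: "(real \<Rightarrow> real) \<Rightarrow> real \<Rightarrow> state set" where
  "physical_states p \<rho>ref = {S. (fst S + snd S) / 2 \<in> Ptilde p \<rho>ref ` {0<..}}"

definition mass_flow :: "(real \<Rightarrow> real) \<Rightarrow> real \<Rightarrow> state \<Rightarrow> real" where
  "mass_flow p \<rho>ref S = density p \<rho>ref S * velocity p \<rho>ref S"

definition enthalpy :: "(real \<Rightarrow> real) \<Rightarrow> (real \<Rightarrow> real) \<Rightarrow> real \<Rightarrow> state \<Rightarrow> real" where
  "enthalpy p P \<rho>ref S = (velocity p \<rho>ref S)\<^sup>2 / 2 + deriv P (density p \<rho>ref S)"

definition lambda_plus :: "(real \<Rightarrow> real) \<Rightarrow> real \<Rightarrow> state \<Rightarrow> real" where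
  "lambda_plus p \<rho>ref S = velocity p \<rho>ref S + sqrt (deriv p (density p \<rho>ref S))"

definition lambda_minus :: "(real \<Rightarrow> real) \<Rightarrow> real \<Rightarrow> state \<Rightarrow> real" where
  "lambda_minus p \<rho>ref S = velocity p \<rho>ref S - sqrt (deriv p (density p \<rho>ref S))"

definition friction :: "(real \<Rightarrow> real) \<Rightarrow> real \<Rightarrow> real \<Rightarrow> state \<Rightarrow> real" where
  "friction p \<gamma> \<rho>ref S =
     \<gamma> * (sound_speed p \<rho>ref / 4) * \<bar>fst S - snd S\<bar> * (fst S - snd S)"


section \<open>Characteristics and the equations on one edge\<close>

text \<open>
  \<open>\<xi>\<close> is a characteristic through \<open>(t, x)\<close> on the time interval \<open>J\<close>. The interval \<open>J\<close> is not
  required to be maximal and \<open>\<xi>\<close> may touch the ends \<open>0\<close> and \<open>l\<close> of the edge; requiring an equation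
  along all such curves is requiring it along the maximal characteristics up to the boundary of
  \<open>[0,T] \<times> [0,l]\<close>, since the former are the restrictions of the latter.
\<close>

definition is_characteristic ::
  "real \<Rightarrow> real \<Rightarrow> (state \<Rightarrow> real) \<Rightarrow> (real \<Rightarrow> real \<Rightarrow> state) \<Rightarrow> real \<Rightarrow> real \<Rightarrow>
   real set \<Rightarrow> (real \<Rightarrow> real) \<Rightarrow> bool" where
  "is_characteristic T l lam U x t J \<xi> \<longleftrightarrow>
     is_interval J \<and> J \<subseteq> {0..T} \<and> t \<in> J \<and> \<xi> t = x \<and>
     (\<forall>s\<in>J. \<xi> s \<in> {0..l} \<and> (\<xi> has_real_derivative lam (U s (\<xi> s))) (at s within J))"

text \<open>
  \<open>U t x\<close> is the state at time \<open>t\<close> and position \<open>x\<close>. The source \<open>q t x\<close> enters the equation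
  for \<open>S\<^sub>+\<close> with sign \<open>+\<close> and the equation for \<open>S\<^sub>-\<close> with sign \<open>-\<close>.
\<close>

definition edge_equations ::
  "(real \<Rightarrow> real) \<Rightarrow> real \<Rightarrow> real \<Rightarrow> real \<Rightarrow> real \<Rightarrow> (real \<Rightarrow> real \<Rightarrow> real) \<Rightarrow>
   (real \<Rightarrow> real \<Rightarrow> state) \<Rightarrow> bool" where
  "edge_equations p \<gamma> \<rho>ref T l q U \<longleftrightarrow>
     (\<forall>x\<in>{0..l}. \<forall>t\<in>{0..T}. \<forall>J \<xi>.
        is_characteristic T l (lambda_plus p \<rho>ref) U x t J \<xi> \<longrightarrow>
        (\<forall>s\<in>J. ((\<lambda>r. fst (U r (\<xi> r))) has_real_derivative
                 - friction p \<gamma> \<rho>ref (U s (\<xi> s)) + q s (\<xi> s)) (at s within J))) \<and>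
     (\<forall>x\<in>{0..l}. \<forall>t\<in>{0..T}. \<forall>J \<xi>.
        is_characteristic T l (lambda_minus p \<rho>ref) U x t J \<xi> \<longrightarrow>
        (\<forall>s\<in>J. ((\<lambda>r. snd (U r (\<xi> r))) has_real_derivative
                 friction p \<gamma> \<rho>ref (U s (\<xi> s)) - q s (\<xi> s)) (at s within J)))"


section \<open>Networks\<close>

text \<open>
  Parallel edges are allowed. Loops are excluded since \<open>s\<^sup>e(\<nu>)\<close> is not defined for them.
  \<open>len e\<close> is the length of \<open>e\<close>.
\<close>

definition pipe_network :: "('v,'e) pre_digraph \<Rightarrow> ('e \<Rightarrow> real) \<Rightarrow> bool" where
  "pipe_network G len \<longleftrightarrow>
     fin_digraph G \<and> loopfree_digraph G \<and> Digraph_Component.connected G \<and>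
     (\<forall>e\<in>arcs G. len e > 0)"

definition incident_edges :: "('v,'e) pre_digraph \<Rightarrow> 'v \<Rightarrow> 'e set" where
  "incident_edges G \<nu> = {e \<in> arcs G. tail G e = \<nu> \<or> head G e = \<nu>}"

definition boundary_nodes :: "('v,'e) pre_digraph \<Rightarrow> 'v set" where
  "boundary_nodes G = {\<nu> \<in> verts G. card (incident_edges G \<nu>) = 1}"

definition inner_nodes :: "('v,'e) pre_digraph \<Rightarrow> 'v set" where
  "inner_nodes G = verts G - boundary_nodes G"

definition orientation :: "('v,'e) pre_digraph \<Rightarrow> 'e \<Rightarrow> 'v \<Rightarrow> real" where
  "orientation G e \<nu> = (if tail G e = \<nu> then -1 else 1)"

text \<open>Below, \<open>W e x\<close> is the state on edge \<open>e\<close> at position \<open>x\<close>, at some fixed time.\<close>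

definition node_state ::
  "('v,'e) pre_digraph \<Rightarrow> ('e \<Rightarrow> real) \<Rightarrow> ('e \<Rightarrow> real \<Rightarrow> state) \<Rightarrow> 'e \<Rightarrow> 'v \<Rightarrow> state" where
  "node_state G len W e \<nu> = (if tail G e = \<nu> then W e 0 else W e (len e))"

definition out_invariant ::
  "('v,'e) pre_digraph \<Rightarrow> ('e \<Rightarrow> real) \<Rightarrow> ('e \<Rightarrow> real \<Rightarrow> state) \<Rightarrow> 'e \<Rightarrow> 'v \<Rightarrow> real" where
  "out_invariant G len W e \<nu> = (if tail G e = \<nu> then fst (W e 0) else snd (W e (len e)))"

definition coupling_condition ::
  "(real \<Rightarrow> real) \<Rightarrow> (real \<Rightarrow> real) \<Rightarrow> real \<Rightarrow> ('v,'e) pre_digraph \<Rightarrow> ('e \<Rightarrow> real) \<Rightarrow>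
   ('e \<Rightarrow> real \<Rightarrow> state) \<Rightarrow> 'v \<Rightarrow> bool" where
  "coupling_condition p P \<rho>ref G len W \<nu> \<longleftrightarrow>
     (\<Sum>e\<in>incident_edges G \<nu>.
        mass_flow p \<rho>ref (node_state G len W e \<nu>) * orientation G e \<nu>) = 0 \<and>
     (\<forall>e\<in>incident_edges G \<nu>. \<forall>f\<in>incident_edges G \<nu>.
        enthalpy p P \<rho>ref (node_state G len W e \<nu>) =
        enthalpy p P \<rho>ref (node_state G len W f \<nu>))"


section \<open>Boundary data\<close>

datatype node_data = Mass_Flow "real \<Rightarrow> real" | Enthalpy "real \<Rightarrow> real"

text \<open>
  \<open>Invariant_Data u\<close>: the outgoing invariants \<open>u \<nu> e\<close> are prescribed at all boundary nodes;
  \<open>Physical_Data b\<close>: mass flow or enthalpy, depending on the node, is prescribed. The functions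
  \<open>u\<close> carry the node as index as well, since both ends of an edge may be boundary nodes.
\<close>

datatype ('v,'e) boundary_data =
    Invariant_Data "'v \<Rightarrow> 'e \<Rightarrow> real \<Rightarrow> real"
  | Physical_Data "'v \<Rightarrow> node_data"

definition boundary_condition ::
  "(real \<Rightarrow> real) \<Rightarrow> (real \<Rightarrow> real) \<Rightarrow> real \<Rightarrow> ('v,'e) pre_digraph \<Rightarrow> ('e \<Rightarrow> real) \<Rightarrow>
   ('v,'e) boundary_data \<Rightarrow> real \<Rightarrow> ('e \<Rightarrow> real \<Rightarrow> state) \<Rightarrow> 'v \<Rightarrow> bool" where
  "boundary_condition p P \<rho>ref G len bd t W \<nu> \<longleftrightarrow>
     (\<forall>e\<in>incident_edges G \<nu>.
        case bd of
          Invariant_Data u \<Rightarrow> out_invariant G len W e \<nu> = u \<nu> e t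
        | Physical_Data b \<Rightarrow>
            (case b \<nu> of
               Mass_Flow mb \<Rightarrow> mass_flow p \<rho>ref (node_state G len W e \<nu>) = mb t
             | Enthalpy hb \<Rightarrow> enthalpy p P \<rho>ref (node_state G len W e \<nu>) = hb t))"

definition boundary_times :: "real \<Rightarrow> ('v,'e) boundary_data \<Rightarrow> real set" where
  "boundary_times T bd =
     (case bd of Invariant_Data u \<Rightarrow> {0<..<T} | Physical_Data b \<Rightarrow> {0..T})"

definition admissible_boundary_data ::
  "(real \<Rightarrow> real) \<Rightarrow> (real \<Rightarrow> real) \<Rightarrow> real \<Rightarrow> real \<Rightarrow> ('v,'e) pre_digraph \<Rightarrow>
   real \<Rightarrow> real \<Rightarrow> real \<Rightarrow> ('v,'e) boundary_data \<Rightarrow> bool" where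
  "admissible_boundary_data p P \<rho>ref T G B\<^sub>m\<^sub>a\<^sub>x L\<^sub>I S\<^sub>m\<^sub>a\<^sub>x bd \<longleftrightarrow>
     (let c = sound_speed p \<rho>ref; Q = Ptilde_inv p \<rho>ref in
      \<forall>\<nu>\<in>boundary_nodes G. \<forall>e\<in>incident_edges G \<nu>.
        case bd of
          Invariant_Data u \<Rightarrow>
            L\<^sub>I-lipschitz_on {0..T} (u \<nu> e) \<and> (\<forall>t\<in>{0..T}. \<bar>u \<nu> e t\<bar> \<le> B\<^sub>m\<^sub>a\<^sub>x)
        | Physical_Data b \<Rightarrow>
            (case b \<nu> of
               Mass_Flow mb \<Rightarrow>
                 L\<^sub>I-lipschitz_on {0..T} mb \<and>
                 (\<forall>t\<in>{0..T}.
                    Q (- S\<^sub>m\<^sub>a\<^sub>x / 8) * (- (c / 8) * S\<^sub>m\<^sub>a\<^sub>x) \<le> - orientation G e \<nu> * mb t \<and>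
                    - orientation G e \<nu> * mb t \<le> Q (S\<^sub>m\<^sub>a\<^sub>x / 8) * (c / 8) * S\<^sub>m\<^sub>a\<^sub>x)
             | Enthalpy hb \<Rightarrow>
                 L\<^sub>I-lipschitz_on {0..T} hb \<and>
                 (\<forall>t\<in>{0..T}.
                    c\<^sup>2 / 8 * (- S\<^sub>m\<^sub>a\<^sub>x / 4)\<^sup>2 + deriv P (Q (- S\<^sub>m\<^sub>a\<^sub>x / 8)) \<le> hb t \<and>
                    hb t \<le> c\<^sup>2 / 8 * (S\<^sub>m\<^sub>a\<^sub>x / 4)\<^sup>2 + deriv P (Q (S\<^sub>m\<^sub>a\<^sub>x / 8)))))"

text \<open>Includes the compatibility with the coupling conditions and with the boundary data at \<open>t = 0\<close>.\<close>

definition admissible_initial_data ::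
  "(real \<Rightarrow> real) \<Rightarrow> (real \<Rightarrow> real) \<Rightarrow> real \<Rightarrow> ('v,'e) pre_digraph \<Rightarrow> ('e \<Rightarrow> real) \<Rightarrow>
   real \<Rightarrow> real \<Rightarrow> ('v,'e) boundary_data \<Rightarrow> ('e \<Rightarrow> real \<Rightarrow> state) \<Rightarrow> bool" where
  "admissible_initial_data p P \<rho>ref G len B\<^sub>m\<^sub>a\<^sub>x L\<^sub>I bd y \<longleftrightarrow>
     (\<forall>e\<in>arcs G.
        L\<^sub>I-lipschitz_on {0..len e} (\<lambda>x. fst (y e x)) \<and>
        L\<^sub>I-lipschitz_on {0..len e} (\<lambda>x. snd (y e x)) \<and>
        (\<forall>x\<in>{0..len e}. \<bar>fst (y e x)\<bar> \<le> B\<^sub>m\<^sub>a\<^sub>x \<and> \<bar>snd (y e x)\<bar> \<le> B\<^sub>m\<^sub>a\<^sub>x)) \<and>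
     (\<forall>\<nu>\<in>inner_nodes G. coupling_condition p P \<rho>ref G len y \<nu>) \<and>
     (\<forall>\<nu>\<in>boundary_nodes G. boundary_condition p P \<rho>ref G len bd 0 y \<nu>)"


section \<open>Solutions on the network\<close>

definition lipschitz_in_space :: "real \<Rightarrow> real \<Rightarrow> real \<Rightarrow> (real \<Rightarrow> real \<Rightarrow> state) \<Rightarrow> bool" where
  "lipschitz_in_space L T l U \<longleftrightarrow>
     (\<forall>t\<in>{0..T}. L-lipschitz_on {0..l} (\<lambda>x. fst (U t x)) \<and>
                 L-lipschitz_on {0..l} (\<lambda>x. snd (U t x)))"

definition bounded_by :: "real \<Rightarrow> real \<Rightarrow> real \<Rightarrow> (real \<Rightarrow> real \<Rightarrow> state) \<Rightarrow> bool" where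
  "bounded_by B T l U \<longleftrightarrow>
     (\<forall>t\<in>{0..T}. \<forall>x\<in>{0..l}. \<bar>fst (U t x)\<bar> \<le> B \<and> \<bar>snd (U t x)\<bar> \<le> B)"

text \<open>\<open>U e t x\<close> is the state on edge \<open>e\<close>; \<open>q e\<close> is the source on \<open>e\<close> and \<open>y\<close> the initial data.\<close>

definition network_solution ::
  "(real \<Rightarrow> real) \<Rightarrow> (real \<Rightarrow> real) \<Rightarrow> real \<Rightarrow> real \<Rightarrow> real \<Rightarrow> ('v,'e) pre_digraph \<Rightarrow>
   ('e \<Rightarrow> real) \<Rightarrow> ('e \<Rightarrow> real \<Rightarrow> real \<Rightarrow> real) \<Rightarrow> ('v,'e) boundary_data \<Rightarrow>
   ('e \<Rightarrow> real \<Rightarrow> state) \<Rightarrow> ('e \<Rightarrow> real \<Rightarrow> real \<Rightarrow> state) \<Rightarrow> bool" where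
  "network_solution p P \<gamma> \<rho>ref T G len q bd y U \<longleftrightarrow>
     (\<forall>e\<in>arcs G.
        continuous_on ({0..T} \<times> {0..len e}) (\<lambda>(t, x). U e t x) \<and>
        (\<exists>L. lipschitz_in_space L T (len e) (U e)) \<and>
        (\<forall>t\<in>{0..T}. \<forall>x\<in>{0..len e}. U e t x \<in> physical_states p \<rho>ref) \<and>
        edge_equations p \<gamma> \<rho>ref T (len e) (q e) (U e) \<and>
        (\<forall>x\<in>{0..len e}. U e 0 x = y e x)) \<and>
     (\<forall>\<nu>\<in>inner_nodes G. \<forall>t\<in>{0..T}.
        coupling_condition p P \<rho>ref G len (\<lambda>e. U e t) \<nu>) \<and>
     (\<forall>\<nu>\<in>boundary_nodes G. \<forall>t\<in>boundary_times T bd.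
        boundary_condition p P \<rho>ref G len bd t (\<lambda>e. U e t) \<nu>)"

definition original_solution ::
  "(real \<Rightarrow> real) \<Rightarrow> (real \<Rightarrow> real) \<Rightarrow> real \<Rightarrow> real \<Rightarrow> real \<Rightarrow> ('v,'e) pre_digraph \<Rightarrow>
   ('e \<Rightarrow> real) \<Rightarrow> ('v,'e) boundary_data \<Rightarrow>
   ('e \<Rightarrow> real \<Rightarrow> state) \<Rightarrow> ('e \<Rightarrow> real \<Rightarrow> real \<Rightarrow> state) \<Rightarrow> bool" where
  "original_solution p P \<gamma> \<rho>ref T G len bd z R \<longleftrightarrow>
     network_solution p P \<gamma> \<rho>ref T G len (\<lambda>e t x. 0) bd z R"

definition observer_solution ::
  "(real \<Rightarrow> real) \<Rightarrow> (real \<Rightarrow> real) \<Rightarrow> real \<Rightarrow> real \<Rightarrow> real \<Rightarrow> ('v,'e) pre_digraph \<Rightarrow>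
   ('e \<Rightarrow> real) \<Rightarrow> real \<Rightarrow> ('e \<Rightarrow> real \<Rightarrow> real \<Rightarrow> state) \<Rightarrow> ('v,'e) boundary_data \<Rightarrow>
   ('e \<Rightarrow> real \<Rightarrow> state) \<Rightarrow> ('e \<Rightarrow> real \<Rightarrow> real \<Rightarrow> state) \<Rightarrow> bool" where
  "observer_solution p P \<gamma> \<rho>ref T G len \<mu> R bd y S \<longleftrightarrow>
     network_solution p P \<gamma> \<rho>ref T G len
       (\<lambda>e t x. \<mu> / 2 * (fst (R e t x) - snd (R e t x) - (fst (S e t x) - snd (S e t x))))
       bd y S"

text \<open>\<open>R\<close> is the unique solution in the class of solutions bounded by \<open>B\<close> and \<open>L\<close>-Lipschitz in \<open>x\<close>.\<close>

definition unique_original_solution ::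
  "(real \<Rightarrow> real) \<Rightarrow> (real \<Rightarrow> real) \<Rightarrow> real \<Rightarrow> real \<Rightarrow> real \<Rightarrow> ('v,'e) pre_digraph \<Rightarrow>
   ('e \<Rightarrow> real) \<Rightarrow> real \<Rightarrow> real \<Rightarrow> ('v,'e) boundary_data \<Rightarrow>
   ('e \<Rightarrow> real \<Rightarrow> state) \<Rightarrow> ('e \<Rightarrow> real \<Rightarrow> real \<Rightarrow> state) \<Rightarrow> bool" where
  "unique_original_solution p P \<gamma> \<rho>ref T G len B L bd z R \<longleftrightarrow>
     (let is_sol = (\<lambda>R'. original_solution p P \<gamma> \<rho>ref T G len bd z R' \<and>
            (\<forall>e\<in>arcs G. bounded_by B T (len e) (R' e) \<and>
                        lipschitz_in_space L T (len e) (R' e)))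
      in is_sol R \<and>
         (\<forall>R'. is_sol R' \<longrightarrow>
            (\<forall>e\<in>arcs G. \<forall>t\<in>{0..T}. \<forall>x\<in>{0..len e}. R' e t x = R e t x)))"

end

theory Submission
  imports Defs
begin

text \<open>
  Each invariant is written as a function of the distance to the end of the edge where it enters.
  In these coordinates both families travel to the right, and the system is discretised by the
  explicit upwind scheme, with the outgoing invariants at the nodes obtained from the incoming ones
  by solving the node conditions. Exponential weights \<open>exp (- \<beta> x)\<close> with large \<open>\<beta>\<close> absorb the
  amplification at the nodes, so the scheme stays bounded and Lipschitz on the whole of \<open>[0,T]\<close>; the
  quadratic term in the equation for the differences is harmless for small data. By compactness a
  subsequence converges to a Lipschitz limit. That the limit satisfies the differential equations
  along characteristics follows by comparing the scheme on small boxes with a quadratic function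
  transported with constant speed, so that no flow of characteristics has to be constructed.
\<close>

section \<open>Compactness and comparison\<close>

text \<open>A wave meets many nodes before time \<open>T\<close>, and each of them may multiply the
  invariants by \<open>K\<close>, a number larger than one. Between entry and exit the weight loses
  the factor \<open>exp (- (\<beta> * l1))\<close>, which beats \<open>K\<close>. The weight has to
  decay in the direction of travel, hence one coordinate per invariant; the opposite family is then
  weighted the wrong way, but it enters only through speed and source and costs no more than a
  larger growth rate \<open>\<kappa>\<close> in time. Slopes are harder than values. Into the cell
  next to a node no slope is transported; it is recovered there from the time difference at the node
  divided by the speed, so speeds must stay above \<open>lmin\<close> and \<open>\<beta>\<close> has
  to meet a second condition. In the other cells the slope obeys a Riccati inequality; while it is
  at most one, its square is bounded by the slope itself, and small data preserve this up to
  \<open>T\<close>. The threshold depends on the bounds alone, so the constants can be fixed before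
  the data and the potential.\<close>

lemma bounded_functions_cluster:
  fixes u :: "nat \<Rightarrow> 'p \<Rightarrow> real"
  assumes "\<And>k p. \<bar>u k p\<bar> \<le> r"
  obtains v where "\<And>X \<epsilon> n. finite X \<Longrightarrow> \<epsilon> > 0 \<Longrightarrow> \<exists>k\<ge>n. \<forall>p\<in>X. \<bar>u k p - v p\<bar> < \<epsilon>"
proof -
  \<comment> \<open>Tychonoff's theorem: the points \<open>p\<close> may form an uncountable set, so
    a cluster point for pointwise convergence is what compactness gives here. Uniform convergence is
    gained later from the Lipschitz bounds.\<close>
  have "compactin (product_topology (\<lambda>i. euclidean) UNIV) (Pi\<^sub>E UNIV (\<lambda>p::'p. {-r..r}))"
    by (simp add: compactin_PiE)
  then have cpt: "compact (Pi\<^sub>E UNIV (\<lambda>p::'p. {-r..r}))"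
    by (simp add: euclidean_product_topology)
  have "\<forall>F>bot. F \<le> principal (Pi\<^sub>E UNIV (\<lambda>p::'p. {-r..r})) \<longrightarrow>
          (\<exists>x\<in>(Pi\<^sub>E UNIV (\<lambda>p::'p. {-r..r})). inf (nhds x) F \<noteq> bot)"
    using cpt unfolding compact_filter
    by (simp add: bot.not_eq_extremum le_principal)
  moreover have "filtermap u sequentially > bot"
    by (simp add: bot.not_eq_extremum [symmetric] filtermap_bot_iff)
  moreover have "filtermap u sequentially \<le> principal (Pi\<^sub>E UNIV (\<lambda>p::'p. {-r..r}))"
    using assms by (auto simp: le_principal eventually_filtermap PiE_iff abs_le_iff minus_le_iff)
  ultimately obtain v where v: "inf (nhds v) (filtermap u sequentially) \<noteq> bot"
    by blast
  have "\<exists>k\<ge>n. \<forall>p\<in>X. \<bar>u k p - v p\<bar> < \<epsilon>" if X: "finite X" and \<epsilon>: "\<epsilon> > 0" for X \<epsilon> n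
  proof (rule ccontr)
    assume neg: "\<not> ?thesis"
    let ?U = "{f. \<forall>p\<in>X. f p \<in> ball (v p) \<epsilon>}"
    have "open ?U"
      by (rule product_topology_basis') (use X in auto)
    then have "eventually (\<lambda>f. f \<in> ?U) (nhds v)"
      by (rule eventually_nhds_in_open) (use \<epsilon> in auto)
    moreover have "eventually (\<lambda>f. f \<notin> ?U) (filtermap u sequentially)"
      unfolding eventually_filtermap eventually_sequentially
      using neg by (intro exI[of _ n]) (auto simp: dist_real_def abs_minus_commute)
    ultimately have "eventually (\<lambda>f. False) (inf (nhds v) (filtermap u sequentially))"
      unfolding eventually_inf by blast
    then show False using v by (simp add: trivial_limit_def)
  qed
  then show thesis by (rule that)
qed

text \<open>The right side is the second moment about \<open>x\<close> of a random walk that starts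
  at \<open>J\<close> and jumps left by one cell with probability \<open>a\<close> in each of
  \<open>M\<close> steps: the mean moves by \<open>a * h\<close> per step, and each step adds a
  variance of at most \<open>a * h\<^sup>2\<close>, the numerical diffusion. The inequalities are
  asked for only in the backward triangle of \<open>(M, J)\<close>, the discrete domain of
  dependence.\<close>

lemma upwind_compare:
  fixes u :: "nat \<Rightarrow> nat \<Rightarrow> real"
  assumes a: "0 \<le> a" "a \<le> 1" and q: "q \<ge> 0" and Mj: "M \<le> J"
    and step: "\<And>m j. m < M \<Longrightarrow> J + m < j + M \<Longrightarrow> j \<le> J \<Longrightarrow>
        u (Suc m) j \<le> (1 - a) * u m j + a * u m (j - 1) + e"
    and init: "\<And>j. J \<le> j + M \<Longrightarrow> j \<le> J \<Longrightarrow> u 0 j \<le> \<alpha> + q * (real j * h - x)\<^sup>2"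
  shows "u M J \<le> \<alpha> + real M * e + q * ((real J * h - x - real M * (a * h))\<^sup>2 + real M * (a * h\<^sup>2))"
proof -
  have "u m j \<le> \<alpha> + real m * e + q * ((real j * h - x - real m * (a * h))\<^sup>2 + real m * (a * h\<^sup>2))"
    if "m \<le> M" "J + m \<le> j + M" "j \<le> J" for m j
    using that
  proof (induction m arbitrary: j)
    case 0
    then show ?case using init by simp
  next
    case (Suc m)
    have jp: "j > 0" using Suc.prems Mj by linarith
    define z where "z = real j * h - x - real m * (a * h)"
    have 1: "u m j \<le> \<alpha> + real m * e + q * (z\<^sup>2 + real m * (a * h\<^sup>2))"
      unfolding z_def by (rule Suc.IH) (use Suc.prems in auto)
    have "u m (j - 1) \<le> \<alpha> + real m * e
       + q * ((real (j - 1) * h - x - real m * (a * h))\<^sup>2 + real m * (a * h\<^sup>2))"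
      by (rule Suc.IH) (use Suc.prems jp in auto)
    also have "real (j - 1) * h - x - real m * (a * h) = z - h"
      using jp by (simp add: z_def of_nat_diff algebra_simps)
    finally have 2: "u m (j - 1) \<le> \<alpha> + real m * e + q * ((z - h)\<^sup>2 + real m * (a * h\<^sup>2))" .
    have "u (Suc m) j \<le> (1 - a) * u m j + a * u m (j - 1) + e"
      by (rule step) (use Suc.prems in auto)
    also have "\<dots> \<le> (1 - a) * (\<alpha> + real m * e + q * (z\<^sup>2 + real m * (a * h\<^sup>2)))
        + a * (\<alpha> + real m * e + q * ((z - h)\<^sup>2 + real m * (a * h\<^sup>2))) + e"
      using 1 2 a by (intro add_mono mult_left_mono) auto
    \<comment> \<open>Averaging \<open>z\<^sup>2\<close> and \<open>(z - h)\<^sup>2\<close> with the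
      weights \<open>1 - a\<close> and \<open>a\<close> gives the square of the mean plus the
      variance \<open>a * h\<^sup>2 - a\<^sup>2 * h\<^sup>2\<close>.\<close>
    also have "\<dots> = \<alpha> + real (Suc m) * e + q * ((z - a * h)\<^sup>2 + real m * (a * h\<^sup>2) + a * h\<^sup>2 - a\<^sup>2 * h\<^sup>2)"
      by (simp add: algebra_simps power2_eq_square)
    also have "\<dots> \<le> \<alpha> + real (Suc m) * e + q * ((z - a * h)\<^sup>2 + real (Suc m) * (a * h\<^sup>2))"
      using q by (intro add_left_mono mult_left_mono) (auto simp: algebra_simps)
    also have "z - a * h = real j * h - x - real (Suc m) * (a * h)"
      by (simp add: z_def algebra_simps)
    finally show ?case .
  qed
  from this[of M J] show ?thesis using Mj by simp
qed

lemma exp_minus_one_le: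
  fixes x :: real
  assumes "0 \<le> x" "x \<le> X"
  shows "exp x - 1 \<le> x * exp X"
proof -
  have "exp x * (1 - x) \<le> exp x * exp (- x)"
    using exp_ge_add_one_self[of "- x"] by (intro mult_left_mono) auto
  then have "exp x - 1 \<le> x * exp x"
    by (simp add: exp_minus field_simps)
  also have "\<dots> \<le> x * exp X"
    using assms by (intro mult_left_mono) auto
  finally show ?thesis .
qed

text \<open>An index stands for an edge with a direction of travel, and \<open>partner\<close>
  reverses the direction. With distances measured from the entry, the opposite invariant at the same
  place is read at \<open>len i - x\<close>. One speed function \<open>\<Lambda>\<close> of the own
  and the opposite invariant serves all indices, since the gas law is symmetric under reversal of an
  edge.\<close>

locale upwind_flux =
  fixes I :: "'i set" and len :: "'i \<Rightarrow> real" and partner :: "'i \<Rightarrow> 'i" and T :: real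
    and \<Lambda> :: "real \<Rightarrow> real \<Rightarrow> real" and l1 l2 C r lmin lmax :: real
  assumes finI: "finite I"
    and partner: "i \<in> I \<Longrightarrow> partner i \<in> I" "i \<in> I \<Longrightarrow> len (partner i) = len i"
    and len: "0 < l1" "l1 \<le> l2" "i \<in> I \<Longrightarrow> l1 \<le> len i" "i \<in> I \<Longrightarrow> len i \<le> l2"
    and T: "T > 0" and C: "C \<ge> 0" and lam: "0 < lmin" "lmin \<le> lmax"
    and \<Lambda>_bound: "\<bar>u\<bar> \<le> r \<Longrightarrow> \<bar>v\<bar> \<le> r \<Longrightarrow> lmin \<le> \<Lambda> u v \<and> \<Lambda> u v \<le> lmax"
    and \<Lambda>_lip: "\<bar>u\<bar> \<le> r \<Longrightarrow> \<bar>v\<bar> \<le> r \<Longrightarrow> \<bar>u'\<bar> \<le> r \<Longrightarrow> \<bar>v'\<bar> \<le> r \<Longrightarrow>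
        \<bar>\<Lambda> u v - \<Lambda> u' v'\<bar> \<le> C * (\<bar>u - u'\<bar> + \<bar>v - v'\<bar>)"

text \<open>At rest the source has the size \<open>b\<close> of the data, and its slope in
  \<open>x\<close> is controlled by \<open>L\<close>. In time it is merely continuous, as is the
  observed solution, so the scheme must be estimated without time differences of the source.\<close>

locale upwind_source = upwind_flux I len partner T \<Lambda> l1 l2 C r lmin lmax
  for I :: "'i set" and len partner T \<Lambda> l1 l2 C r lmin lmax +
  fixes F :: "'i \<Rightarrow> real \<Rightarrow> real \<Rightarrow> real \<Rightarrow> real \<Rightarrow> real" and b L :: real
  assumes F_bound: "i \<in> I \<Longrightarrow> t \<in> {0..T} \<Longrightarrow> x \<in> {0..len i} \<Longrightarrow> \<bar>u\<bar> \<le> s \<Longrightarrow> \<bar>v\<bar> \<le> s \<Longrightarrow> s \<le> r \<Longrightarrow>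
        \<bar>F i t x u v\<bar> \<le> C * (s + b)"
    and F_lip: "i \<in> I \<Longrightarrow> t \<in> {0..T} \<Longrightarrow> x \<in> {0..len i} \<Longrightarrow> x' \<in> {0..len i} \<Longrightarrow>
        \<bar>u\<bar> \<le> r \<Longrightarrow> \<bar>v\<bar> \<le> r \<Longrightarrow> \<bar>u'\<bar> \<le> r \<Longrightarrow> \<bar>v'\<bar> \<le> r \<Longrightarrow>
        \<bar>F i t x u v - F i t x' u' v'\<bar> \<le> C * (\<bar>u - u'\<bar> + \<bar>v - v'\<bar> + L * \<bar>x - x'\<bar>)"
    and F_cont: "i \<in> I \<Longrightarrow> x \<in> {0..len i} \<Longrightarrow> \<bar>u\<bar> \<le> r \<Longrightarrow> \<bar>v\<bar> \<le> r \<Longrightarrow>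
        continuous_on {0..T} (\<lambda>t. F i t x u v)"
    and b: "b \<ge> 0" and L: "L \<ge> 0"

text \<open>\<open>\<Phi> i t g\<close> is the entry value of \<open>i\<close> determined by the
  exit values \<open>g\<close> of all indices. \<open>y_compat\<close> keeps the slope in the first
  cell bounded: a jump at a node would give a slope of the order of the inverse mesh after one time
  step.\<close>

locale upwind_data = upwind_source I len partner T \<Lambda> l1 l2 C r lmin lmax F b L
  for I :: "'i set" and len partner T \<Lambda> l1 l2 C r lmin lmax F b L +
  fixes \<Phi> :: "'i \<Rightarrow> real \<Rightarrow> ('i \<Rightarrow> real) \<Rightarrow> real" and y :: "'i \<Rightarrow> real \<Rightarrow> real" and K :: real
  assumes \<Phi>_bound: "i \<in> I \<Longrightarrow> t \<in> {0..T} \<Longrightarrow> (\<And>k. k \<in> I \<Longrightarrow> \<bar>g k\<bar> \<le> s) \<Longrightarrow> s \<le> r \<Longrightarrow>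
        \<bar>\<Phi> i t g\<bar> \<le> K * (s + b)"
    and \<Phi>_lip: "i \<in> I \<Longrightarrow> t \<in> {0..T} \<Longrightarrow> t' \<in> {0..T} \<Longrightarrow>
        (\<And>k. k \<in> I \<Longrightarrow> \<bar>g k\<bar> \<le> r) \<Longrightarrow> (\<And>k. k \<in> I \<Longrightarrow> \<bar>g' k\<bar> \<le> r) \<Longrightarrow>
        (\<And>k. k \<in> I \<Longrightarrow> \<bar>g k - g' k\<bar> \<le> s) \<Longrightarrow> \<bar>\<Phi> i t g - \<Phi> i t' g'\<bar> \<le> K * (s + L * \<bar>t - t'\<bar>)"
    and y_bound: "i \<in> I \<Longrightarrow> x \<in> {0..len i} \<Longrightarrow> \<bar>y i x\<bar> \<le> b"
    and y_lip: "i \<in> I \<Longrightarrow> x \<in> {0..len i} \<Longrightarrow> x' \<in> {0..len i} \<Longrightarrow> \<bar>y i x - y i x'\<bar> \<le> L * \<bar>x - x'\<bar>"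
    and y_compat: "i \<in> I \<Longrightarrow> y i 0 = \<Phi> i 0 (\<lambda>k. y k (len k))"
    and K: "K \<ge> 0"

text \<open>\<open>\<beta>\<close> makes the decay of the weight along an edge outweigh
  \<open>K\<close>; the condition with \<open>l1 / 2\<close> concerns slopes, which are evaluated
  one cell before the exit. \<open>A\<close> and \<open>D\<close> place the initial data below the
  weighted envelopes even at the far end of the longest edge; \<open>A \<ge> 2 * K\<close> leaves
  room for the boundary data, and the second condition on \<open>D\<close> pays for sources and
  boundary data in the entry cell. \<open>m0\<close> is large enough for the CFL condition on the
  shortest edge.\<close>

locale upwind_scheme = upwind_data I len partner T \<Lambda> l1 l2 C r lmin lmax F b L \<Phi> y K
  for I :: "'i set" and len partner T \<Lambda> l1 l2 C r lmin lmax F b L \<Phi> y K +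
  fixes \<beta> A \<kappa> D :: real and m0 :: nat
  assumes \<beta>: "\<beta> \<ge> 0" "K * lmax * exp (- (\<beta> * l1 / 2)) \<le> lmin / 4" "K * exp (- (\<beta> * l1)) \<le> 1 / 2"
    and A: "A \<ge> exp (\<beta> * l2)" "A \<ge> 2 * K"
    and \<kappa>: "\<kappa> = (lmax * \<beta> + 5 * C) * exp (\<beta> * l2)"
    and D: "D \<ge> L * exp (\<beta> * l2)" "2 * (1 + K) * C * A * b + K * L \<le> 3 / 4 * lmin * D"
    and small: "A * b * exp (\<kappa> * T) \<le> r" "D * exp (\<kappa> * T) \<le> 1"
    and m0: "lmax * T \<le> real m0 * l1"
begin

section \<open>Grid, scheme and weighted envelopes\<close>

definition "\<tau> N = T / (real m0 * real N)"
definition "mesh N i = len i / real N"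

text \<open>Every edge has \<open>N\<close> cells whatever its length, so the grid point
  \<open>j\<close> of an index is the grid point \<open>N - j\<close> of its partner and both are
  read without interpolation. The formula is meant for \<open>j > 0\<close>; at \<open>j = 0\<close>
  truncated subtraction lets the difference vanish.\<close>

definition inner_step :: "nat \<Rightarrow> nat \<Rightarrow> ('i \<Rightarrow> nat \<Rightarrow> real) \<Rightarrow> 'i \<Rightarrow> nat \<Rightarrow> real" where
  "inner_step N n W i j = W i j
     - \<tau> N / mesh N i * \<Lambda> (W i j) (W (partner i) (N - j)) * (W i j - W i (j - 1))
     + \<tau> N * F i (real n * \<tau> N) (real j * mesh N i) (W i j) (W (partner i) (N - j))"

text \<open>The entry value uses the exit values of the new time level, so the node relation holds
  exactly on every level and not just up to a time step.\<close>

primrec w :: "nat \<Rightarrow> nat \<Rightarrow> 'i \<Rightarrow> nat \<Rightarrow> real" where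
  "w N 0 = (\<lambda>i j. y i (real j * mesh N i))"
| "w N (Suc n) = (\<lambda>i j. if j = 0 then \<Phi> i (real (Suc n) * \<tau> N) (\<lambda>k. inner_step N n (w N n) k N)
                       else inner_step N n (w N n) i j)"

definition "E N n = A * b * exp (\<kappa> * (real n * \<tau> N))"
definition "E' N n = D * exp (\<kappa> * (real n * \<tau> N))"

definition sup_inv :: "nat \<Rightarrow> nat \<Rightarrow> bool" where
  "sup_inv N n \<longleftrightarrow> (\<forall>i\<in>I. \<forall>j\<le>N. \<bar>w N n i j\<bar> \<le> E N n * exp (- (\<beta> * (real j * mesh N i))))"

definition diff_inv :: "nat \<Rightarrow> nat \<Rightarrow> bool" where
  "diff_inv N n \<longleftrightarrow> (\<forall>i\<in>I. \<forall>j<N. \<bar>w N n i (Suc j) - w N n i j\<bar>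
      \<le> E' N n * mesh N i * exp (- (\<beta> * (real j * mesh N i))))"

lemma m0_pos: "real m0 > 0"
proof -
  have "0 < lmax * T" using lam T by auto
  with m0 len(1) have "0 < real m0 * l1" by linarith
  with len(1) show ?thesis by (simp add: zero_less_mult_iff)
qed

lemma expl2: "exp (\<beta> * l2) \<ge> 1"
  using len(1,2) \<beta>(1) by simp

lemma A_ge: "A \<ge> 1"
  using expl2 A(1) by linarith

lemma D_ge: "D \<ge> L" "D \<ge> 0"
proof -
  have "L * 1 \<le> L * exp (\<beta> * l2)" using expl2 L by (intro mult_left_mono) auto
  then show "D \<ge> L" "D \<ge> 0" using D(1) L by auto
qed

lemma kappa_nonneg: "\<kappa> \<ge> 0"
  unfolding \<kappa> using lam \<beta> C by auto

lemma tau_pos: "N > 0 \<Longrightarrow> \<tau> N > 0"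
  using T m0_pos by (simp add: \<tau>_def)

lemma len_pos: "i \<in> I \<Longrightarrow> len i > 0"
  using len(1) len(3)[of i] by linarith

lemma mesh_pos: "i \<in> I \<Longrightarrow> N > 0 \<Longrightarrow> mesh N i > 0"
  using len_pos by (simp add: mesh_def)

lemma mesh_partner: "i \<in> I \<Longrightarrow> mesh N (partner i) = mesh N i"
  using partner by (simp add: mesh_def)

lemma mesh_N: "N > 0 \<Longrightarrow> real N * mesh N i = len i"
  by (simp add: mesh_def)

lemma mesh_in: "i \<in> I \<Longrightarrow> N > 0 \<Longrightarrow> j \<le> N \<Longrightarrow> real j * mesh N i \<in> {0..len i}"
  using len_pos[of i] by (auto simp: mesh_def field_simps)

text \<open>The ratio of time step and mesh, independent of \<open>N\<close>; times the speed it is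
  the Courant number.\<close>

definition "\<theta> i = T / (real m0 * len i)"

lemma theta_pos: "i \<in> I \<Longrightarrow> \<theta> i > 0"
  using T m0_pos len_pos by (simp add: \<theta>_def)

lemma tau_mesh: "i \<in> I \<Longrightarrow> N > 0 \<Longrightarrow> \<tau> N = \<theta> i * mesh N i"
  using len_pos[of i] m0_pos by (simp add: \<theta>_def mesh_def \<tau>_def field_simps)

lemma tau_div_mesh: "i \<in> I \<Longrightarrow> N > 0 \<Longrightarrow> \<tau> N / mesh N i = \<theta> i"
  using tau_mesh[of i N] mesh_pos[of i N] by simp

lemma cfl: "i \<in> I \<Longrightarrow> \<theta> i * lmax \<le> 1"
proof -
  assume i: "i \<in> I"
  have "lmax * T \<le> real m0 * len i"
    using m0 mult_left_mono[OF len(3)[OF i], of "real m0"] m0_pos by linarith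
  then show ?thesis
    using m0_pos len_pos[OF i] by (simp add: \<theta>_def divide_simps mult.commute)
qed

lemma time_in: "N > 0 \<Longrightarrow> n \<le> m0 * N \<Longrightarrow> real n * \<tau> N \<in> {0..T}"
proof -
  assume N: "N > 0" "n \<le> m0 * N"
  have "real n \<le> real (m0 * N)" using N by linarith
  then have "real n * T \<le> real (m0 * N) * T" using T by simp
  then show ?thesis using N T m0_pos by (simp add: \<tau>_def field_simps)
qed

lemma E_nonneg: "E N n \<ge> 0"
  using A_ge b by (simp add: E_def)

lemma E'_nonneg: "E' N n \<ge> 0"
  using D_ge by (simp add: E'_def)

lemma exp_time_ge: "N > 0 \<Longrightarrow> exp (\<kappa> * (real n * \<tau> N)) \<ge> 1"
  using kappa_nonneg tau_pos[of N] by (simp add: zero_le_mult_iff)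

lemma b_le_E: "N > 0 \<Longrightarrow> b \<le> E N n"
proof -
  assume N: "N > 0"
  have "1 * b * 1 \<le> A * b * exp (\<kappa> * (real n * \<tau> N))"
    using A_ge b exp_time_ge[OF N] by (intro mult_mono) auto
  then show ?thesis by (simp add: E_def)
qed

lemma D_le_E': "N > 0 \<Longrightarrow> D \<le> E' N n"
proof -
  assume N: "N > 0"
  have "D * 1 \<le> D * exp (\<kappa> * (real n * \<tau> N))"
    using D_ge exp_time_ge[OF N] by (intro mult_mono) auto
  then show ?thesis by (simp add: E'_def)
qed

lemma exp_time_le: "N > 0 \<Longrightarrow> n \<le> m0 * N \<Longrightarrow> exp (\<kappa> * (real n * \<tau> N)) \<le> exp (\<kappa> * T)"
  using kappa_nonneg time_in[of N n] by (auto intro!: mult_left_mono)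

lemma E_le_r: "N > 0 \<Longrightarrow> n \<le> m0 * N \<Longrightarrow> E N n \<le> r"
proof -
  assume N: "N > 0" "n \<le> m0 * N"
  have "E N n \<le> A * b * exp (\<kappa> * T)"
    unfolding E_def using A_ge b exp_time_le[OF N] by (intro mult_left_mono) auto
  then show ?thesis using small by simp
qed

lemma E'_le_1: "N > 0 \<Longrightarrow> n \<le> m0 * N \<Longrightarrow> E' N n \<le> 1"
proof -
  assume N: "N > 0" "n \<le> m0 * N"
  have "E' N n \<le> D * exp (\<kappa> * T)"
    unfolding E'_def using D_ge exp_time_le[OF N] by (intro mult_left_mono) auto
  then show ?thesis using small by simp
qed

lemma exp_Suc: "exp (\<kappa> * (real (Suc n) * \<tau> N)) = exp (\<kappa> * (real n * \<tau> N)) * exp (\<kappa> * \<tau> N)"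
  by (simp add: algebra_simps flip: exp_add)

lemma E_Suc: "E N (Suc n) = E N n * exp (\<kappa> * \<tau> N)"
  unfolding E_def exp_Suc by simp

lemma E'_Suc: "E' N (Suc n) = E' N n * exp (\<kappa> * \<tau> N)"
  unfolding E'_def exp_Suc by simp

lemma E'_Suc_ge: "N > 0 \<Longrightarrow> E' N n \<le> E' N (Suc n)"
  using E'_nonneg[of N n] kappa_nonneg tau_pos[of N] by (simp add: E'_Suc mult_le_cancel_left1)

lemma w_le_E:
  assumes "sup_inv N n" "i \<in> I" "j \<le> N" "N > 0"
  shows "\<bar>w N n i j\<bar> \<le> E N n"
proof -
  have "\<bar>w N n i j\<bar> \<le> E N n * exp (- (\<beta> * (real j * mesh N i)))"
    using assms by (auto simp: sup_inv_def)
  also have "\<dots> \<le> E N n * 1"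
    using E_nonneg \<beta>(1) mesh_pos[of i N] assms by (intro mult_left_mono) auto
  finally show ?thesis by simp
qed

lemma diff_le_E':
  assumes "diff_inv N n" "i \<in> I" "j < N" "N > 0"
  shows "\<bar>w N n i (Suc j) - w N n i j\<bar> \<le> E' N n * mesh N i"
proof -
  have "\<bar>w N n i (Suc j) - w N n i j\<bar> \<le> E' N n * mesh N i * exp (- (\<beta> * (real j * mesh N i)))"
    using assms by (auto simp: diff_inv_def)
  also have "\<dots> \<le> E' N n * mesh N i * 1"
    using E'_nonneg \<beta>(1) mesh_pos[of i N] assms by (intro mult_left_mono) auto
  finally show ?thesis by simp
qed

text \<open>The growth factor \<open>\<kappa>\<close> absorbs the weight of the upwind neighbour and the source terms.\<close>

lemma weighted_transport:
  assumes i: "i \<in> I" and N: "N > 0" and a: "0 \<le> a" "a \<le> \<theta> i * lmax" and e: "e \<ge> 0"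
    and x: "0 \<le> x" "x \<le> l2"
    and u: "\<bar>u\<bar> \<le> e * exp (- (\<beta> * x))" and v: "\<bar>v\<bar> \<le> e * exp (- (\<beta> * (x - mesh N i)))"
    and z: "\<bar>z\<bar> \<le> 5 * C * e"
  shows "\<bar>(1 - a) * u + a * v + \<tau> N * z\<bar> \<le> e * exp (\<kappa> * \<tau> N) * exp (- (\<beta> * x))"
proof -
  let ?h = "mesh N i" and ?G = "exp (\<beta> * l2)" and ?g = "exp (- (\<beta> * x))"
  have h: "0 < ?h" "?h \<le> l2"
  proof -
    show "0 < ?h" using mesh_pos i N by auto
    have "?h \<le> len i" using mesh_in[OF i N, of 1] N by auto
    then show "?h \<le> l2" using len(4)[OF i] by auto
  qed
  have a1: "a \<le> 1" using a cfl[OF i] by linarith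
  have tau: "\<tau> N > 0" using tau_pos N by auto
  \<comment> \<open>The upwind neighbour has a weight larger by the factor
    \<open>exp (\<beta> * ?h)\<close>. A Courant number times the mesh is at most
    \<open>lmax\<close> times \<open>\<tau> N\<close>, so the excess is of the order of one time
    step and adds up to finite growth.\<close>
  have "exp (\<beta> * ?h) - 1 \<le> \<beta> * ?h * ?G"
    by (rule exp_minus_one_le) (use \<beta>(1) h in \<open>auto intro!: mult_left_mono\<close>)
  then have "a * (exp (\<beta> * ?h) - 1) \<le> (\<theta> i * lmax) * (\<beta> * ?h * ?G)"
    using a \<beta>(1) h by (intro mult_mono) auto
  also have "\<dots> = \<tau> N * (lmax * \<beta> * ?G)"
    using tau_mesh[OF i N] by simp
  finally have 1: "a * (exp (\<beta> * ?h) - 1) \<le> \<tau> N * (lmax * \<beta> * ?G)" .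
  \<comment> \<open>The term \<open>z\<close> may contain the partner, whose weight decays in the
    opposite direction, so it is bounded without weight; inserting the weight at \<open>x\<close>
    costs the factor \<open>?G\<close>.\<close>
  have "?g * ?G \<ge> 1"
  proof -
    have "\<beta> * x \<le> \<beta> * l2" using x \<beta>(1) by (intro mult_left_mono) auto
    then show ?thesis by (simp flip: exp_add)
  qed
  then have "5 * C * e * 1 \<le> 5 * C * e * (?g * ?G)"
    using C e by (intro mult_left_mono) auto
  then have 2: "\<bar>z\<bar> \<le> e * ?g * (5 * C * ?G)"
    using z by (simp add: mult_ac)
  have ev: "exp (- (\<beta> * (x - ?h))) = ?g * exp (\<beta> * ?h)"
    by (simp add: algebra_simps flip: exp_add)
  have "\<bar>(1 - a) * u + a * v + \<tau> N * z\<bar> \<le> (1 - a) * \<bar>u\<bar> + a * \<bar>v\<bar> + \<tau> N * \<bar>z\<bar>"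
  proof -
    have "\<bar>(1 - a) * u\<bar> = (1 - a) * \<bar>u\<bar>" "\<bar>a * v\<bar> = a * \<bar>v\<bar>" "\<bar>\<tau> N * z\<bar> = \<tau> N * \<bar>z\<bar>"
      using a a1 tau by (simp_all add: abs_mult)
    then show ?thesis by linarith
  qed
  also have "\<dots> \<le> (1 - a) * (e * ?g) + a * (e * (?g * exp (\<beta> * ?h))) + \<tau> N * (e * ?g * (5 * C * ?G))"
    using u v[unfolded ev] 2 a a1 tau by (intro add_mono mult_left_mono) auto
  also have "\<dots> = e * ?g * (1 + a * (exp (\<beta> * ?h) - 1) + \<tau> N * (5 * C * ?G))"
    by (simp add: algebra_simps)
  also have "\<dots> \<le> e * ?g * (1 + \<tau> N * (lmax * \<beta> * ?G) + \<tau> N * (5 * C * ?G))"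
    using 1 e by (intro mult_left_mono) auto
  also have "\<dots> = e * ?g * (1 + \<kappa> * \<tau> N)"
    by (simp add: \<kappa> algebra_simps)
  also have "\<dots> \<le> e * ?g * exp (\<kappa> * \<tau> N)"
    using e by (intro mult_left_mono) (auto simp: exp_ge_add_one_self)
  finally show ?thesis by (simp add: mult_ac)
qed

end

section \<open>Bounds for the upwind scheme\<close>

context upwind_scheme begin

definition "cour N n i j = \<theta> i * \<Lambda> (w N n i j) (w N n (partner i) (N - j))"
definition "src N n i j =
  F i (real n * \<tau> N) (real j * mesh N i) (w N n i j) (w N n (partner i) (N - j))"

text \<open>Under the CFL condition this is a convex combination of two old values plus the source,
  which is what makes the scheme stable.\<close>

lemma w_Suc:
  assumes "i \<in> I" "N > 0" "j > 0"
  shows "w N (Suc n) i j = (1 - cour N n i j) * w N n i j + cour N n i j * w N n i (j - 1) + \<tau> N * src N n i j"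
  using assms by (simp add: inner_step_def tau_div_mesh cour_def src_def algebra_simps)

text \<open>For \<open>n = 0\<close> this is the compatibility of the initial data; on later levels
  it holds because the scheme inserts the new exit values.\<close>

lemma w_boundary:
  assumes "i \<in> I" "N > 0"
  shows "w N n i 0 = \<Phi> i (real n * \<tau> N) (\<lambda>k. w N n k N)"
proof (cases n)
  case 0
  then show ?thesis using assms y_compat[of i] by (simp add: mesh_N)
next
  case (Suc m)
  have "w N (Suc m) i 0 = \<Phi> i (real (Suc m) * \<tau> N) (\<lambda>k. inner_step N m (w N m) k N)"
    by simp
  also have "(\<lambda>k. inner_step N m (w N m) k N) = (\<lambda>k. w N (Suc m) k N)"
    using assms by auto
  finally show ?thesis using Suc by simp
qed

lemma w_le_r:
  assumes "sup_inv N n" "i \<in> I" "j \<le> N" "N > 0" "n \<le> m0 * N"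
  shows "\<bar>w N n i j\<bar> \<le> r"
  using w_le_E[OF assms(1-4)] E_le_r[OF assms(4,5)] by linarith

lemma cour_bounds:
  assumes "sup_inv N n" "i \<in> I" "j \<le> N" "N > 0" "n \<le> m0 * N"
  shows "\<theta> i * lmin \<le> cour N n i j" "cour N n i j \<le> \<theta> i * lmax" "0 \<le> cour N n i j" "cour N n i j \<le> 1"
proof -
  have "lmin \<le> \<Lambda> (w N n i j) (w N n (partner i) (N - j)) \<and>
        \<Lambda> (w N n i j) (w N n (partner i) (N - j)) \<le> lmax"
    by (rule \<Lambda>_bound; rule w_le_r) (use assms partner in auto)
  then show "\<theta> i * lmin \<le> cour N n i j" "cour N n i j \<le> \<theta> i * lmax" "0 \<le> cour N n i j"
    using theta_pos[OF assms(2)] lam by (auto simp: cour_def)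
  then show "cour N n i j \<le> 1" using cfl[OF assms(2)] by linarith
qed

lemma src_bound:
  assumes "sup_inv N n" "i \<in> I" "j \<le> N" "N > 0" "n \<le> m0 * N"
  shows "\<bar>src N n i j\<bar> \<le> 2 * C * E N n"
proof -
  have "\<bar>src N n i j\<bar> \<le> C * (E N n + b)"
    unfolding src_def
  proof (rule F_bound)
    show "\<bar>w N n (partner i) (N - j)\<bar> \<le> E N n" by (rule w_le_E) (use assms partner in auto)
  qed (use assms time_in mesh_in w_le_E E_le_r in auto)
  also have "\<dots> \<le> C * (E N n + E N n)"
    using C b_le_E[of N n] assms by (intro mult_left_mono) auto
  finally show ?thesis by simp
qed

lemma Ab_le_E: "N > 0 \<Longrightarrow> A * b \<le> E N n"
proof -
  assume N: "N > 0"
  have "A * b * 1 \<le> A * b * exp (\<kappa> * (real n * \<tau> N))"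
    using A_ge b exp_time_ge[OF N] by (intro mult_left_mono) auto
  then show ?thesis by (simp add: E_def)
qed

lemma sup_inv_0: 
  assumes "N > 0" shows "sup_inv N 0"
  unfolding sup_inv_def
proof (intro ballI allI impI)
  fix i j assume i: "i \<in> I" and j: "j \<le> N"
  let ?x = "real j * mesh N i"
  have x: "?x \<in> {0..len i}" using mesh_in i j assms by auto
  have "\<beta> * ?x \<le> \<beta> * l2" using x \<beta>(1) len(4)[OF i] by (intro mult_left_mono) auto
  then have "1 \<le> exp (\<beta> * l2) * exp (- (\<beta> * ?x))" by (simp flip: exp_add)
  also have "\<dots> \<le> A * exp (- (\<beta> * ?x))" using A by (intro mult_right_mono) auto
  finally have "b * 1 \<le> b * (A * exp (- (\<beta> * ?x)))" using b by (intro mult_left_mono) auto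
  then show "\<bar>w N 0 i j\<bar> \<le> E N 0 * exp (- (\<beta> * ?x))"
    using y_bound[OF i x] by (simp add: E_def mult_ac)
qed

declare w.simps [simp del]

text \<open>In the interior the convex combination respects the envelope up to the growth factor. At
  an entry, the exit values lie below the envelope by the factor
  \<open>exp (- (\<beta> * l1))\<close>, so \<open>K\<close> times them uses half of the admissible
  size; \<open>A \<ge> 2 * K\<close> fits the boundary data into the other half.\<close>

lemma sup_inv_Suc:
  assumes inv: "sup_inv N n" and N: "N > 0" and n: "Suc n \<le> m0 * N"
  shows "sup_inv N (Suc n)"
proof -
  have interior: "\<bar>w N (Suc n) i j\<bar> \<le> E N (Suc n) * exp (- (\<beta> * (real j * mesh N i)))"
    if i: "i \<in> I" and j: "0 < j" "j \<le> N" for i j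
    unfolding w_Suc[OF i N j(1)] E_Suc
  proof (rule weighted_transport)
    show "0 \<le> cour N n i j" "cour N n i j \<le> \<theta> i * lmax"
      using cour_bounds[OF inv i j(2) N] n by auto
    show "0 \<le> real j * mesh N i" "real j * mesh N i \<le> l2"
      using mesh_in[OF i N j(2)] len(4)[OF i] by auto
    show "\<bar>w N n i j\<bar> \<le> E N n * exp (- (\<beta> * (real j * mesh N i)))"
      using inv i j by (auto simp: sup_inv_def)
    have "\<bar>w N n i (j - 1)\<bar> \<le> E N n * exp (- (\<beta> * (real (j - 1) * mesh N i)))"
      using inv i j unfolding sup_inv_def by (meson diff_le_self le_trans)
    also have "real (j - 1) * mesh N i = real j * mesh N i - mesh N i"
      using j by (simp add: of_nat_diff algebra_simps)
    finally show "\<bar>w N n i (j - 1)\<bar> \<le> E N n * exp (- (\<beta> * (real j * mesh N i - mesh N i)))" .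
    have "2 * C * E N n \<le> 5 * C * E N n" using C E_nonneg[of N n] by (intro mult_right_mono) auto
    then show "\<bar>src N n i j\<bar> \<le> 5 * C * E N n"
      using src_bound[OF inv i j(2) N] n by linarith
  qed (use i N E_nonneg in auto)
  have boundary: "\<bar>w N (Suc n) i 0\<bar> \<le> E N (Suc n)" if i: "i \<in> I" for i
  proof -
    let ?s = "E N (Suc n) * exp (- (\<beta> * l1))"
    have "\<bar>w N (Suc n) k N\<bar> \<le> ?s" if k: "k \<in> I" for k
    proof -
      have "\<bar>w N (Suc n) k N\<bar> \<le> E N (Suc n) * exp (- (\<beta> * len k))"
        using interior[OF k N] N by (simp add: mesh_N)
      also have "\<dots> \<le> ?s"
        using E_nonneg \<beta>(1) len(3)[OF k] by (intro mult_left_mono) (auto intro!: mult_left_mono)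
      finally show ?thesis .
    qed
    moreover have "?s \<le> r"
    proof -
      have "?s \<le> E N (Suc n) * 1"
        using E_nonneg \<beta>(1) len(1) by (intro mult_left_mono) auto
      then show ?thesis using E_le_r[OF N n] by simp
    qed
    ultimately have "\<bar>w N (Suc n) i 0\<bar> \<le> K * (?s + b)"
      unfolding w_boundary[OF i N, of "Suc n"] using time_in[OF N n] i by (intro \<Phi>_bound) auto
    also have "\<dots> = E N (Suc n) * (K * exp (- (\<beta> * l1))) + K * b"
      by (simp add: algebra_simps)
    also have "\<dots> \<le> E N (Suc n) * (1 / 2) + E N (Suc n) / 2"
    proof (rule add_mono)
      show "E N (Suc n) * (K * exp (- (\<beta> * l1))) \<le> E N (Suc n) * (1 / 2)"
        using E_nonneg \<beta>(3) by (intro mult_left_mono) auto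
      have "2 * K * b \<le> A * b" using A b by (intro mult_right_mono) auto
      then show "K * b \<le> E N (Suc n) / 2" using Ab_le_E[OF N, of "Suc n"] by simp
    qed
    finally show ?thesis by simp
  qed
  show ?thesis unfolding sup_inv_def
  proof (intro ballI allI impI)
    fix i j assume "i \<in> I" "j \<le> N"
    then show "\<bar>w N (Suc n) i j\<bar> \<le> E N (Suc n) * exp (- (\<beta> * (real j * mesh N i)))"
      using interior[of i j] boundary[of i] by (cases "j = 0") auto
  qed
qed

lemma sup_inv: "N > 0 \<Longrightarrow> n \<le> m0 * N \<Longrightarrow> sup_inv N n"
  by (induction n) (auto intro: sup_inv_0 sup_inv_Suc)

section \<open>Differences of the scheme in time and in space\<close>

lemma time_diff_interior:
  assumes i: "i \<in> I" and N: "N > 0" and n: "n \<le> m0 * N" and j: "j < N"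
  shows "\<bar>w N (Suc n) i (Suc j) - w N n i (Suc j)\<bar>
     \<le> \<theta> i * lmax * \<bar>w N n i (Suc j) - w N n i j\<bar> + \<tau> N * (2 * C * E N n)"
proof -
  let ?a = "cour N n i (Suc j)" and ?d = "w N n i (Suc j) - w N n i j"
  note inv = sup_inv[OF N n]
  have a: "0 \<le> ?a" "?a \<le> \<theta> i * lmax" using cour_bounds[OF inv i _ N n, of "Suc j"] j by auto
  have s: "\<bar>src N n i (Suc j)\<bar> \<le> 2 * C * E N n" using src_bound[OF inv i _ N n, of "Suc j"] j by auto
  have tau: "\<tau> N > 0" using tau_pos N by auto
  \<comment> \<open>The time difference is read off the scheme, which expresses it by the space
    difference and the source.\<close>
  have "w N (Suc n) i (Suc j) - w N n i (Suc j) = \<tau> N * src N n i (Suc j) - ?a * ?d"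
    using w_Suc[OF i N, of "Suc j" n] by (simp add: algebra_simps)
  then have "\<bar>w N (Suc n) i (Suc j) - w N n i (Suc j)\<bar> \<le> \<bar>\<tau> N * src N n i (Suc j)\<bar> + \<bar>?a * ?d\<bar>"
    by linarith
  also have "\<dots> = \<tau> N * \<bar>src N n i (Suc j)\<bar> + ?a * \<bar>?d\<bar>"
    using a tau by (simp add: abs_mult)
  also have "\<dots> \<le> \<tau> N * (2 * C * E N n) + \<theta> i * lmax * \<bar>?d\<bar>"
    using a tau s by (intro add_mono mult_left_mono mult_right_mono) auto
  finally show ?thesis by simp
qed

text \<open>Through \<open>\<Phi>\<close> the entry changes in a time step by at most
  \<open>K\<close> times the change at the exits plus that of the boundary data. The change at an
  exit involves the slope in the last cell, which is damped by the weight at the left end of that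
  cell; \<open>N > 1\<close> puts this point at least \<open>l1 / 2\<close> away from the
  entry.\<close>

lemma time_diff_boundary:
  assumes i: "i \<in> I" and N: "N > 1" and n: "Suc n \<le> m0 * N" and inv: "diff_inv N n"
  shows "\<bar>w N (Suc n) i 0 - w N n i 0\<bar>
     \<le> K * (\<tau> N * (lmax * exp (- (\<beta> * l1 / 2)) * E' N n + 2 * C * E N n) + L * \<tau> N)"
proof -
  have N0: "N > 0" using N by simp
  let ?s = "\<tau> N * (lmax * exp (- (\<beta> * l1 / 2)) * E' N n + 2 * C * E N n)"
  have "\<bar>w N (Suc n) k N - w N n k N\<bar> \<le> ?s" if k: "k \<in> I" for k
  proof -
    have h: "mesh N k > 0" using mesh_pos k N0 by auto
    have "2 * mesh N k \<le> len k"
      using N len_pos[OF k] by (simp add: mesh_def field_simps)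
    then have x: "l1 / 2 \<le> real (N - 1) * mesh N k"
      using len(3)[OF k] mesh_N[OF N0, of k] N by (simp add: of_nat_diff algebra_simps)
    have "\<bar>w N n k N - w N n k (N - 1)\<bar> \<le> E' N n * mesh N k * exp (- (\<beta> * (real (N - 1) * mesh N k)))"
      using inv k N by (auto simp: diff_inv_def dest!: bspec spec[of _ "N - 1"])
    also have "\<dots> \<le> E' N n * mesh N k * exp (- (\<beta> * (l1 / 2)))"
    proof -
      have "\<beta> * (l1 / 2) \<le> \<beta> * (real (N - 1) * mesh N k)" using \<beta>(1) x by (intro mult_left_mono)
      then show ?thesis using E'_nonneg h by (intro mult_left_mono) auto
    qed
    finally have d: "\<bar>w N n k N - w N n k (N - 1)\<bar> \<le> E' N n * mesh N k * exp (- (\<beta> * (l1 / 2)))" .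
    have "\<bar>w N (Suc n) k N - w N n k N\<bar> \<le> \<theta> k * lmax * \<bar>w N n k N - w N n k (N - 1)\<bar> + \<tau> N * (2 * C * E N n)"
      using time_diff_interior[OF k N0, of n "N - 1"] n N by simp
    also have "\<dots> \<le> \<theta> k * lmax * (E' N n * mesh N k * exp (- (\<beta> * (l1 / 2)))) + \<tau> N * (2 * C * E N n)"
      using theta_pos[OF k] lam by (intro add_right_mono mult_left_mono d) auto
    also have "\<dots> = ?s" using tau_mesh[OF k N0] by (simp add: algebra_simps)
    finally show ?thesis .
  qed
  then have "\<bar>w N (Suc n) i 0 - w N n i 0\<bar> \<le> K * (?s + L * \<bar>real (Suc n) * \<tau> N - real n * \<tau> N\<bar>)"
    unfolding w_boundary[OF i N0]
    using time_in[OF N0, of n] time_in[OF N0 n] n i N0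
    by (intro \<Phi>_lip w_le_r sup_inv) auto
  also have "real (Suc n) * \<tau> N - real n * \<tau> N = \<tau> N" by (simp add: algebra_simps)
  finally show ?thesis using tau_pos[OF N0] by simp
qed

lemma diff_inv_0: 
  assumes "N > 0" shows "diff_inv N 0"
  unfolding diff_inv_def
proof (intro ballI allI impI)
  fix i j assume i: "i \<in> I" and j: "j < N"
  let ?h = "mesh N i"
  let ?x = "real j * ?h"
  have h: "?h > 0" using mesh_pos i assms by auto
  have x: "?x \<in> {0..len i}" "real (Suc j) * ?h \<in> {0..len i}" using mesh_in[OF i assms, of j] mesh_in[OF i assms, of "Suc j"] j by auto
  have "\<beta> * ?x \<le> \<beta> * l2" using x \<beta>(1) len(4)[OF i] by (intro mult_left_mono) auto
  then have "L * 1 \<le> L * (exp (\<beta> * l2) * exp (- (\<beta> * ?x)))" using L by (intro mult_left_mono) (auto simp flip: exp_add)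
  also have "\<dots> \<le> D * exp (- (\<beta> * ?x))" using mult_right_mono[OF D(1), of "exp (- (\<beta> * ?x))"] by (simp add: mult_ac)
  finally have "L * ?h \<le> (D * exp (- (\<beta> * ?x))) * ?h" using h by (intro mult_right_mono) auto
  moreover have "real (Suc j) * ?h - ?x = ?h" by (simp add: algebra_simps)
  then have "\<bar>y i (real (Suc j) * ?h) - y i ?x\<bar> \<le> L * ?h"
    using y_lip[OF i x(2) x(1)] h by simp
  ultimately have "\<bar>y i (real (Suc j) * ?h) - y i ?x\<bar> \<le> (D * exp (- (\<beta> * ?x))) * ?h" by linarith
  then show "\<bar>w N 0 i (Suc j) - w N 0 i j\<bar> \<le> E' N 0 * ?h * exp (- (\<beta> * ?x))"
    unfolding E'_def w.simps by (simp add: mult_ac del: of_nat_Suc)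
qed

text \<open>Subtracting the scheme in neighbouring cells gives the same kind of transport for the
  differences; the variation of the Courant number appears as a quadratic term of lower order. The
  first cell has no upwind neighbour: its difference changes by its own outflow, the source and the
  time difference at the node.\<close>

lemma diff_inv_Suc:
  assumes inv: "diff_inv N n" and N: "N > 1" and n: "Suc n \<le> m0 * N"
  shows "diff_inv N (Suc n)"
  unfolding diff_inv_def
proof (intro ballI allI impI)
  fix i j assume i: "i \<in> I" and j: "j < N"
  have N0: "N > 0" and n': "n \<le> m0 * N" using N n by auto
  note sinv = sup_inv[OF N0 n']
  let ?h = "mesh N i" and ?x = "real j * mesh N i" and ?a = "cour N n i (Suc j)"
  define e where "e = E' N n * ?h"
  have h: "?h > 0" using mesh_pos i N0 by auto
  have tau: "\<tau> N > 0" using tau_pos N0 by auto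
  have e0: "e \<ge> 0" using E'_nonneg h by (simp add: e_def)
  have a: "\<theta> i * lmin \<le> ?a" "?a \<le> \<theta> i * lmax" "0 \<le> ?a" "?a \<le> 1"
    using cour_bounds[OF sinv i _ N0 n', of "Suc j"] j by auto
  have d: "\<bar>w N n i (Suc k) - w N n i k\<bar> \<le> e * exp (- (\<beta> * (real k * mesh N i)))" if "k < N" for k
    using inv i that by (simp add: diff_inv_def e_def)
  have e_time: "e * exp (\<kappa> * \<tau> N) = E' N (Suc n) * ?h" by (simp add: e_def E'_Suc)
  show "\<bar>w N (Suc n) i (Suc j) - w N (Suc n) i j\<bar> \<le> E' N (Suc n) * ?h * exp (- (\<beta> * ?x))"
  proof (cases j)
    case 0
    let ?d = "w N n i (Suc 0) - w N n i 0"
    let ?R = "K * (\<tau> N * (lmax * exp (- (\<beta> * l1 / 2)) * E' N n + 2 * C * E N n) + L * \<tau> N)"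
    have eq: "w N (Suc n) i (Suc 0) - w N (Suc n) i 0
      = (1 - ?a) * ?d + \<tau> N * src N n i (Suc 0) - (w N (Suc n) i 0 - w N n i 0)"
    proof -
      have "(1 - a) * u + a * v + t - z = (1 - a) * (u - v) + t - (z - v)" for a u v t z :: real
        by (simp add: algebra_simps)
      then show ?thesis using w_Suc[OF i N0, of "Suc 0" n] 0 by simp
    qed
    have "\<bar>w N (Suc n) i (Suc 0) - w N (Suc n) i 0\<bar>
      \<le> \<bar>(1 - ?a) * ?d\<bar> + \<bar>\<tau> N * src N n i (Suc 0)\<bar> + \<bar>w N (Suc n) i 0 - w N n i 0\<bar>"
      unfolding eq by linarith
    also have "\<dots> \<le> (1 - ?a) * e + \<tau> N * (2 * C * E N n) + ?R"
    proof (intro add_mono)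
      show "\<bar>(1 - ?a) * ?d\<bar> \<le> (1 - ?a) * e"
        using d[of 0] N0 a by (simp add: abs_mult mult_left_mono)
      show "\<bar>\<tau> N * src N n i (Suc 0)\<bar> \<le> \<tau> N * (2 * C * E N n)"
        using src_bound[OF sinv i _ N0 n', of "Suc 0"] N0 tau by (simp add: abs_mult)
      show "\<bar>w N (Suc n) i 0 - w N n i 0\<bar> \<le> ?R"
        by (rule time_diff_boundary[OF i N n inv])
    qed
    \<comment> \<open>The outflow removes \<open>?a * e\<close>, which is at least
      \<open>\<tau> N * lmin * E' N n\<close>. A quarter of this pays for the reflected slopes, by
      the choice of \<open>\<beta>\<close>; three quarters pay for the sources and the boundary
      data, by the choice of \<open>D\<close>.\<close>
    also have "\<dots> \<le> e"
    proof -
      define X where "X = exp (\<kappa> * (real n * \<tau> N))"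
      have X: "X \<ge> 1" using exp_time_ge[OF N0] by (simp add: X_def)
      have E: "E N n = A * b * X" "E' N n = D * X" by (simp_all add: E_def E'_def X_def)
      have "2 * (1 + K) * C * A * b * X + K * L * 1 \<le> 2 * (1 + K) * C * A * b * X + K * L * X"
        using X K L by (intro add_left_mono mult_left_mono) auto
      also have "\<dots> = (2 * (1 + K) * C * A * b + K * L) * X" by (simp add: algebra_simps)
      also have "\<dots> \<le> (3 / 4 * lmin * D) * X" using D(2) X by (intro mult_right_mono) auto
      finally have 1: "2 * (1 + K) * C * E N n + K * L \<le> 3 / 4 * lmin * E' N n"
        unfolding E by (simp add: mult_ac)
      have 2: "K * lmax * exp (- (\<beta> * l1 / 2)) * E' N n \<le> lmin / 4 * E' N n"
        using \<beta>(2) E'_nonneg by (intro mult_right_mono) auto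
      have "2 * C * E N n + K * (lmax * exp (- (\<beta> * l1 / 2)) * E' N n + 2 * C * E N n) + K * L
         \<le> lmin * E' N n"
        using 1 2 by (simp add: algebra_simps)
      then have "\<tau> N * (2 * C * E N n + K * (lmax * exp (- (\<beta> * l1 / 2)) * E' N n + 2 * C * E N n) + K * L)
         \<le> \<tau> N * (lmin * E' N n)"
        using tau by (intro mult_left_mono) auto
      also have "\<dots> = \<theta> i * lmin * e" using tau_mesh[OF i N0] by (simp add: e_def)
      also have "\<dots> \<le> ?a * e" using a e0 by (intro mult_right_mono) auto
      finally show ?thesis by (simp add: algebra_simps)
    qed
    also have "e \<le> E' N (Suc n) * ?h" using E'_Suc_ge[OF N0, of n] h by (simp add: e_def)
    finally show ?thesis using 0 by simp
  next
    case (Suc k)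
    let ?d = "w N n i (Suc j) - w N n i j" and ?d' = "w N n i j - w N n i k"
    \<comment> \<open>All that is not part of the convex combination, divided by the time step.
      Neighbouring Courant numbers differ by the order of the mesh, hence of
      \<open>\<tau> N\<close>, so the quotient stays bounded.\<close>
    define z where "z = (cour N n i j - ?a) / \<tau> N * ?d' + (src N n i (Suc j) - src N n i j)"
    have jk: "j = Suc k" "k < N" "j \<le> N" "0 < j" using Suc j by auto
    \<comment> \<open>The partner runs backwards: from \<open>j\<close> to \<open>Suc j\<close> its
      grid index falls from \<open>N - j\<close> to \<open>N - Suc j\<close>. Its slope bound is
      used without the weight, which points the wrong way.\<close>
    have sub: "\<bar>w N n (partner i) (N - Suc j) - w N n (partner i) (N - j)\<bar> \<le> e"
    proof -
      have "\<bar>w N n (partner i) (Suc (N - Suc j)) - w N n (partner i) (N - Suc j)\<bar> \<le> E' N n * mesh N (partner i)"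
        by (rule diff_le_E'[OF inv]) (use partner i j N0 in auto)
      moreover have "Suc (N - Suc j) = N - j" using j by simp
      ultimately show ?thesis by (simp add: e_def mesh_partner[OF i] abs_minus_commute)
    qed
    have own: "\<bar>w N n i (Suc j) - w N n i j\<bar> \<le> e" "\<bar>?d'\<bar> \<le> e"
      using diff_le_E'[OF inv i _ N0] j jk by (auto simp: e_def)
    have wr: "\<bar>w N n i (Suc j)\<bar> \<le> r" "\<bar>w N n i j\<bar> \<le> r" "\<bar>w N n (partner i) (N - Suc j)\<bar> \<le> r"
      "\<bar>w N n (partner i) (N - j)\<bar> \<le> r"
      using w_le_r[OF sinv _ _ N0 n'] i j partner by auto
    have "\<bar>cour N n i j - ?a\<bar> = \<theta> i * \<bar>\<Lambda> (w N n i (Suc j)) (w N n (partner i) (N - Suc j))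
        - \<Lambda> (w N n i j) (w N n (partner i) (N - j))\<bar>"
      unfolding cour_def right_diff_distrib[symmetric] abs_mult using theta_pos[OF i] by (simp add: abs_minus_commute)
    also have "\<dots> \<le> \<theta> i * (C * (e + e))"
    proof (rule mult_left_mono)
      have "C * (\<bar>w N n i (Suc j) - w N n i j\<bar> + \<bar>w N n (partner i) (N - Suc j) - w N n (partner i) (N - j)\<bar>)
         \<le> C * (e + e)"
        by (rule mult_left_mono[OF add_mono[OF own(1) sub] C])
      then show "\<bar>\<Lambda> (w N n i (Suc j)) (w N n (partner i) (N - Suc j))
        - \<Lambda> (w N n i j) (w N n (partner i) (N - j))\<bar> \<le> C * (e + e)"
        using \<Lambda>_lip[OF wr(1,3,2,4)] by linarith
    qed (use theta_pos[OF i] in auto)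
    also have "\<dots> = \<tau> N * (2 * C * E' N n)" using tau_mesh[OF i N0] by (simp add: e_def)
    finally have "\<bar>cour N n i j - ?a\<bar> / \<tau> N \<le> 2 * C * E' N n"
      using tau by (simp add: field_simps)
    then have "\<bar>(cour N n i j - ?a) / \<tau> N * ?d'\<bar> \<le> (2 * C * E' N n) * e"
      unfolding abs_mult using own(2) tau e0 C E'_nonneg by (intro mult_mono) auto
    \<comment> \<open>A product of two slopes becomes linear here: one factor is at most one, which
      the smallness of \<open>D\<close> guarantees up to time \<open>T\<close>.\<close>
    also have "\<dots> \<le> 2 * C * 1 * e"
      using E'_le_1[OF N0 n'] C e0 by (intro mult_right_mono mult_left_mono) auto
    finally have z1: "\<bar>(cour N n i j - ?a) / \<tau> N * ?d'\<bar> \<le> 2 * C * e" by simp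
    have hN: "real (Suc j) * ?h - ?x = ?h" by (simp add: algebra_simps)
    have "\<bar>src N n i (Suc j) - src N n i j\<bar> \<le> C * (\<bar>w N n i (Suc j) - w N n i j\<bar>
       + \<bar>w N n (partner i) (N - Suc j) - w N n (partner i) (N - j)\<bar> + L * \<bar>real (Suc j) * ?h - ?x\<bar>)"
      unfolding src_def
      by (rule F_lip[OF i time_in[OF N0 n'] mesh_in[OF i N0] mesh_in[OF i N0] wr(1,3,2,4)]) (use j in auto)
    also have "\<dots> \<le> C * (e + e + e)"
    proof -
      have "L \<le> E' N n" using D_ge(1) D_le_E'[OF N0, of n] by linarith
      then have "L * ?h \<le> e" using h by (simp add: e_def)
      then show ?thesis using own sub C h unfolding hN by (intro mult_left_mono add_mono) auto
    qed
    finally have z2: "\<bar>src N n i (Suc j) - src N n i j\<bar> \<le> 3 * C * e" by (simp add: algebra_simps)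
    have z: "\<bar>z\<bar> \<le> 5 * C * e" using z1 z2 unfolding z_def by linarith
    have eq: "w N (Suc n) i (Suc j) - w N (Suc n) i j = (1 - ?a) * ?d + ?a * ?d' + \<tau> N * z"
    proof -
      have "\<tau> N * z = (cour N n i j - ?a) * ?d' + \<tau> N * (src N n i (Suc j) - src N n i j)"
        using tau by (simp add: z_def distrib_left)
      moreover have "w N (Suc n) i (Suc j) = (1 - ?a) * w N n i (Suc j) + ?a * w N n i j + \<tau> N * src N n i (Suc j)"
        using w_Suc[OF i N0, of "Suc j" n] by simp
      moreover have "w N (Suc n) i j = (1 - cour N n i j) * w N n i j + cour N n i j * w N n i k + \<tau> N * src N n i j"
        using w_Suc[OF i N0, of j n] jk by simp
      ultimately show ?thesis by (simp add: algebra_simps)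
    qed
    have "\<bar>(1 - ?a) * ?d + ?a * ?d' + \<tau> N * z\<bar> \<le> e * exp (\<kappa> * \<tau> N) * exp (- (\<beta> * ?x))"
    proof (rule weighted_transport[OF i N0 a(3,2) e0 _ _ _ _ z])
      show "0 \<le> ?x" "?x \<le> l2" using mesh_in[OF i N0 jk(3)] len(4)[OF i] by auto
      show "\<bar>?d\<bar> \<le> e * exp (- (\<beta> * ?x))" using d[OF j] .
      have "?x - ?h = real k * ?h" using jk by (simp add: algebra_simps)
      then show "\<bar>?d'\<bar> \<le> e * exp (- (\<beta> * (?x - ?h)))" using d[OF jk(2)] jk by simp
    qed
    then show ?thesis unfolding eq e_time .
  qed
qed

lemma diff_inv: "N > 1 \<Longrightarrow> n \<le> m0 * N \<Longrightarrow> diff_inv N n"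
  by (induction n) (auto intro: diff_inv_0 diff_inv_Suc)

end

section \<open>Compactness of the scheme\<close>

lemma grid_floor:
  fixes h x :: real
  assumes "h > 0" "x \<ge> 0"
  shows "real (nat \<lfloor>x / h\<rfloor>) * h \<le> x" "x < real (nat \<lfloor>x / h\<rfloor>) * h + h"
    "\<bar>real (nat \<lfloor>x / h\<rfloor>) * h - x\<bar> \<le> h"
proof -
  have 0: "0 \<le> x / h" using assms by simp
  then have e: "real (nat \<lfloor>x / h\<rfloor>) = of_int \<lfloor>x / h\<rfloor>" by simp
  have "of_int \<lfloor>x / h\<rfloor> \<le> x / h" by simp
  then show 1: "real (nat \<lfloor>x / h\<rfloor>) * h \<le> x" unfolding e using assms by (simp add: le_divide_eq)
  have "x / h < of_int \<lfloor>x / h\<rfloor> + 1" by linarith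
  then have "x < (of_int \<lfloor>x / h\<rfloor> + 1) * h" using assms(1) pos_divide_less_eq by blast
  then show 2: "x < real (nat \<lfloor>x / h\<rfloor>) * h + h" unfolding e by (simp add: distrib_right)
  show "\<bar>real (nat \<lfloor>x / h\<rfloor>) * h - x\<bar> \<le> h" using 1 2 by linarith
qed

lemma grid_floor_le:
  fixes h x :: real
  assumes "h > 0" "x \<ge> 0" "x \<le> real n * h"
  shows "nat \<lfloor>x / h\<rfloor> \<le> n"
proof -
  have "x / h \<le> real n" using assms by (simp add: divide_le_eq)
  then show ?thesis using assms by linarith
qed

lemma grid_floor_tendsto:
  fixes x :: real
  assumes "h \<longlonglongrightarrow> 0" "\<And>k. h k > 0" "x \<ge> 0"
  shows "(\<lambda>k. real (nat \<lfloor>x / h k\<rfloor>) * h k) \<longlonglongrightarrow> x"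
proof (rule Lim_transform2[where f = "\<lambda>k. x"])
  show "(\<lambda>k. x - real (nat \<lfloor>x / h k\<rfloor>) * h k) \<longlonglongrightarrow> 0"
    by (rule Lim_null_comparison[OF _ assms(1)])
       (use grid_floor(3)[OF assms(2,3)] in \<open>simp add: abs_minus_commute del: of_nat_nat\<close>)
qed simp

context upwind_scheme begin

lemma r_nonneg: "r \<ge> 0"
proof -
  have "0 \<le> A * b * exp (\<kappa> * T)" using A_ge b by simp
  then show ?thesis using small by linarith
qed

text \<open>A common Lipschitz constant in space and time. The summand one covers differences in
  space; the product bounds time differences, inside an edge and, through \<open>K\<close>, at the
  entries.\<close>

definition "L1 = (1 + K) * (lmax + 2 * C * r + L) + 1"

lemma L1_ge: "L1 \<ge> 1" "L \<le> L1" "lmax + 2 * C * r \<le> L1" "K * (lmax + 2 * C * r + L) \<le> L1"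
proof -
  have p: "0 \<le> lmax + 2 * C * r" "0 \<le> lmax + 2 * C * r + L" using lam C r_nonneg L by auto
  then have "0 \<le> K * (lmax + 2 * C * r + L)" using K by simp
  then show "L1 \<ge> 1" "L \<le> L1" "lmax + 2 * C * r \<le> L1" "K * (lmax + 2 * C * r + L) \<le> L1"
    using p L by (auto simp: L1_def distrib_right)
qed

lemma space_step:
  assumes "i \<in> I" "N > 1" "n \<le> m0 * N" "j < N"
  shows "\<bar>w N n i (Suc j) - w N n i j\<bar> \<le> mesh N i"
proof -
  have "\<bar>w N n i (Suc j) - w N n i j\<bar> \<le> E' N n * mesh N i"
    by (rule diff_le_E') (use assms diff_inv in auto)
  also have "\<dots> \<le> 1 * mesh N i"
    using E'_le_1[of N n] mesh_pos[of i N] assms by (intro mult_right_mono) auto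
  finally show ?thesis by simp
qed

lemma time_step:
  assumes i: "i \<in> I" and N: "N > 1" and n: "Suc n \<le> m0 * N" and j: "j \<le> N"
  shows "\<bar>w N (Suc n) i j - w N n i j\<bar> \<le> L1 * \<tau> N"
proof -
  have N0: "N > 0" and n': "n \<le> m0 * N" using N n by auto
  have tau: "\<tau> N > 0" using tau_pos N0 by auto
  have E: "2 * C * E N n \<le> 2 * C * r" using E_le_r[OF N0 n'] C by (intro mult_left_mono) auto
  show ?thesis
  proof (cases j)
    case (Suc k)
    have "\<bar>w N (Suc n) i (Suc k) - w N n i (Suc k)\<bar>
      \<le> \<theta> i * lmax * \<bar>w N n i (Suc k) - w N n i k\<bar> + \<tau> N * (2 * C * E N n)"
      by (rule time_diff_interior) (use i N0 n' j Suc in auto)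
    also have "\<dots> \<le> \<theta> i * lmax * mesh N i + \<tau> N * (2 * C * r)"
    proof (rule add_mono)
      show "\<theta> i * lmax * \<bar>w N n i (Suc k) - w N n i k\<bar> \<le> \<theta> i * lmax * mesh N i"
        using theta_pos[OF i] lam j Suc by (intro mult_left_mono space_step i N n') auto
      show "\<tau> N * (2 * C * E N n) \<le> \<tau> N * (2 * C * r)"
        using E tau by (rule mult_left_mono[OF _ less_imp_le])
    qed
    also have "\<dots> = \<tau> N * (lmax + 2 * C * r)" using tau_mesh[OF i N0] by (simp add: algebra_simps)
    also have "\<dots> \<le> \<tau> N * L1" using L1_ge tau by (intro mult_left_mono) auto
    finally show ?thesis using Suc by (simp add: mult.commute)
  next
    case 0
    have "\<bar>w N (Suc n) i 0 - w N n i 0\<bar>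
     \<le> K * (\<tau> N * (lmax * exp (- (\<beta> * l1 / 2)) * E' N n + 2 * C * E N n) + L * \<tau> N)"
      by (rule time_diff_boundary) (use i N n diff_inv[OF N n'] in auto)
    also have "\<dots> = \<tau> N * (K * (lmax * (exp (- (\<beta> * l1 / 2)) * E' N n) + 2 * C * E N n + L))"
      by (simp add: algebra_simps)
    also have "\<dots> \<le> \<tau> N * (K * (lmax * 1 + 2 * C * r + L))"
    proof -
      have "exp (- (\<beta> * l1 / 2)) * E' N n \<le> 1 * 1"
        using \<beta>(1) len(1) E'_le_1[OF N0 n'] E'_nonneg by (intro mult_mono) auto
      then have "lmax * (exp (- (\<beta> * l1 / 2)) * E' N n) \<le> lmax * 1"
        using lam by (intro mult_left_mono) auto
      then have "lmax * (exp (- (\<beta> * l1 / 2)) * E' N n) + 2 * C * E N n + L \<le> lmax * 1 + 2 * C * r + L"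
        using E by linarith
      then show ?thesis using K tau by (intro mult_left_mono) auto
    qed
    also have "\<dots> \<le> \<tau> N * L1" using L1_ge tau by (intro mult_left_mono) auto
    finally show ?thesis using 0 by (simp add: mult.commute)
  qed
qed

lemma space_lip:
  assumes "i \<in> I" "N > 1" "n \<le> m0 * N" "j' \<le> j" "j \<le> N"
  shows "\<bar>w N n i j - w N n i j'\<bar> \<le> real j * mesh N i - real j' * mesh N i"
  using assms(4,5)
proof (induction j rule: dec_induct)
  case (step k)
  then show ?case using space_step[OF assms(1-3), of k] by (simp add: algebra_simps)
qed simp

lemma time_lip:
  assumes "i \<in> I" "N > 1" "n \<le> m0 * N" "n' \<le> n" "j \<le> N"
  shows "\<bar>w N n i j - w N n' i j\<bar> \<le> L1 * (real n * \<tau> N - real n' * \<tau> N)"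
  using assms(4,3)
proof (induction n rule: dec_induct)
  case (step k)
  then show ?case using time_step[OF assms(1,2) _ assms(5), of k] by (simp add: algebra_simps)
qed simp

lemma space_lip_abs:
  assumes "i \<in> I" "N > 1" "n \<le> m0 * N" "j' \<le> N" "j \<le> N"
  shows "\<bar>w N n i j - w N n i j'\<bar> \<le> L1 * \<bar>real j * mesh N i - real j' * mesh N i\<bar>"
proof -
  have "\<bar>w N n i j - w N n i j'\<bar> \<le> 1 * \<bar>real j * mesh N i - real j' * mesh N i\<bar>"
    using space_lip[OF assms(1-3), of j' j] space_lip[OF assms(1-3), of j j'] assms
    by (cases "j' \<le> j") auto
  also have "\<dots> \<le> L1 * \<bar>real j * mesh N i - real j' * mesh N i\<bar>"
    using L1_ge by (intro mult_right_mono) auto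
  finally show ?thesis .
qed

lemma time_lip_abs:
  assumes "i \<in> I" "N > 1" "n \<le> m0 * N" "n' \<le> m0 * N" "j \<le> N"
  shows "\<bar>w N n i j - w N n' i j\<bar> \<le> L1 * \<bar>real n * \<tau> N - real n' * \<tau> N\<bar>"
proof (cases "n' \<le> n")
  case True
  then have "L1 * (real n * \<tau> N - real n' * \<tau> N) \<le> L1 * \<bar>real n * \<tau> N - real n' * \<tau> N\<bar>"
    using L1_ge by (intro mult_left_mono) auto
  then show ?thesis using time_lip[OF assms(1,2,3) True assms(5)] by linarith
next
  case False
  then have "L1 * (real n' * \<tau> N - real n * \<tau> N) \<le> L1 * \<bar>real n * \<tau> N - real n' * \<tau> N\<bar>"
    using L1_ge by (intro mult_left_mono) auto
  then show ?thesis using time_lip[OF assms(1,2,4) _ assms(5), of n] False by linarith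
qed

section \<open>Step functions through the grid values and their uniform limit\<close>

definition "U N i t x = w N (nat \<lfloor>t / \<tau> N\<rfloor>) i (nat \<lfloor>x / mesh N i\<rfloor>)"

lemma U_grid: "i \<in> I \<Longrightarrow> N > 0 \<Longrightarrow> U N i (real n * \<tau> N) (real j * mesh N i) = w N n i j"
  using tau_pos[of N] mesh_pos[of i N] by (simp add: U_def)

lemma T_grid: "N > 0 \<Longrightarrow> real (m0 * N) * \<tau> N = T"
  using m0_pos by (simp add: \<tau>_def)

lemma floor_idx:
  assumes "i \<in> I" "N > 0" "t \<in> {0..T}" "x \<in> {0..len i}"
  shows "nat \<lfloor>t / \<tau> N\<rfloor> \<le> m0 * N" "nat \<lfloor>x / mesh N i\<rfloor> \<le> N"
  using assms grid_floor_le[OF tau_pos, of N t "m0 * N"] grid_floor_le[OF mesh_pos, of i N x N]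
  by (auto simp: T_grid mesh_N simp del: of_nat_mult)

lemma U_bound:
  assumes "i \<in> I" "N > 0" "t \<in> {0..T}" "x \<in> {0..len i}"
  shows "\<bar>U N i t x\<bar> \<le> r"
  unfolding U_def using floor_idx[OF assms] assms by (intro w_le_r sup_inv)

lemma tau_le: "N > 0 \<Longrightarrow> \<tau> N \<le> T / real N"
proof -
  assume N: "N > 0"
  have "m0 \<ge> 1" using m0_pos by simp
  then have "real N \<le> real m0 * real N" using N by simp
  then show ?thesis unfolding \<tau>_def using N T m0_pos by (intro divide_left_mono) auto
qed

lemma mesh_le: "i \<in> I \<Longrightarrow> N > 0 \<Longrightarrow> mesh N i \<le> l2 / real N"
  using len(4)[of i] by (simp add: mesh_def divide_right_mono)

text \<open>A step function is Lipschitz only up to its jumps, which are of the order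
  \<open>1 / N\<close>. The defect is kept explicit, because it has to become small together with
  the distance to the limit.\<close>

lemma U_lip:
  assumes i: "i \<in> I" and N: "N > 1" and t: "t \<in> {0..T}" "t' \<in> {0..T}" and x: "x \<in> {0..len i}" "x' \<in> {0..len i}"
  shows "\<bar>U N i t x - U N i t' x'\<bar> \<le> L1 * (\<bar>t - t'\<bar> + \<bar>x - x'\<bar>) + 2 * L1 * (T + l2) / real N"
proof -
  have N0: "N > 0" using N by simp
  define n n' j j' where nj: "n = nat \<lfloor>t / \<tau> N\<rfloor>" "n' = nat \<lfloor>t' / \<tau> N\<rfloor>"
    "j = nat \<lfloor>x / mesh N i\<rfloor>" "j' = nat \<lfloor>x' / mesh N i\<rfloor>"
  have le: "n \<le> m0 * N" "n' \<le> m0 * N" "j \<le> N" "j' \<le> N"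
    using floor_idx[OF i N0 t(1) x(1)] floor_idx[OF i N0 t(2) x(2)] unfolding nj by auto
  have "\<bar>real n * \<tau> N - t\<bar> \<le> \<tau> N" "\<bar>real n' * \<tau> N - t'\<bar> \<le> \<tau> N"
    using grid_floor(3)[OF tau_pos[OF N0]] t unfolding nj by auto
  then have tt: "\<bar>real n * \<tau> N - real n' * \<tau> N\<bar> \<le> \<bar>t - t'\<bar> + 2 * (T / real N)"
    using tau_le[OF N0] by linarith
  have "\<bar>real j * mesh N i - x\<bar> \<le> mesh N i" "\<bar>real j' * mesh N i - x'\<bar> \<le> mesh N i"
    using grid_floor(3)[OF mesh_pos[OF i N0]] x unfolding nj by auto
  then have xx: "\<bar>real j * mesh N i - real j' * mesh N i\<bar> \<le> \<bar>x - x'\<bar> + 2 * (l2 / real N)"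
    using mesh_le[OF i N0] by linarith
  have "\<bar>U N i t x - U N i t' x'\<bar> \<le> \<bar>w N n i j - w N n' i j\<bar> + \<bar>w N n' i j - w N n' i j'\<bar>"
    unfolding U_def nj by linarith
  also have "\<dots> \<le> L1 * \<bar>real n * \<tau> N - real n' * \<tau> N\<bar> + L1 * \<bar>real j * mesh N i - real j' * mesh N i\<bar>"
    using time_lip_abs[OF i N le(1,2,3)] space_lip_abs[OF i N le(2,4,3)] by linarith
  also have "\<dots> \<le> L1 * (\<bar>t - t'\<bar> + 2 * (T / real N)) + L1 * (\<bar>x - x'\<bar> + 2 * (l2 / real N))"
    using L1_ge tt xx by (intro add_mono mult_left_mono) auto
  also have "\<dots> = L1 * (\<bar>t - t'\<bar> + \<bar>x - x'\<bar>) + 2 * L1 * (T + l2) / real N"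
    by (simp add: add_divide_distrib algebra_simps)
  finally show ?thesis .
qed

text \<open>A version of Arzela-Ascoli for functions that are equicontinuous up to a defect of the
  order \<open>1 / N\<close>: the cluster point inherits the Lipschitz bound without defect, and
  closeness on a fine finite grid then spreads to the whole domain.\<close>

lemma limit_exists:
  obtains W and \<phi> :: "nat \<Rightarrow> nat" where
    "\<And>k. \<phi> k > Suc k"
    "\<And>k i t x. i \<in> I \<Longrightarrow> t \<in> {0..T} \<Longrightarrow> x \<in> {0..len i} \<Longrightarrow> \<bar>U (\<phi> k) i t x - W i t x\<bar> \<le> 1 / real (Suc k)"
proof -
  define dom where "dom = {(i, t, x). i \<in> I \<and> t \<in> {0..T} \<and> x \<in> {0..len i}}"
  \<comment> \<open>The shift by two provides \<open>N > 1\<close> for the slope bounds. Outside the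
    domain the value is zero, since the cluster lemma asks for a bound at all points.\<close>
  define u where "u k p = (if p \<in> dom then (case p of (i, t, x) \<Rightarrow> U (k + 2) i t x) else 0)" for k p
  have "\<bar>u k p\<bar> \<le> r" for k p
    using U_bound r_nonneg by (auto simp: u_def dom_def split: prod.splits)
  then obtain v where v: "\<And>X \<epsilon> n. finite X \<Longrightarrow> \<epsilon> > 0 \<Longrightarrow> \<exists>k\<ge>n. \<forall>p\<in>X. \<bar>u k p - v p\<bar> < \<epsilon>"
    using bounded_functions_cluster[of u r] by metis
  define B where "B = 2 * L1 * (T + l2)"
  have B: "B \<ge> 0" using L1_ge T len(1,2) by (simp add: B_def)
  have ulip: "\<bar>u k (i, t, x) - u k (i, t', x')\<bar> \<le> L1 * (\<bar>t - t'\<bar> + \<bar>x - x'\<bar>) + B / real (k + 2)"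
    if "(i, t, x) \<in> dom" "(i, t', x') \<in> dom" for k i t x t' x'
    using that U_lip[of i "k + 2" t t' x x'] by (auto simp: u_def dom_def B_def)
  \<comment> \<open>A cluster point is approached for arbitrarily large indices, so the Lipschitz
    defect can be made small along with the distance.\<close>
  have near: "\<exists>k\<ge>n. (\<forall>p\<in>X. \<bar>u k p - v p\<bar> < \<epsilon>) \<and> B / real (k + 2) \<le> \<epsilon>" if X: "finite X" and \<epsilon>: "\<epsilon> > 0" for X \<epsilon> n
  proof -
    obtain k where k: "k \<ge> max n (nat \<lceil>B / \<epsilon>\<rceil>)" "\<forall>p\<in>X. \<bar>u k p - v p\<bar> < \<epsilon>" using v[OF X \<epsilon>] by blast
    have "B / \<epsilon> \<le> real (k + 2)" using k(1) by linarith
    then have "B / real (k + 2) \<le> \<epsilon>" using \<epsilon> by (simp add: field_simps)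
    then show ?thesis using k by auto
  qed
  have vlip: "\<bar>v (i, t, x) - v (i, t', x')\<bar> \<le> L1 * (\<bar>t - t'\<bar> + \<bar>x - x'\<bar>)"
    if d: "(i, t, x) \<in> dom" "(i, t', x') \<in> dom" for i t x t' x'
  proof (rule field_le_epsilon)
    fix e :: real assume "e > 0"
    then obtain k where k: "\<forall>p\<in>{(i, t, x), (i, t', x')}. \<bar>u k p - v p\<bar> < e / 3" "B / real (k + 2) \<le> e / 3"
      using near[of "{(i, t, x), (i, t', x')}" "e / 3" 0] by auto
    then show "\<bar>v (i, t, x) - v (i, t', x')\<bar> \<le> L1 * (\<bar>t - t'\<bar> + \<bar>x - x'\<bar>) + e"
      using ulip[OF d, of k] by (simp only: ball_simps) linarith
  qed
  have unif: "\<exists>k\<ge>n. \<forall>p\<in>dom. \<bar>u k p - v p\<bar> \<le> \<epsilon>" if \<epsilon>: "\<epsilon> > 0" for \<epsilon> n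
  proof -
    \<comment> \<open>Four errors: the variation of \<open>u\<close>, its defect, the distance at
      the grid point and the variation of \<open>v\<close>.\<close>
    define e where "e = \<epsilon> / 4"
    have e: "e > 0" using \<epsilon> by (simp add: e_def)
    define Q where "Q = Suc (nat \<lceil>L1 * (T + l2) / e\<rceil>)"
    have Q: "Q > 0" "L1 * (T + l2) / real Q \<le> e"
    proof -
      have "L1 * (T + l2) / e \<le> real Q" unfolding Q_def by linarith
      then show "L1 * (T + l2) / real Q \<le> e" using e by (simp add: field_simps Q_def)
    qed (simp add: Q_def)
    define X where "X = (\<Union>i\<in>I. (\<lambda>(a, c). (i, real a * (T / real Q), real c * (len i / real Q))) ` ({..Q} \<times> {..Q}))"
    have "finite X" using finI by (simp add: X_def)
    then obtain k where k: "k \<ge> n" "\<forall>p\<in>X. \<bar>u k p - v p\<bar> < e" "B / real (k + 2) \<le> e"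
      using near[of X e n] e by blast
    have "\<bar>u k p - v p\<bar> \<le> \<epsilon>" if p: "p \<in> dom" for p
    proof -
      obtain i t x where pe: "p = (i, t, x)" by (cases p)
      have i: "i \<in> I" and t: "0 \<le> t" "t \<le> T" and x: "0 \<le> x" "x \<le> len i" using p by (auto simp: dom_def pe)
      have hp: "T / real Q > 0" "len i / real Q > 0" using T Q len_pos[OF i] by auto
      define a where "a = nat \<lfloor>t / (T / real Q)\<rfloor>"
      define c where "c = nat \<lfloor>x / (len i / real Q)\<rfloor>"
      have le: "a \<le> Q" "c \<le> Q"
        using grid_floor_le[OF hp(1) t(1), of Q] grid_floor_le[OF hp(2) x(1), of Q] Q t x by (auto simp: a_def c_def)
      define t' where "t' = real a * (T / real Q)"
      define x' where "x' = real c * (len i / real Q)"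
      have cl: "\<bar>t' - t\<bar> \<le> T / real Q" "\<bar>x' - x\<bar> \<le> len i / real Q"
        using grid_floor(3)[OF hp(1) t(1)] grid_floor(3)[OF hp(2) x(1)] by (auto simp: t'_def x'_def a_def c_def)
      have inX: "(i, t', x') \<in> X" using le i by (force simp: X_def t'_def x'_def)
      have in01: "real a / real Q \<le> 1" "real c / real Q \<le> 1" using le Q by auto
      have "t' \<le> 1 * T" "x' \<le> 1 * len i" "0 \<le> t'" "0 \<le> x'"
        using mult_right_mono[OF in01(1), of T] mult_right_mono[OF in01(2), of "len i"] T len_pos[OF i] hp
        unfolding t'_def x'_def by auto
      then have d': "(i, t', x') \<in> dom" using i by (simp add: dom_def)
      have d: "(i, t, x) \<in> dom" using p pe by simp
      have "len i / real Q \<le> l2 / real Q" using len(4)[OF i] Q by (simp add: divide_right_mono)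
      then have "\<bar>t - t'\<bar> + \<bar>x - x'\<bar> \<le> (T + l2) / real Q" using cl unfolding add_divide_distrib by linarith
      then have s: "L1 * (\<bar>t - t'\<bar> + \<bar>x - x'\<bar>) \<le> e"
        using mult_left_mono[of "\<bar>t - t'\<bar> + \<bar>x - x'\<bar>" "(T + l2) / real Q" L1] L1_ge Q by simp
      have "\<bar>u k (i, t', x') - v (i, t', x')\<bar> < e" using k inX by blast
      then show ?thesis
        using ulip[OF d d', of k] vlip[OF d d'] s k(3) unfolding pe e_def by linarith
    qed
    then show ?thesis using k(1) by blast
  qed
  have "\<forall>k. \<exists>K'. K' \<ge> k \<and> (\<forall>p\<in>dom. \<bar>u K' p - v p\<bar> \<le> 1 / real (Suc k))"
    using unif by auto
  then obtain f where f: "\<And>k. f k \<ge> k" "\<And>k p. p \<in> dom \<Longrightarrow> \<bar>u (f k) p - v p\<bar> \<le> 1 / real (Suc k)"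
    by metis
  show thesis
  proof (rule that[of "\<lambda>k. f k + 2" "\<lambda>i t x. v (i, t, x)"])
    fix k i t x assume a: "i \<in> I" "t \<in> {0..T}" "x \<in> {0..len i}"
    then have "(i, t, x) \<in> dom" by (simp add: dom_def)
    then show "\<bar>U (f k + 2) i t x - v (i, t, x)\<bar> \<le> 1 / real (Suc k)"
      using f(2)[of "(i, t, x)" k] by (simp add: u_def)
  qed (use f(1) in \<open>auto simp: less_Suc_eq_le\<close>)
qed

end

section \<open>The limit of the scheme\<close>

locale upwind_limit = upwind_scheme I len partner T \<Lambda> l1 l2 C r lmin lmax F b L \<Phi> y K \<beta> A \<kappa> D m0
  for I :: "'i set" and len partner T \<Lambda> l1 l2 C r lmin lmax F b L \<Phi> y K \<beta> A \<kappa> D m0 +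
  fixes W :: "'i \<Rightarrow> real \<Rightarrow> real \<Rightarrow> real" and \<phi> :: "nat \<Rightarrow> nat"
  assumes \<phi>: "\<phi> k > Suc k"
    and conv: "i \<in> I \<Longrightarrow> t \<in> {0..T} \<Longrightarrow> x \<in> {0..len i} \<Longrightarrow>
      \<bar>U (\<phi> k) i t x - W i t x\<bar> \<le> 1 / real (Suc k)"
begin

lemma phi_gt: "\<phi> k > 1" "\<phi> k > 0" "real (\<phi> k) \<ge> real (Suc k)" "\<phi> k \<noteq> 0"
  using \<phi>[of k] by linarith+

lemma over_phi: "c \<ge> 0 \<Longrightarrow> c / real (\<phi> k) \<le> c / real (Suc k)"
  using phi_gt[of k] by (intro divide_left_mono) auto

lemma over_phi_tendsto: "(\<lambda>k. c / real (\<phi> k)) \<longlonglongrightarrow> 0"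
proof (rule Lim_null_comparison)
  show "eventually (\<lambda>k. norm (c / real (\<phi> k)) \<le> \<bar>c\<bar> * inverse (real (Suc k))) sequentially"
    using over_phi[of "\<bar>c\<bar>"] by (simp add: divide_inverse abs_mult del: of_nat_Suc)
  have "(\<lambda>k. \<bar>c\<bar> * inverse (real (Suc k))) \<longlonglongrightarrow> \<bar>c\<bar> * 0"
    by (intro tendsto_intros LIMSEQ_inverse_real_of_nat)
  then show "(\<lambda>k. \<bar>c\<bar> * inverse (real (Suc k))) \<longlonglongrightarrow> 0" by simp
qed

lemma mesh_tendsto: "(\<lambda>k. mesh (\<phi> k) i) \<longlonglongrightarrow> 0"
  unfolding mesh_def by (rule over_phi_tendsto)

lemma tau_tendsto: "(\<lambda>k. \<tau> (\<phi> k)) \<longlonglongrightarrow> 0"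
  using over_phi_tendsto[of "T / real m0"] by (simp add: \<tau>_def divide_divide_eq_left)

lemma U_tendsto:
  assumes "i \<in> I" "t \<in> {0..T}" "x \<in> {0..len i}"
  shows "(\<lambda>k. U (\<phi> k) i t x) \<longlonglongrightarrow> W i t x"
proof (rule Lim_transform2[where f = "\<lambda>k. W i t x"])
  show "(\<lambda>k. W i t x - U (\<phi> k) i t x) \<longlonglongrightarrow> 0"
    by (rule Lim_null_comparison[OF _ LIMSEQ_inverse_real_of_nat])
      (use conv[OF assms] in \<open>auto simp: abs_minus_commute divide_inverse\<close>)
qed simp

lemma W_bound:
  assumes "i \<in> I" "t \<in> {0..T}" "x \<in> {0..len i}"
  shows "\<bar>W i t x\<bar> \<le> r"
proof (rule LIMSEQ_le_const2)
  show "(\<lambda>k. \<bar>U (\<phi> k) i t x\<bar>) \<longlonglongrightarrow> \<bar>W i t x\<bar>"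
    using U_tendsto[OF assms] by (rule tendsto_rabs)
qed (use U_bound[OF assms(1) _ assms(2,3)] phi_gt in auto)

lemma W_lip:
  assumes "i \<in> I" "t \<in> {0..T}" "t' \<in> {0..T}" "x \<in> {0..len i}" "x' \<in> {0..len i}"
  shows "\<bar>W i t x - W i t' x'\<bar> \<le> L1 * (\<bar>t - t'\<bar> + \<bar>x - x'\<bar>)"
proof (rule LIMSEQ_le)
  show "(\<lambda>k. \<bar>U (\<phi> k) i t x - U (\<phi> k) i t' x'\<bar>) \<longlonglongrightarrow> \<bar>W i t x - W i t' x'\<bar>"
    using assms by (intro tendsto_intros U_tendsto)
  have "(\<lambda>k. L1 * (\<bar>t - t'\<bar> + \<bar>x - x'\<bar>) + 2 * L1 * (T + l2) / real (\<phi> k))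
     \<longlonglongrightarrow> L1 * (\<bar>t - t'\<bar> + \<bar>x - x'\<bar>) + 0"
    by (intro tendsto_intros over_phi_tendsto)
  then show "(\<lambda>k. L1 * (\<bar>t - t'\<bar> + \<bar>x - x'\<bar>) + 2 * L1 * (T + l2) / real (\<phi> k))
     \<longlonglongrightarrow> L1 * (\<bar>t - t'\<bar> + \<bar>x - x'\<bar>)" by simp
qed (use U_lip[OF assms(1) _ assms(2-5)] phi_gt in auto)

lemma W_init:
  assumes i: "i \<in> I" and x: "x \<in> {0..len i}"
  shows "W i 0 x = y i x"
proof (rule LIMSEQ_unique)
  show "(\<lambda>k. U (\<phi> k) i 0 x) \<longlonglongrightarrow> W i 0 x" using U_tendsto i x T by auto
  show "(\<lambda>k. U (\<phi> k) i 0 x) \<longlonglongrightarrow> y i x"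
  proof (rule Lim_transform2[where f = "\<lambda>k. y i x"])
    show "(\<lambda>k. y i x - U (\<phi> k) i 0 x) \<longlonglongrightarrow> 0"
    proof (rule Lim_null_comparison)
      have "(\<lambda>k. L * mesh (\<phi> k) i) \<longlonglongrightarrow> L * 0" by (intro tendsto_intros mesh_tendsto)
      then show "(\<lambda>k. L * mesh (\<phi> k) i) \<longlonglongrightarrow> 0" by simp
      have "\<bar>y i x - U (\<phi> k) i 0 x\<bar> \<le> L * mesh (\<phi> k) i" for k
      proof -
        define j where "j = nat \<lfloor>x / mesh (\<phi> k) i\<rfloor>"
        have h: "mesh (\<phi> k) i > 0" using mesh_pos i phi_gt by auto
        have "j \<le> \<phi> k" using floor_idx(2)[OF i phi_gt(2) _ x, of 0] T by (auto simp: j_def)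
        then have jx: "real j * mesh (\<phi> k) i \<in> {0..len i}" using mesh_in[OF i phi_gt(2)] by auto
        have "\<bar>y i x - y i (real j * mesh (\<phi> k) i)\<bar> \<le> L * \<bar>x - real j * mesh (\<phi> k) i\<bar>"
          by (rule y_lip[OF i x jx])
        also have "\<dots> \<le> L * mesh (\<phi> k) i"
          using grid_floor(3)[OF h, of x] x L unfolding j_def[symmetric]
          by (intro mult_left_mono) (auto simp: abs_minus_commute)
        finally show ?thesis by (simp add: U_def j_def w.simps)
      qed
      then show "eventually (\<lambda>k. norm (y i x - U (\<phi> k) i 0 x) \<le> L * mesh (\<phi> k) i) sequentially"
        by simp
    qed
  qed simp
qed

text \<open>On the grid the relation is exact, so the Lipschitz bound of \<open>\<Phi>\<close> in
  time and in the exit values and the uniform convergence carry it to the limit.\<close>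

lemma W_boundary:
  assumes i: "i \<in> I" and t: "t \<in> {0..T}"
  shows "W i t 0 = \<Phi> i t (\<lambda>k. W k t (len k))"
proof (rule LIMSEQ_unique)
  have lenk: "len k \<in> {0..len k}" "0 \<in> {0..len k}" if "k \<in> I" for k using len_pos[OF that] by auto
  show "(\<lambda>k. U (\<phi> k) i t 0) \<longlonglongrightarrow> W i t 0" using U_tendsto i t lenk by auto
  show "(\<lambda>k. U (\<phi> k) i t 0) \<longlonglongrightarrow> \<Phi> i t (\<lambda>k. W k t (len k))"
  proof (rule Lim_transform2[where f = "\<lambda>k. \<Phi> i t (\<lambda>k. W k t (len k))"])
    show "(\<lambda>k. \<Phi> i t (\<lambda>k. W k t (len k)) - U (\<phi> k) i t 0) \<longlonglongrightarrow> 0"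
    proof (rule Lim_null_comparison)
      have "(\<lambda>k. K * (inverse (real (Suc k)) + L * \<tau> (\<phi> k))) \<longlonglongrightarrow> K * (0 + L * 0)"
        by (intro tendsto_intros tau_tendsto LIMSEQ_inverse_real_of_nat)
      then show "(\<lambda>k. K * (inverse (real (Suc k)) + L * \<tau> (\<phi> k))) \<longlonglongrightarrow> 0" by simp
      have "\<bar>\<Phi> i t (\<lambda>k. W k t (len k)) - U (\<phi> k) i t 0\<bar> \<le> K * (inverse (real (Suc k)) + L * \<tau> (\<phi> k))" for k
      proof -
        let ?N = "\<phi> k"
        define n where "n = nat \<lfloor>t / \<tau> ?N\<rfloor>"
        have n: "n \<le> m0 * ?N" using floor_idx(1)[OF i phi_gt(2) t lenk(2)[OF i]] by (simp add: n_def)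
        have eq: "U ?N i t 0 = \<Phi> i (real n * \<tau> ?N) (\<lambda>l. w ?N n l ?N)"
          unfolding U_def n_def[symmetric] using w_boundary[OF i phi_gt(2)] by simp
        have end_eq: "w ?N n l ?N = U ?N l t (len l)" if l: "l \<in> I" for l
        proof -
          have "len l / mesh ?N l = real ?N" using len_pos[OF l] by (simp add: mesh_def)
          then show ?thesis by (simp add: U_def n_def)
        qed
        have "\<bar>\<Phi> i t (\<lambda>k. W k t (len k)) - \<Phi> i (real n * \<tau> ?N) (\<lambda>l. w ?N n l ?N)\<bar>
          \<le> K * (inverse (real (Suc k)) + L * \<bar>t - real n * \<tau> ?N\<bar>)"
        proof (rule \<Phi>_lip[OF i t time_in[OF phi_gt(2) n]])
          fix l assume l: "l \<in> I"
          show "\<bar>W l t (len l)\<bar> \<le> r" by (rule W_bound[OF l t lenk(1)[OF l]])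
          show "\<bar>w ?N n l ?N\<bar> \<le> r" by (rule w_le_r[OF sup_inv]) (use l n phi_gt in auto)
          show "\<bar>W l t (len l) - w ?N n l ?N\<bar> \<le> inverse (real (Suc k))"
            using conv[OF l t lenk(1)[OF l], of k] end_eq[OF l] by (simp add: divide_inverse abs_minus_commute)
        qed
        also have "\<dots> \<le> K * (inverse (real (Suc k)) + L * \<tau> ?N)"
        proof -
          have "\<bar>t - real n * \<tau> ?N\<bar> \<le> \<tau> ?N"
            using grid_floor(3)[OF tau_pos[OF phi_gt(2)], of t k] t unfolding n_def atLeastAtMost_iff by linarith
          then show ?thesis using K L by (intro mult_left_mono add_left_mono) auto
        qed
        finally show ?thesis using eq by simp
      qed
      then show "eventually (\<lambda>k. norm (\<Phi> i t (\<lambda>k. W k t (len k)) - U (\<phi> k) i t 0)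
         \<le> K * (inverse (real (Suc k)) + L * \<tau> (\<phi> k))) sequentially" by simp
    qed
  qed simp
qed

definition "speed i t x = \<Lambda> (W i t x) (W (partner i) t (len i - x))"
definition "source i t x = F i t x (W i t x) (W (partner i) t (len i - x))"

text \<open>At grid points the step function equals the grid value, so the error of the coefficients
  is the distance to the limit alone, uniformly in the grid point.\<close>

lemma discrete_coefficients:
  assumes i: "i \<in> I" and n: "n \<le> m0 * \<phi> k" and j: "j \<le> \<phi> k"
  defines "t \<equiv> real n * \<tau> (\<phi> k)" and "x \<equiv> real j * mesh (\<phi> k) i"
  shows "\<bar>cour (\<phi> k) n i j - \<theta> i * speed i t x\<bar> \<le> \<theta> i * (2 * C / real (Suc k))"
    and "\<bar>src (\<phi> k) n i j - source i t x\<bar> \<le> 2 * C / real (Suc k)"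
proof -
  let ?N = "\<phi> k"
  have N: "?N > 0" by (rule phi_gt)
  have t: "t \<in> {0..T}" using time_in[OF N n] by (simp add: t_def)
  have x: "x \<in> {0..len i}" using mesh_in[OF i N j] by (simp add: x_def)
  have x': "len i - x \<in> {0..len (partner i)}" using x partner(2)[OF i] by auto
  have pe: "real (?N - j) * mesh ?N (partner i) = len i - x"
    using mesh_partner[OF i] mesh_N[OF N, of i] j by (simp add: x_def of_nat_diff algebra_simps)
  have u: "w ?N n i j = U ?N i t x" using U_grid[OF i N] by (simp add: t_def x_def)
  have v: "w ?N n (partner i) (?N - j) = U ?N (partner i) t (len i - x)"
    using U_grid[OF partner(1)[OF i] N, of n "?N - j"] unfolding pe by (simp add: t_def)
  note ub = U_bound[OF i N t x] U_bound[OF partner(1)[OF i] N t x'] W_bound[OF i t x] W_bound[OF partner(1)[OF i] t x']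
  have cl: "C * (\<bar>U ?N i t x - W i t x\<bar> + \<bar>U ?N (partner i) t (len i - x) - W (partner i) t (len i - x)\<bar>)
     \<le> 2 * C / real (Suc k)"
  proof -
    have "C * (\<bar>U ?N i t x - W i t x\<bar> + \<bar>U ?N (partner i) t (len i - x) - W (partner i) t (len i - x)\<bar>)
      \<le> C * (1 / real (Suc k) + 1 / real (Suc k))"
      using conv[OF i t x] conv[OF partner(1)[OF i] t x'] C by (intro mult_left_mono add_mono) auto
    then show ?thesis by (simp add: add_divide_distrib algebra_simps)
  qed
  have "\<bar>\<Lambda> (U ?N i t x) (U ?N (partner i) t (len i - x)) - speed i t x\<bar> \<le> 2 * C / real (Suc k)"
    unfolding speed_def using \<Lambda>_lip[OF ub] cl by linarith
  then have "\<theta> i * \<bar>\<Lambda> (U ?N i t x) (U ?N (partner i) t (len i - x)) - speed i t x\<bar> \<le> \<theta> i * (2 * C / real (Suc k))"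
    using theta_pos[OF i] by (intro mult_left_mono) auto
  then show "\<bar>cour ?N n i j - \<theta> i * speed i t x\<bar> \<le> \<theta> i * (2 * C / real (Suc k))"
    unfolding cour_def u v using theta_pos[OF i] by (simp add: abs_mult flip: right_diff_distrib)
  have "src ?N n i j = F i t x (U ?N i t x) (U ?N (partner i) t (len i - x))"
    unfolding src_def u v by (simp add: t_def x_def)
  then show "\<bar>src ?N n i j - source i t x\<bar> \<le> 2 * C / real (Suc k)"
    unfolding source_def using F_lip[OF i t x x ub] cl by simp
qed

text \<open>The quadratic test function dominates \<open>L1 * \<bar>x - x1\<bar>\<close> and is almost transported by the scheme.\<close>

lemma box_estimate:
  fixes sg :: real
  assumes i: "i \<in> I" and sg: "sg = 1 \<or> sg = -1"
    and t: "0 \<le> ta" "ta < t1" "t1 < t2" "t2 \<le> tb" "tb \<le> T"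
    and x: "0 \<le> xa" "xa < x2 - (t2 - t1) / \<theta> i" "x2 \<le> xb" "xb \<le> len i"
    and s: "lmin \<le> s" "s \<le> lmax" and x2: "x2 = x1 + s * (t2 - t1)" and \<eta>: "\<eta> \<ge> 0"
    and osc: "\<And>t x. t \<in> {ta..tb} \<Longrightarrow> x \<in> {xa..xb} \<Longrightarrow> \<bar>speed i t x - s\<bar> \<le> \<eta> \<and> \<bar>source i t x - f\<bar> \<le> \<eta>"
  shows "sg * W i t2 x2 \<le> sg * W i t1 x1 + (t2 - t1) * (sg * f + 2 * \<eta>)"
proof (rule field_le_epsilon)
  fix d :: real assume d: "d > 0"
  \<comment> \<open>With this choice Young's inequality
    \<open>L1 * z \<le> q * z\<^sup>2 + L1 * \<delta> / 2\<close> has the constant term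
    \<open>d\<close>. The factor \<open>q\<close> grows as \<open>d\<close> shrinks, but it is fixed
    while the mesh tends to zero.\<close>
  define \<delta> where "\<delta> = 2 * d / L1"
  have L1: "L1 > 0" using L1_ge by linarith
  have \<delta>: "\<delta> > 0" "L1 * \<delta> / 2 = d" using d L1 by (auto simp: \<delta>_def)
  define q where "q = L1 / (2 * \<delta>)"
  have q: "q \<ge> 0" using L1 \<delta> by (simp add: q_def)
  define N h \<tau>' n1 n2 J j1 where "N k = \<phi> k" and "h k = mesh (\<phi> k) i" and "\<tau>' k = \<tau> (\<phi> k)"
    and "n1 k = nat \<lfloor>t1 / \<tau>' k\<rfloor>" and "n2 k = nat \<lfloor>t2 / \<tau>' k\<rfloor>" and "J k = nat \<lfloor>x2 / h k\<rfloor>"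
    and "j1 k = nat \<lfloor>x1 / h k\<rfloor>" for k
  define M where "M k = n2 k - n1 k" for k
  have th: "\<theta> i > 0" using theta_pos[OF i] .
  have hp: "h k > 0" "\<tau>' k > 0" "\<tau>' k = \<theta> i * h k" for k
    using mesh_pos[OF i phi_gt(2)] tau_pos[OF phi_gt(2)] tau_mesh[OF i phi_gt(2)] by (auto simp: h_def \<tau>'_def)
  have lim: "h \<longlonglongrightarrow> 0" "\<tau>' \<longlonglongrightarrow> 0"
    unfolding h_def \<tau>'_def by (rule mesh_tendsto tau_tendsto)+
  have ths: "\<theta> i * s \<le> 1" using cfl[OF i] mult_left_mono[OF s(2), of "\<theta> i"] th by linarith
  have t12: "t2 - t1 > 0" "t1 \<ge> 0" "t2 \<ge> 0" "t1 \<in> {0..T}" "t2 \<in> {0..T}" using t by auto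
  have x1: "xa < x1" "x1 \<le> x2"
  proof -
    have "s * (t2 - t1) \<le> (t2 - t1) / \<theta> i"
      using ths th t12 by (simp add: le_divide_eq) (simp add: mult.assoc[symmetric] mult_le_cancel_right mult.commute)
    then show "xa < x1" using x x2 by linarith
    show "x1 \<le> x2" using x2 s lam t12 by simp
  qed
  have x12: "x1 \<in> {0..len i}" "x2 \<in> {0..len i}" "x1 \<ge> 0" "x2 \<ge> 0" using x x1 by auto
  have n_lim: "(\<lambda>k. real (n1 k) * \<tau>' k) \<longlonglongrightarrow> t1" "(\<lambda>k. real (n2 k) * \<tau>' k) \<longlonglongrightarrow> t2"
    unfolding n1_def n2_def by (rule grid_floor_tendsto[OF lim(2) hp(2)]; use t12 in simp)+
  have J_lim: "(\<lambda>k. real (J k) * h k) \<longlonglongrightarrow> x2"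
    unfolding J_def by (rule grid_floor_tendsto[OF lim(1) hp(1)]) (use x12 in simp)
  have n12: "n1 k \<le> n2 k" for k
    unfolding n1_def n2_def using t12 hp(2)[of k] by (intro nat_mono floor_mono divide_right_mono) auto
  have Mn: "real (M k) * \<tau>' k = real (n2 k) * \<tau>' k - real (n1 k) * \<tau>' k" for k
    using n12[of k] by (simp add: M_def of_nat_diff algebra_simps)
  have M_lim: "(\<lambda>k. real (M k) * \<tau>' k) \<longlonglongrightarrow> t2 - t1"
    unfolding Mn by (intro tendsto_diff n_lim)
  have idx: "n1 k \<le> m0 * N k" "n2 k \<le> m0 * N k" "J k \<le> N k" "j1 k \<le> N k" for k
    using floor_idx[OF i phi_gt(2) t12(4) x12(1), of k] floor_idx[OF i phi_gt(2) t12(5) x12(2), of k]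
    by (auto simp: n1_def n2_def J_def j1_def N_def h_def \<tau>'_def)
  define e where "e k = \<tau>' k * (sg * f + 2 * \<eta> + 4 * C * inverse (real (Suc k)))" for k
  define \<alpha> where "\<alpha> k = sg * U (\<phi> k) i t1 x1 + L1 * h k + L1 * \<delta> / 2" for k
  have "eventually (\<lambda>k. sg * U (\<phi> k) i t2 x2 \<le> \<alpha> k + real (M k) * e k
     + q * ((real (J k) * h k - x1 - real (M k) * (\<theta> i * s * h k))\<^sup>2 + real (M k) * (\<theta> i * s * (h k)\<^sup>2))) sequentially"
  proof -
    have "(\<lambda>k. real (J k) * h k - (real (M k) * \<tau>' k) / \<theta> i) \<longlonglongrightarrow> x2 - (t2 - t1) / \<theta> i"
      using th by (intro tendsto_intros J_lim M_lim) auto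
    then have ev1: "eventually (\<lambda>k. xa < real (J k) * h k - (real (M k) * \<tau>' k) / \<theta> i) sequentially"
      using x(2) by (rule order_tendstoD)
    have ev2: "eventually (\<lambda>k. ta < real (n1 k) * \<tau>' k) sequentially"
      using n_lim(1) t(2) by (rule order_tendstoD)
    show ?thesis using ev1 ev2
    proof eventually_elim
      case (elim k)
      \<comment> \<open>The scheme reaches back one cell per time step, that is with the slope
        \<open>1 / \<theta> i\<close>. The margin in the hypothesis on \<open>xa\<close> keeps this
        numerical domain of dependence inside the box, where the coefficients are almost
        constant.\<close>
      have cone: "xa < (real (J k) - real (M k)) * h k"
        using elim(1) hp(3)[of k] th by (simp add: left_diff_distrib)
      have MJ: "M k < J k"
      proof -
        have "0 < (real (J k) - real (M k)) * h k" using cone x(1) by linarith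
        then show ?thesis using hp(1)[of k] by (simp add: zero_less_mult_iff)
      qed
      have n2M: "n1 k + M k = n2 k" using n12[of k] by (simp add: M_def)
      have n2t: "real (n2 k) * \<tau>' k \<le> t2" unfolding n2_def using grid_floor(1) hp t12 by blast
      have Jx: "real (J k) * h k \<le> x2" unfolding J_def using grid_floor(1) hp x12 by blast
      have *: "sg * w (N k) (n1 k + M k) i (J k) \<le> \<alpha> k + real (M k) * e k
         + q * ((real (J k) * h k - x1 - real (M k) * (\<theta> i * s * h k))\<^sup>2 + real (M k) * (\<theta> i * s * (h k)\<^sup>2))"
      proof (rule upwind_compare[where u = "\<lambda>m j. sg * w (N k) (n1 k + m) i j"])
        show "0 \<le> \<theta> i * s" "\<theta> i * s \<le> 1" using th s lam ths by auto
        show "q \<ge> 0" "M k \<le> J k" using q MJ by auto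
        show "sg * w (N k) (n1 k + 0) i j \<le> \<alpha> k + q * (real j * h k - x1)\<^sup>2"
          if j: "J k \<le> j + M k" "j \<le> J k" for j
        proof -
          have "\<bar>w (N k) (n1 k) i j - w (N k) (n1 k) i (j1 k)\<bar> \<le> L1 * \<bar>real j * h k - real (j1 k) * h k\<bar>"
            unfolding h_def using idx[of k] j unfolding N_def by (intro space_lip_abs i phi_gt) auto
          also have "\<dots> \<le> L1 * (\<bar>real j * h k - x1\<bar> + h k)"
          proof -
            have "\<bar>real (j1 k) * h k - x1\<bar> \<le> h k" unfolding j1_def using grid_floor(3) hp x12 by blast
            then show ?thesis using L1 by (intro mult_left_mono) auto
          qed
          also have "\<dots> \<le> L1 * h k + (L1 * \<delta> / 2 + q * (real j * h k - x1)\<^sup>2)"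
          proof -
            define z where "z = \<bar>real j * h k - x1\<bar>"
            have "0 \<le> (z - \<delta>)\<^sup>2" by simp
            then have "2 * \<delta> * z \<le> z\<^sup>2 + \<delta>\<^sup>2" by (simp add: power2_eq_square algebra_simps)
            then have "z \<le> (z\<^sup>2 + \<delta>\<^sup>2) / (2 * \<delta>)" using \<delta> by (simp add: le_divide_eq mult.commute)
            then have "L1 * z \<le> L1 * ((z\<^sup>2 + \<delta>\<^sup>2) / (2 * \<delta>))" using L1 by (intro mult_left_mono) auto
            also have "\<dots> = q * z\<^sup>2 + L1 * \<delta> / 2"
              using \<delta> by (simp add: q_def field_simps power2_eq_square)
            finally show ?thesis by (simp add: z_def distrib_left)
          qed
          finally have "\<bar>w (N k) (n1 k) i j - w (N k) (n1 k) i (j1 k)\<bar> \<le> L1 * h k + (L1 * \<delta> / 2 + q * (real j * h k - x1)\<^sup>2)" .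
          moreover have "w (N k) (n1 k) i (j1 k) = U (\<phi> k) i t1 x1"
            by (simp add: U_def N_def n1_def j1_def h_def \<tau>'_def)
          ultimately show ?thesis unfolding \<alpha>_def using sg by auto
        qed
        \<comment> \<open>Freezing the Courant number at \<open>\<theta> i * s\<close> costs its
          error times the difference of two neighbours. Such a difference is at most one mesh width,
          so the cost is of the order of the time step times \<open>\<eta>\<close>, like that of
          freezing the source.\<close>
        show "sg * w (N k) (n1 k + Suc m) i j \<le> (1 - \<theta> i * s) * (sg * w (N k) (n1 k + m) i j)
            + \<theta> i * s * (sg * w (N k) (n1 k + m) i (j - 1)) + e k"
          if mj: "m < M k" "J k + m < j + M k" "j \<le> J k" for m j
        proof -
          define n where "n = n1 k + m"
          have jp: "j > 0" "j \<le> N k" "Suc (j - 1) = j" "j - 1 < N k" using mj MJ idx[of k] by auto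
          have n: "n1 k \<le> n" "Suc n \<le> n2 k" "n \<le> m0 * N k" using mj n2M idx[of k] by (auto simp: n_def)
          define u u' where "u = w (N k) n i j" and "u' = w (N k) n i (j - 1)"
          define tt xx where "tt = real n * \<tau>' k" and "xx = real j * h k"
          have tin: "tt \<in> {ta..tb}"
          proof -
            have "real (n1 k) * \<tau>' k \<le> tt" "tt \<le> real (n2 k) * \<tau>' k"
              using n hp(2)[of k] by (auto simp: tt_def intro!: mult_right_mono)
            then show ?thesis using elim(2) n2t t by auto
          qed
          have xin: "xx \<in> {xa..xb}"
          proof -
            have "(real (J k) - real (M k)) * h k \<le> xx" "xx \<le> real (J k) * h k"
              using mj hp(1)[of k] by (auto simp: xx_def intro!: mult_right_mono)
            then show ?thesis using cone Jx x by auto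
          qed
          have "\<bar>cour (\<phi> k) n i j - \<theta> i * speed i tt xx\<bar> \<le> \<theta> i * (2 * C / real (Suc k))"
            and c2: "\<bar>src (\<phi> k) n i j - source i tt xx\<bar> \<le> 2 * C / real (Suc k)"
            using discrete_coefficients[OF i, of n k j] n jp unfolding tt_def xx_def N_def \<tau>'_def h_def by auto
          moreover have o: "\<bar>speed i tt xx - s\<bar> \<le> \<eta>" "\<bar>source i tt xx - f\<bar> \<le> \<eta>" using osc tin xin by auto
          have "\<bar>\<theta> i * speed i tt xx - \<theta> i * s\<bar> \<le> \<theta> i * \<eta>"
            using o(1) th by (simp add: abs_mult flip: right_diff_distrib)
          ultimately have c1: "\<bar>\<theta> i * s - cour (\<phi> k) n i j\<bar> \<le> \<theta> i * (\<eta> + 2 * C / real (Suc k))"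
            unfolding distrib_left by linarith
          have du: "\<bar>u - u'\<bar> \<le> h k"
            using space_step[OF i phi_gt(1), of n k "j - 1"] n jp by (simp add: u_def u'_def N_def h_def)
          have "\<bar>(\<theta> i * s - cour (\<phi> k) n i j) * (u - u')\<bar> \<le> (\<theta> i * (\<eta> + 2 * C / real (Suc k))) * h k"
            unfolding abs_mult using c1 du hp by (intro mult_mono) auto
          also have "\<dots> = \<tau>' k * (\<eta> + 2 * C / real (Suc k))" by (simp add: hp(3))
          finally have 1: "\<bar>(\<theta> i * s - cour (\<phi> k) n i j) * (u - u')\<bar> \<le> \<tau>' k * (\<eta> + 2 * C / real (Suc k))" .
          have "\<bar>src (\<phi> k) n i j - f\<bar> \<le> \<eta> + 2 * C / real (Suc k)" using c2 o(2) by linarith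
          then have 2: "\<bar>\<tau>' k * src (\<phi> k) n i j - \<tau>' k * f\<bar> \<le> \<tau>' k * (\<eta> + 2 * C / real (Suc k))"
            using hp(2)[of k] by (simp add: abs_mult flip: right_diff_distrib)
          define X P Q B where "X = (1 - \<theta> i * s) * u + \<theta> i * s * u'"
            and "P = (\<theta> i * s - cour (\<phi> k) n i j) * (u - u')" and "Q = \<tau>' k * src (\<phi> k) n i j"
            and "B = \<tau>' k * (\<eta> + 2 * C / real (Suc k))"
          have wS: "w (N k) (Suc n) i j = X + P + Q"
            using w_Suc[OF i phi_gt(2) jp(1), of k n]
            by (simp add: u_def u'_def N_def \<tau>'_def X_def P_def Q_def algebra_simps)
          have "sg * (X + P + Q) - sg * X \<le> sg * (\<tau>' k * f) + 2 * B"
            using sg 1[folded P_def B_def] 2[folded Q_def B_def] by (elim disjE; simp; linarith)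
          moreover have "sg * X = (1 - \<theta> i * s) * (sg * u) + \<theta> i * s * (sg * u')"
            by (simp add: X_def algebra_simps)
          ultimately have "sg * w (N k) (Suc n) i j - ((1 - \<theta> i * s) * (sg * u) + \<theta> i * s * (sg * u'))
             \<le> sg * (\<tau>' k * f) + 2 * (\<tau>' k * (\<eta> + 2 * C / real (Suc k)))"
            unfolding wS B_def by simp
          also have "\<dots> = e k" by (simp add: e_def divide_inverse algebra_simps)
          finally show ?thesis by (simp add: u_def u'_def n_def)
        qed
      qed
      have "w (N k) (n1 k + M k) i (J k) = U (\<phi> k) i t2 x2"
        unfolding n2M by (simp add: U_def N_def n2_def J_def h_def \<tau>'_def)
      then show ?case using * by simp
    qed
  qed
  moreover have "(\<lambda>k. sg * U (\<phi> k) i t2 x2) \<longlonglongrightarrow> sg * W i t2 x2"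
    by (intro tendsto_intros U_tendsto i t12 x12)
  moreover have "(\<lambda>k. \<alpha> k + real (M k) * e k
     + q * ((real (J k) * h k - x1 - real (M k) * (\<theta> i * s * h k))\<^sup>2 + real (M k) * (\<theta> i * s * (h k)\<^sup>2)))
     \<longlonglongrightarrow> sg * W i t1 x1 + d + (t2 - t1) * (sg * f + 2 * \<eta>)"
  proof -
    have "(\<lambda>k. sg * U (\<phi> k) i t1 x1 + L1 * h k + L1 * \<delta> / 2
       + (real (M k) * \<tau>' k) * (sg * f + 2 * \<eta> + 4 * C * inverse (real (Suc k)))
       + q * ((real (J k) * h k - x1 - s * (real (M k) * \<tau>' k))\<^sup>2 + (real (M k) * \<tau>' k) * s * h k))
     \<longlonglongrightarrow> sg * W i t1 x1 + L1 * 0 + L1 * \<delta> / 2 + (t2 - t1) * (sg * f + 2 * \<eta> + 4 * C * 0)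
       + q * ((x2 - x1 - s * (t2 - t1))\<^sup>2 + (t2 - t1) * s * 0)"
      by (intro tendsto_intros U_tendsto i t12 x12 lim J_lim M_lim LIMSEQ_inverse_real_of_nat)
    \<comment> \<open>The vertex of the transported parabola arrives exactly at \<open>x2\<close>,
      so the quadratic term disappears in the limit; the numerical diffusion disappears with the
      mesh.\<close>
    moreover have z: "x2 - x1 - s * (t2 - t1) = 0" by (simp add: x2)
    have "(\<lambda>k. \<alpha> k + real (M k) * e k
      + q * ((real (J k) * h k - x1 - real (M k) * (\<theta> i * s * h k))\<^sup>2 + real (M k) * (\<theta> i * s * (h k)\<^sup>2)))
      = (\<lambda>k. sg * U (\<phi> k) i t1 x1 + L1 * h k + L1 * \<delta> / 2
       + (real (M k) * \<tau>' k) * (sg * f + 2 * \<eta> + 4 * C * inverse (real (Suc k)))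
       + q * ((real (J k) * h k - x1 - s * (real (M k) * \<tau>' k))\<^sup>2 + (real (M k) * \<tau>' k) * s * h k))"
      by (simp add: fun_eq_iff \<alpha>_def e_def hp(3) power2_eq_square mult_ac)
    ultimately show ?thesis
      unfolding \<delta>(2) z by simp
  qed
  ultimately have "sg * W i t2 x2 \<le> sg * W i t1 x1 + d + (t2 - t1) * (sg * f + 2 * \<eta>)"
    by (intro tendsto_le[OF sequentially_bot]) auto
  then show "sg * W i t2 x2 \<le> sg * W i t1 x1 + (t2 - t1) * (sg * f + 2 * \<eta>) + d" by simp
qed

end

section \<open>The differential equation along characteristics\<close>

lemma increment_bound:
  fixes g :: "real \<Rightarrow> real"
  assumes "g (max a s) - g (min a s) = (max a s - min a s) * q" "\<bar>q - u\<bar> \<le> e"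
  shows "norm (g a - g s - u * (a - s)) \<le> e * norm (a - s)"
proof -
  have "g a - g s = (a - s) * q" using assms(1) by (cases "a \<le> s") (auto simp: algebra_simps)
  then have "g a - g s - u * (a - s) = (q - u) * (a - s)" by (simp add: algebra_simps)
  then show ?thesis using assms(2) by (simp add: abs_mult mult_right_mono)
qed

lemma mvt_formula:
  fixes g :: "real \<Rightarrow> real"
  assumes "a < b" "continuous_on {a..b} g"
    and "\<And>c. c \<in> {a<..<b} \<Longrightarrow> (g has_real_derivative g' c) (at c)"
  shows "\<exists>c. a < c \<and> c < b \<and> g b - g a = (b - a) * g' c"
proof -
  have "g differentiable (at x)" if "a < x" "x < b" for x
    using assms(3)[of x] that by (intro differentiableI) (simp add: has_field_derivative_def)
  then obtain l z where z: "a < z" "z < b" "DERIV g z :> l" "g b - g a = (b - a) * l"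
    using MVT[of a b g] assms(1,2) by blast
  have "l = g' z" using DERIV_unique[OF z(3) assms(3)] z by simp
  then show ?thesis using z by blast
qed

context upwind_limit begin

lemma coefficients_continuous:
  assumes i: "i \<in> I" and t0: "t0 \<in> {0..T}" and x0: "x0 \<in> {0..len i}" and e: "e > 0"
  obtains d where "d > 0"
    "\<And>t x. t \<in> {0..T} \<Longrightarrow> x \<in> {0..len i} \<Longrightarrow> \<bar>t - t0\<bar> \<le> d \<Longrightarrow> \<bar>x - x0\<bar> \<le> d \<Longrightarrow>
        \<bar>speed i t x - speed i t0 x0\<bar> \<le> e \<and> \<bar>source i t x - source i t0 x0\<bar> \<le> e"
proof -
  define u0 v0 where "u0 = W i t0 x0" and "v0 = W (partner i) t0 (len i - x0)"
  have p: "partner i \<in> I" "len (partner i) = len i" using partner i by auto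
  have u0: "\<bar>u0\<bar> \<le> r" unfolding u0_def using W_bound i t0 x0 by auto
  have v0: "\<bar>v0\<bar> \<le> r" unfolding v0_def using W_bound[OF p(1)] p(2) t0 x0 by auto
  obtain d0 where d0: "d0 > 0" "\<And>t. t \<in> {0..T} \<Longrightarrow> \<bar>t - t0\<bar> < d0 \<Longrightarrow> \<bar>F i t x0 u0 v0 - F i t0 x0 u0 v0\<bar> < e / 2"
    using F_cont[OF i x0 u0 v0] t0 e unfolding continuous_on_iff dist_real_def
    by (metis half_gt_zero)
  define B where "B = C * (4 * L1 + L) + 1"
  have B: "B > 0" using C L1_ge L by (auto simp: B_def intro!: add_nonneg_pos mult_nonneg_nonneg)
  define d where "d = min (d0 / 2) (e / (2 * B))"
  have d: "d > 0" using d0(1) e B by (simp add: d_def)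
  have Bd: "B * d \<le> e / 2"
  proof -
    have "B * d \<le> B * (e / (2 * B))" using B by (intro mult_left_mono) (auto simp: d_def)
    then show ?thesis using B by simp
  qed
  show thesis
  proof (rule that[OF d])
    fix t x assume t: "t \<in> {0..T}" and x: "x \<in> {0..len i}" and dt: "\<bar>t - t0\<bar> \<le> d" and dx: "\<bar>x - x0\<bar> \<le> d"
    define u v where "u = W i t x" and "v = W (partner i) t (len i - x)"
    have u: "\<bar>u\<bar> \<le> r" unfolding u_def using W_bound i t x by auto
    have v: "\<bar>v\<bar> \<le> r" unfolding v_def using W_bound[OF p(1)] p(2) t x by auto
    have "\<bar>u - u0\<bar> \<le> L1 * (\<bar>t - t0\<bar> + \<bar>x - x0\<bar>)"
      unfolding u_def u0_def by (rule W_lip[OF i t t0 x x0])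
    also have "\<dots> \<le> L1 * (2 * d)" using dt dx L1_ge by (intro mult_left_mono) auto
    finally have du: "\<bar>u - u0\<bar> \<le> L1 * (2 * d)" .
    have "\<bar>v - v0\<bar> \<le> L1 * (\<bar>t - t0\<bar> + \<bar>(len i - x) - (len i - x0)\<bar>)"
      unfolding v_def v0_def by (rule W_lip[OF p(1) t t0]) (use x x0 p in auto)
    also have "\<dots> \<le> L1 * (2 * d)" using dt dx L1_ge by (intro mult_left_mono) auto
    finally have dv: "\<bar>v - v0\<bar> \<le> L1 * (2 * d)" .
    have "C * (\<bar>u - u0\<bar> + \<bar>v - v0\<bar> + L * \<bar>x - x0\<bar>) \<le> C * (L1 * (2 * d) + L1 * (2 * d) + L * d)"
      using du dv dx L C by (intro mult_left_mono add_mono) auto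
    also have "\<dots> \<le> B * d" using d by (simp add: B_def algebra_simps)
    finally have 1: "C * (\<bar>u - u0\<bar> + \<bar>v - v0\<bar> + L * \<bar>x - x0\<bar>) \<le> e / 2" using Bd by linarith
    have "C * (\<bar>u - u0\<bar> + \<bar>v - v0\<bar>) \<le> C * (\<bar>u - u0\<bar> + \<bar>v - v0\<bar> + L * \<bar>x - x0\<bar>)"
      using L C by (intro mult_left_mono) auto
    then have "\<bar>\<Lambda> u v - \<Lambda> u0 v0\<bar> \<le> e"
      using \<Lambda>_lip[OF u v u0 v0] 1 e by linarith
    moreover have "\<bar>F i t x u v - F i t0 x0 u0 v0\<bar> \<le> e"
    proof -
      have "d < d0" using d0(1) by (simp add: d_def min_less_iff_disj)
      then have "\<bar>F i t x0 u0 v0 - F i t0 x0 u0 v0\<bar> < e / 2" using d0(2)[OF t] dt by linarith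
      then show ?thesis using F_lip[OF i t x x0 u v u0 v0] 1 by linarith
    qed
    ultimately show "\<bar>speed i t x - speed i t0 x0\<bar> \<le> e \<and> \<bar>source i t x - source i t0 x0\<bar> \<le> e"
      by (simp add: speed_def source_def u_def v_def u0_def v0_def)
  qed
qed

lemma W_derivative_interior:
  assumes i: "i \<in> I" and s0: "s0 \<in> {sa<..<sb}" and sub: "{sa<..<sb} \<subseteq> {0..T}"
    and \<xi>: "\<And>s. s \<in> {sa<..<sb} \<Longrightarrow> \<xi> s \<in> {0<..<len i} \<and> (\<xi> has_real_derivative speed i s (\<xi> s)) (at s)"
  shows "((\<lambda>s. W i s (\<xi> s)) has_real_derivative source i s0 (\<xi> s0)) (at s0)"
  unfolding has_field_derivative_def has_derivative_at_alt
proof (intro conjI allI impI)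
  show "bounded_linear ((*) (source i s0 (\<xi> s0)))" by (rule bounded_linear_mult_right)
next
  fix e :: real assume e: "e > 0"
  define x0 s f where "x0 = \<xi> s0" and "s = speed i s0 x0" and "f = source i s0 x0"
  define g where "g t = W i t (\<xi> t)" for t
  have x0: "x0 \<in> {0<..<len i}" using \<xi>[OF s0] by (simp add: x0_def)
  have s0T: "s0 \<in> {0..T}" using s0 sub by auto
  \<comment> \<open>The two comes from the estimate on the box, \<open>L1\<close> from the passage
    from the line to the characteristic.\<close>
  define \<eta> where "\<eta> = e / (2 + L1)"
  have L1: "L1 > 0" using L1_ge by linarith
  have \<eta>: "\<eta> > 0" "(2 + L1) * \<eta> = e" using e L1 by (auto simp: \<eta>_def)
  obtain d where d: "d > 0" "\<And>t x. t \<in> {0..T} \<Longrightarrow> x \<in> {0..len i} \<Longrightarrow> \<bar>t - s0\<bar> \<le> d \<Longrightarrow> \<bar>x - x0\<bar> \<le> d \<Longrightarrow>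
        \<bar>speed i t x - s\<bar> \<le> \<eta> \<and> \<bar>source i t x - f\<bar> \<le> \<eta>"
    using coefficients_continuous[OF i s0T _ \<eta>(1), of x0] x0 unfolding s_def f_def by auto
  define \<rho> where "\<rho> = Min {d, (s0 - sa) / 2, (sb - s0) / 2, x0 / 2, (len i - x0) / 2}"
  have \<rho>: "\<rho> > 0" "\<rho> \<le> d" "\<rho> < s0 - sa" "\<rho> < sb - s0" "\<rho> < x0" "\<rho> < len i - x0"
    using d(1) s0 x0 by (auto simp: \<rho>_def min_less_iff_disj)
  have s: "lmin \<le> s" "s \<le> lmax"
    using \<Lambda>_bound[OF W_bound[OF i s0T, of x0] W_bound[OF partner(1)[OF i] s0T, of "len i - x0"]] x0 partner(2)[OF i]
    by (auto simp: s_def speed_def)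
  have "isCont \<xi> s0" using \<xi>[OF s0] DERIV_isCont by blast
  then obtain \<rho>1 where \<rho>1: "\<rho>1 > 0" "\<And>t. \<bar>t - s0\<bar> < \<rho>1 \<Longrightarrow> \<bar>\<xi> t - x0\<bar> < \<rho> / 4"
    using \<rho>(1) unfolding isCont_def LIM_eq x0_def
    by (metis abs_zero cancel_comm_monoid_add_class.diff_cancel divide_pos_pos real_norm_def zero_less_numeral)
  have th: "\<theta> i > 0" using theta_pos[OF i] .
  \<comment> \<open>Within this time span the line, the characteristic and the numerical domain of
    dependence stay in the box of half width \<open>\<rho>\<close>: each of the displacements
    involved takes at most a quarter of it.\<close>
  define \<rho>2 where "\<rho>2 = Min {\<rho>1, \<rho> / 2, \<rho> / (4 * lmax), \<rho> * \<theta> i / 4}"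
  have \<rho>2: "\<rho>2 > 0" "\<rho>2 \<le> \<rho>1" "\<rho>2 < \<rho>" "lmax * \<rho>2 \<le> \<rho> / 4" "\<rho>2 / \<theta> i \<le> \<rho> / 4"
  proof -
    have "\<rho>2 \<le> \<rho> / (4 * lmax)" "\<rho>2 \<le> \<rho> * \<theta> i / 4" by (auto simp: \<rho>2_def)
    then show "lmax * \<rho>2 \<le> \<rho> / 4" "\<rho>2 / \<theta> i \<le> \<rho> / 4" using lam th by (auto simp: field_simps)
  qed (use \<rho>(1) \<rho>1(1) lam th in \<open>auto simp: \<rho>2_def min_less_iff_disj\<close>)
  have key: "\<bar>g t2 - g t1 - f * (t2 - t1)\<bar> \<le> e * (t2 - t1)"
    if t: "t1 < t2" "\<bar>t1 - s0\<bar> < \<rho>2" "\<bar>t2 - s0\<bar> < \<rho>2" "t2 - t1 < \<rho>2" for t1 t2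
  proof -
    define x1 x2 where "x1 = \<xi> t1" and "x2 = x1 + s * (t2 - t1)"
    have nx: "\<bar>\<xi> t - x0\<bar> < \<rho> / 4" if "t \<in> {t1..t2}" for t
      using \<rho>1(2)[of t] that t \<rho>2(2) by auto
    have dom: "t \<in> {sa<..<sb}" if "t \<in> {t1..t2}" for t using that t \<rho> \<rho>2 by auto
    have x1: "\<bar>x1 - x0\<bar> < \<rho> / 4" unfolding x1_def using nx t by auto
    have st: "0 \<le> s * (t2 - t1)" "s * (t2 - t1) \<le> \<rho> / 4"
    proof -
      have "s * (t2 - t1) \<le> lmax * \<rho>2" using s t lam by (intro mult_mono) auto
      then show "s * (t2 - t1) \<le> \<rho> / 4" using \<rho>2(4) by linarith
    qed (use s lam t in auto)
    have div: "(t2 - t1) / \<theta> i \<le> \<rho> / 4"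
    proof -
      have "(t2 - t1) / \<theta> i \<le> \<rho>2 / \<theta> i" using t th by (intro divide_right_mono) auto
      then show ?thesis using \<rho>2(5) by linarith
    qed
    have osc: "\<bar>speed i t x - s\<bar> \<le> \<eta> \<and> \<bar>source i t x - f\<bar> \<le> \<eta>"
      if "t \<in> {s0 - \<rho>..s0 + \<rho>}" "x \<in> {x0 - \<rho>..x0 + \<rho>}" for t x
    proof (rule d(2))
      have "t \<in> {sa<..<sb}" using that \<rho> by auto
      then show "t \<in> {0..T}" using sub by auto
    qed (use that \<rho> in auto)
    have tT: "0 \<le> s0 - \<rho>" "s0 + \<rho> \<le> T"
    proof -
      have "s0 - \<rho> \<in> {sa<..<sb}" "s0 + \<rho> \<in> {sa<..<sb}" using \<rho> by auto
      then show "0 \<le> s0 - \<rho>" "s0 + \<rho> \<le> T" using sub by auto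
    qed
    have box: "sg * W i t2 x2 \<le> sg * W i t1 x1 + (t2 - t1) * (sg * f + 2 * \<eta>)" if "sg = 1 \<or> sg = -1" for sg
    proof (rule box_estimate[OF i that, where ta = "s0 - \<rho>" and tb = "s0 + \<rho>" and xa = "x0 - \<rho>" and xb = "x0 + \<rho>" and s = s])
      show "s0 - \<rho> < t1" "t2 \<le> s0 + \<rho>" using t \<rho>2(3) by auto
      show "x0 - \<rho> < x2 - (t2 - t1) / \<theta> i" "x2 \<le> x0 + \<rho>"
        using x1 st div \<rho>(1) unfolding x2_def by linarith+
    qed (use t \<rho> tT s \<eta> osc in \<open>auto simp: x2_def\<close>)
    have b: "\<bar>W i t2 x2 - W i t1 x1 - f * (t2 - t1)\<bar> \<le> 2 * \<eta> * (t2 - t1)"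
      using box[of 1] box[of "-1"] by (simp add: abs_le_iff algebra_simps)
    obtain c where c: "t1 < c" "c < t2" "\<xi> t2 - \<xi> t1 = (t2 - t1) * speed i c (\<xi> c)"
    proof -
      have "\<exists>z>t1. z < t2 \<and> \<xi> t2 - \<xi> t1 = (t2 - t1) * speed i z (\<xi> z)"
        by (rule MVT2) (use t(1) \<xi> dom in auto)
      then show thesis using that by blast
    qed
    have cc: "\<bar>speed i c (\<xi> c) - s\<bar> \<le> \<eta>"
    proof -
      have "\<bar>\<xi> c - x0\<bar> < \<rho> / 4" using nx[of c] c by simp
      then have "\<xi> c \<in> {x0 - \<rho>..x0 + \<rho>}" using \<rho>(1) unfolding atLeastAtMost_iff by linarith
      moreover have "c \<in> {s0 - \<rho>..s0 + \<rho>}" using c t \<rho>2(3) by auto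
      ultimately show ?thesis using osc by blast
    qed
    have "\<xi> t2 - x2 = (t2 - t1) * (speed i c (\<xi> c) - s)"
      using c(3) by (simp add: x2_def x1_def algebra_simps)
    then have "\<bar>\<xi> t2 - x2\<bar> \<le> (t2 - t1) * \<eta>" using cc t(1) by (simp add: abs_mult)
    then have "L1 * \<bar>\<xi> t2 - x2\<bar> \<le> L1 * ((t2 - t1) * \<eta>)" using L1 by (intro mult_left_mono) auto
    moreover have "\<bar>W i t2 (\<xi> t2) - W i t2 x2\<bar> \<le> L1 * (\<bar>t2 - t2\<bar> + \<bar>\<xi> t2 - x2\<bar>)"
    proof (rule W_lip[OF i])
      show "t2 \<in> {0..T}" "t2 \<in> {0..T}" using sub dom[of t2] t by auto
      show "\<xi> t2 \<in> {0..len i}" using \<xi>[OF dom[of t2]] t by auto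
      show "x2 \<in> {0..len i}" using x1 st \<rho> unfolding x2_def atLeastAtMost_iff by linarith
    qed
    ultimately have "\<bar>g t2 - g t1 - f * (t2 - t1)\<bar> \<le> 2 * \<eta> * (t2 - t1) + L1 * ((t2 - t1) * \<eta>)"
      using b unfolding g_def x1_def by simp
    also have "\<dots> = ((2 + L1) * \<eta>) * (t2 - t1)" by (simp add: algebra_simps)
    finally show ?thesis unfolding \<eta>(2) .
  qed
  have "norm (g t - g s0 - f * (t - s0)) \<le> e * norm (t - s0)" if "norm (t - s0) < \<rho>2" for t
  proof (cases t s0 rule: linorder_cases)
    case less
    then have "\<bar>g s0 - g t - f * (s0 - t)\<bar> \<le> e * (s0 - t)" using key[of t s0] that \<rho>2(1) by auto
    moreover have "g s0 - g t - f * (s0 - t) = - (g t - g s0 - f * (t - s0))" by (simp add: algebra_simps)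
    ultimately show ?thesis using less by (simp only: abs_minus_cancel real_norm_def) simp
  next
    case greater
    then show ?thesis using key[of s0 t] that \<rho>2(1) by auto
  qed auto
  then show "\<exists>d>0. \<forall>t. norm (t - s0) < d \<longrightarrow>
     norm (W i t (\<xi> t) - W i s0 (\<xi> s0) - source i s0 (\<xi> s0) * (t - s0)) \<le> e * norm (t - s0)"
    using \<rho>2(1) unfolding g_def f_def x0_def by blast
qed

text \<open>The interval may be closed and the curve may touch the ends of the edge. Positive speed
  makes the curve strictly increasing, so it touches them only at the end points of the interval and
  the interior result applies in between. The mean value theorem and the continuity of the source
  extend the derivative to the end points.\<close>

lemma W_along_characteristics:
  assumes i: "i \<in> I" and J: "is_interval J" "J \<subseteq> {0..T}" and s: "s \<in> J"
    and \<xi>: "\<And>s. s \<in> J \<Longrightarrow> \<xi> s \<in> {0..len i} \<and> (\<xi> has_real_derivative speed i s (\<xi> s)) (at s within J)"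
  shows "((\<lambda>s. W i s (\<xi> s)) has_real_derivative source i s (\<xi> s)) (at s within J)"
proof -
  have contx: "continuous_on J \<xi>"
    using \<xi> by (meson DERIV_continuous continuous_on_eq_continuous_within)
  have contW: "continuous_on J (\<lambda>s. W i s (\<xi> s))"
    unfolding continuous_on_iff dist_real_def
  proof (intro ballI allI impI)
    fix a and e :: real assume a: "a \<in> J" and e: "e > 0"
    have L1: "L1 > 0" using L1_ge by linarith
    obtain d where d: "d > 0" "\<And>a'. a' \<in> J \<Longrightarrow> \<bar>a' - a\<bar> < d \<Longrightarrow> \<bar>\<xi> a' - \<xi> a\<bar> < e / (2 * L1)"
      using contx a e L1 unfolding continuous_on_iff dist_real_def
      by (metis divide_pos_pos mult_pos_pos zero_less_numeral)
    show "\<exists>d>0. \<forall>a'\<in>J. \<bar>a' - a\<bar> < d \<longrightarrow> \<bar>W i a' (\<xi> a') - W i a (\<xi> a)\<bar> < e"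
    proof (intro exI conjI ballI impI)
      show "0 < min d (e / (2 * L1))" using d e L1 by simp
      fix a' assume a': "a' \<in> J" "\<bar>a' - a\<bar> < min d (e / (2 * L1))"
      have "\<bar>W i a' (\<xi> a') - W i a (\<xi> a)\<bar> \<le> L1 * (\<bar>a' - a\<bar> + \<bar>\<xi> a' - \<xi> a\<bar>)"
        by (rule W_lip[OF i]) (use a a' J \<xi> in auto)
      also have "\<dots> < L1 * (e / (2 * L1) + e / (2 * L1))"
        using a' d(2)[of a'] L1 by (intro mult_strict_left_mono add_strict_mono) auto
      finally show "\<bar>W i a' (\<xi> a') - W i a (\<xi> a)\<bar> < e" using L1 by simp
    qed
  qed
  have mvt: "\<exists>c. lo < c \<and> c < hi \<and> W i hi (\<xi> hi) - W i lo (\<xi> lo) = (hi - lo) * source i c (\<xi> c)"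
    if lohi: "lo \<in> J" "hi \<in> J" "lo < hi" for lo hi
  proof -
    have sub: "{lo..hi} \<subseteq> J"
      by (intro subsetI mem_is_interval_1_I[OF J(1) lohi(1,2)]) simp_all
    have der: "(\<xi> has_real_derivative speed i c (\<xi> c)) (at c)" if "c \<in> {lo<..<hi}" for c
    proof -
      have "(\<xi> has_real_derivative speed i c (\<xi> c)) (at c within {lo<..<hi})"
      proof (rule DERIV_subset)
        show "{lo<..<hi} \<subseteq> J"
          using sub greaterThanLessThan_subseteq_atLeastAtMost_iff[of lo hi lo hi] by blast
        show "(\<xi> has_real_derivative speed i c (\<xi> c)) (at c within J)"
          by (rule conjunct2[OF \<xi>[OF subsetD[OF sub]]]) (use that in simp)
      qed
      then show ?thesis using that by (simp only: at_within_open[OF that open_greaterThanLessThan])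
    qed
    have sp: "speed i c (\<xi> c) > 0" if "c \<in> J" for c
    proof -
      have "lmin \<le> \<Lambda> (W i c (\<xi> c)) (W (partner i) c (len i - \<xi> c)) \<and> \<Lambda> (W i c (\<xi> c)) (W (partner i) c (len i - \<xi> c)) \<le> lmax"
      proof (rule \<Lambda>_bound; rule W_bound)
        show cT: "c \<in> {0..T}" using that J(2) by (rule subsetD[rotated])
        then show "c \<in> {0..T}" .
        show x: "\<xi> c \<in> {0..len i}" using \<xi>[OF that] by (rule conjunct1)
        then show "len i - \<xi> c \<in> {0..len (partner i)}" using partner(2)[OF i] by simp
      qed (use i partner(1)[OF i] in simp_all)
      then show ?thesis using lam by (simp add: speed_def)
    qed
    have incr: "\<xi> a < \<xi> b" if ab: "lo \<le> a" "a < b" "b \<le> hi" for a b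
    proof (rule DERIV_pos_imp_increasing_open[OF ab(2)])
      show "\<exists>y. (\<xi> has_real_derivative y) (at x) \<and> 0 < y" if "a < x" "x < b" for x
      proof (intro exI conjI)
        have x: "x \<in> {lo<..<hi}" using that ab by simp
        show "(\<xi> has_real_derivative speed i x (\<xi> x)) (at x)" by (rule der[OF x])
        show "0 < speed i x (\<xi> x)" using x by (intro sp subsetD[OF sub]) simp
      qed
      have "{a..b} \<subseteq> {lo..hi}" using ab by simp
      then show "continuous_on {a..b} \<xi>" by (intro continuous_on_subset[OF contx] order_trans[OF _ sub])
    qed
    have inside: "\<xi> c \<in> {0<..<len i}" if "c \<in> {lo<..<hi}" for c
    proof -
      have "\<xi> lo < \<xi> c" "\<xi> c < \<xi> hi" by (rule incr; use that in simp)+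
      then show ?thesis using conjunct1[OF \<xi>[OF lohi(1)]] conjunct1[OF \<xi>[OF lohi(2)]] by simp
    qed
    have dW: "((\<lambda>s. W i s (\<xi> s)) has_real_derivative source i c (\<xi> c)) (at c)" if c: "c \<in> {lo<..<hi}" for c
    proof (rule W_derivative_interior[where \<xi> = \<xi> and sa = lo and sb = hi, OF i c])
      have "{lo<..<hi} \<subseteq> {lo..hi}" by (rule subsetI) simp
      from order_trans[OF order_trans[OF this sub] J(2)] show "{lo<..<hi} \<subseteq> {0..T}" .
      show "\<xi> s \<in> {0<..<len i} \<and> (\<xi> has_real_derivative speed i s (\<xi> s)) (at s)" if "s \<in> {lo<..<hi}" for s
        using inside[OF that] der[OF that] by (rule conjI)
    qed
    show ?thesis
      by (rule mvt_formula[where g = "\<lambda>s. W i s (\<xi> s)" and g' = "\<lambda>s. source i s (\<xi> s)",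
        OF lohi(3) continuous_on_subset[OF contW sub] dW])
  qed
  show ?thesis
    unfolding has_field_derivative_def has_derivative_within_alt
  proof (intro conjI allI impI)
    show "bounded_linear ((*) (source i s (\<xi> s)))" by (rule bounded_linear_mult_right)
  next
    fix e :: real assume e: "e > 0"
    have sT: "s \<in> {0..T}" using s J(2) by (rule subsetD[rotated])
    obtain d where d: "d > 0" "\<And>t x. t \<in> {0..T} \<Longrightarrow> x \<in> {0..len i} \<Longrightarrow> \<bar>t - s\<bar> \<le> d \<Longrightarrow> \<bar>x - \<xi> s\<bar> \<le> d \<Longrightarrow>
        \<bar>source i t x - source i s (\<xi> s)\<bar> \<le> e"
      by (rule coefficients_continuous[OF i sT conjunct1[OF \<xi>[OF s]] e]) (use that in simp)
    obtain d' where d': "d' > 0" "\<And>a. a \<in> J \<Longrightarrow> \<bar>a - s\<bar> < d' \<Longrightarrow> \<bar>\<xi> a - \<xi> s\<bar> < d"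
      using contx s d(1) unfolding continuous_on_iff dist_real_def by metis
    have near: "\<bar>source i c (\<xi> c) - source i s (\<xi> s)\<bar> \<le> e" if "c \<in> J" "\<bar>c - s\<bar> < min d d'" for c
    proof (rule d(2))
      show "\<bar>c - s\<bar> \<le> d" "\<bar>\<xi> c - \<xi> s\<bar> \<le> d"
        using that d'(2)[OF that(1)] by simp_all
      show "c \<in> {0..T}" using that(1) J(2) by (rule subsetD[rotated])
      show "\<xi> c \<in> {0..len i}" using \<xi>[OF that(1)] by (rule conjunct1)
    qed
    have "norm (W i a (\<xi> a) - W i s (\<xi> s) - source i s (\<xi> s) * (a - s)) \<le> e * norm (a - s)"
      if a: "a \<in> J" "norm (a - s) < min d d'" for a
    proof (cases "a = s")
      case False
      then have lh: "min a s \<in> J" "max a s \<in> J" "min a s < max a s"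
        using a s by (auto simp: min_def max_def)
      obtain c where c: "min a s < c" "c < max a s" "W i (max a s) (\<xi> (max a s)) - W i (min a s) (\<xi> (min a s))
          = (max a s - min a s) * source i c (\<xi> c)"
        using mvt[OF lh] by (elim exE conjE) (rule that)
      have cJ: "c \<in> J"
        by (rule mem_is_interval_1_I[OF J(1) lh(1,2)]) (use c(1,2) in simp_all)
      have "\<bar>c - s\<bar> < norm (a - s)"
        using c(1,2) unfolding real_norm_def min_def max_def by (simp split: if_splits)
      then have "\<bar>c - s\<bar> < min d d'" using a(2) by (rule less_trans)
      from near[OF cJ this] show ?thesis
        by (rule increment_bound[where g = "\<lambda>a. W i a (\<xi> a)", OF c(3)])
    next
      case True
      show ?thesis unfolding True by simp
    qed
    then show "\<exists>d>0. \<forall>a\<in>J. norm (a - s) < d \<longrightarrow>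
       norm (W i a (\<xi> a) - W i s (\<xi> s) - source i s (\<xi> s) * (a - s)) \<le> e * norm (a - s)"
      using d(1) d'(1) by (intro exI[of _ "min d d'"] conjI ballI impI) simp_all
  qed
qed

end

section \<open>Semi-global existence\<close>

context upwind_flux begin

text \<open>A predicate with \<open>F\<close>, \<open>\<Phi>\<close> and \<open>y\<close> as
  arguments, because the smallness threshold has to be found before these are known.\<close>

definition is_solution ::
  "('i \<Rightarrow> real \<Rightarrow> real \<Rightarrow> real \<Rightarrow> real \<Rightarrow> real) \<Rightarrow> ('i \<Rightarrow> real \<Rightarrow> ('i \<Rightarrow> real) \<Rightarrow> real) \<Rightarrow> ('i \<Rightarrow> real \<Rightarrow> real) \<Rightarrow>
   ('i \<Rightarrow> real \<Rightarrow> real \<Rightarrow> real) \<Rightarrow> bool" where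
  "is_solution F \<Phi> y W \<longleftrightarrow>
    (\<forall>i\<in>I. \<forall>t\<in>{0..T}. \<forall>x\<in>{0..len i}. \<bar>W i t x\<bar> \<le> r) \<and>
    (\<exists>M\<ge>0. \<forall>i\<in>I. \<forall>t\<in>{0..T}. \<forall>t'\<in>{0..T}. \<forall>x\<in>{0..len i}. \<forall>x'\<in>{0..len i}.
       \<bar>W i t x - W i t' x'\<bar> \<le> M * (\<bar>t - t'\<bar> + \<bar>x - x'\<bar>)) \<and>
    (\<forall>i\<in>I. \<forall>x\<in>{0..len i}. W i 0 x = y i x) \<and>
    (\<forall>i\<in>I. \<forall>t\<in>{0..T}. W i t 0 = \<Phi> i t (\<lambda>k. W k t (len k))) \<and>
    (\<forall>i\<in>I. \<forall>J \<xi>. is_interval J \<longrightarrow> J \<subseteq> {0..T} \<longrightarrow>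
       (\<forall>s\<in>J. \<xi> s \<in> {0..len i} \<and>
          (\<xi> has_real_derivative \<Lambda> (W i s (\<xi> s)) (W (partner i) s (len i - \<xi> s))) (at s within J)) \<longrightarrow>
       (\<forall>s\<in>J. ((\<lambda>s. W i s (\<xi> s)) has_real_derivative
          F i s (\<xi> s) (W i s (\<xi> s)) (W (partner i) s (len i - \<xi> s))) (at s within J)))"

text \<open>All constants of the scheme are built from \<open>K\<close>, \<open>T\<close> and the
  bounds on lengths and flux, except \<open>D\<close>, which is taken proportional to
  \<open>b + L\<close>. The remaining conditions of smallness thereby become upper bounds on
  \<open>b\<close> and \<open>L\<close>.\<close>

theorem semiglobal_existence:
  assumes K: "K \<ge> 0" and r: "r > 0"
  shows "\<exists>\<epsilon>>0. \<forall>b L F \<Phi> y. b \<le> \<epsilon> \<longrightarrow> L \<le> \<epsilon> \<longrightarrow>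
      upwind_data I len partner T \<Lambda> l1 l2 C r lmin lmax F b L \<Phi> y K \<longrightarrow> (\<exists>W. is_solution F \<Phi> y W)"
proof -
  \<comment> \<open>\<open>\<beta>\<close> is chosen with
    \<open>exp (- (\<beta> * l1 / 2)) = inverse M\<close>; the first two summands of
    \<open>M\<close> then give the two conditions on \<open>\<beta>\<close>, the last one makes it
    nonnegative.\<close>
  define M where "M = 4 * K * lmax / lmin + 2 * K + 1"
  define \<beta> where "\<beta> = 2 * ln M / l1"
  define A where "A = exp (\<beta> * l2) + 2 * K"
  define \<kappa> where "\<kappa> = (lmax * \<beta> + 5 * C) * exp (\<beta> * l2)"
  \<comment> \<open>\<open>B * (b + L)\<close> dominates sources and boundary data in the entry
    cell. The factor \<open>4 / (3 * lmin)\<close> in \<open>Dc\<close> cancels the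
    \<open>3 / 4 * lmin\<close> in the condition on \<open>D\<close>, and
    \<open>exp (\<beta> * l2)\<close> serves the initial slopes.\<close>
  define B where "B = 2 * (1 + K) * C * A + K"
  define Dc where "Dc = exp (\<beta> * l2) + 4 / (3 * lmin) * B"
  define \<epsilon> where "\<epsilon> = min (r / (A * exp (\<kappa> * T))) (1 / (2 * Dc * exp (\<kappa> * T)))"
  define m0 where "m0 = nat \<lceil>lmax * T / l1\<rceil>"
  have "4 * K * lmax / lmin \<ge> 0" using K lam by simp
  then have M: "M \<ge> 1" "4 * K * lmax / lmin \<le> M" "2 * K \<le> M" using K by (auto simp: M_def)
  have \<beta>0: "\<beta> \<ge> 0" using M(1) len(1) by (simp add: \<beta>_def)
  have e1: "exp (- (\<beta> * l1 / 2)) = inverse M"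
    using len(1) M(1) by (simp add: \<beta>_def exp_minus)
  have e2: "exp (- (\<beta> * l1)) \<le> inverse M"
    unfolding e1[symmetric] using \<beta>0 len(1) by simp
  have \<beta>: "K * lmax * exp (- (\<beta> * l1 / 2)) \<le> lmin / 4" "K * exp (- (\<beta> * l1)) \<le> 1 / 2"
  proof -
    show "K * lmax * exp (- (\<beta> * l1 / 2)) \<le> lmin / 4"
      unfolding e1 using M lam by (simp add: field_simps)
    have "K * exp (- (\<beta> * l1)) \<le> K * inverse M" using e2 K by (intro mult_left_mono)
    also have "\<dots> \<le> 1 / 2" using M by (simp add: field_simps)
    finally show "K * exp (- (\<beta> * l1)) \<le> 1 / 2" .
  qed
  have A: "A > 0" "A \<ge> exp (\<beta> * l2)" "A \<ge> 2 * K" using K by (auto simp: A_def intro: add_pos_nonneg)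
  have B: "B \<ge> 0" using K C A(1) by (simp add: B_def)
  then have Dc: "Dc > 0" using lam by (auto simp: Dc_def intro!: add_pos_nonneg)
  have \<epsilon>: "\<epsilon> > 0" using A(1) Dc r by (simp add: \<epsilon>_def)
  have m0: "lmax * T \<le> real m0 * l1"
  proof -
    have "lmax * T / l1 \<le> real m0" unfolding m0_def by linarith
    then show ?thesis using len(1) by (simp add: divide_le_eq)
  qed
  have "\<exists>W. is_solution F \<Phi> y W"
    if small: "b \<le> \<epsilon>" "L \<le> \<epsilon>" and data: "upwind_data I len partner T \<Lambda> l1 l2 C r lmin lmax F b L \<Phi> y K" for b L F \<Phi> y
  proof -
    interpret upwind_data I len partner T \<Lambda> l1 l2 C r lmin lmax F b L \<Phi> y K by (rule data)
    define D where "D = Dc * (b + L)"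
    have "L * exp (\<beta> * l2) \<le> D"
    proof -
      have "exp (\<beta> * l2) * L \<le> Dc * (b + L)"
        using b L B lam Dc by (intro mult_mono) (auto simp: Dc_def)
      then show ?thesis by (simp add: D_def mult.commute)
    qed
    moreover have "2 * (1 + K) * C * A * b + K * L \<le> 3 / 4 * lmin * D"
    proof -
      have c: "2 * (1 + K) * C * A \<ge> 0" using K C A(1) by simp
      have "2 * (1 + K) * C * A * b + K * L \<le> 2 * (1 + K) * C * A * b + K * L + (2 * (1 + K) * C * A * L + K * b)"
        using c K b L by simp
      also have "\<dots> = B * (b + L)" by (simp add: B_def algebra_simps)
      also have "\<dots> = 3 / 4 * lmin * (4 / (3 * lmin) * B) * (b + L)" using lam by simp
      also have "\<dots> \<le> 3 / 4 * lmin * Dc * (b + L)"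
        using lam b L by (intro mult_right_mono mult_left_mono) (auto simp: Dc_def)
      finally show ?thesis by (simp add: D_def)
    qed
    moreover have "A * b * exp (\<kappa> * T) \<le> r"
    proof -
      have "b \<le> r / (A * exp (\<kappa> * T))" using small(1) by (simp add: \<epsilon>_def)
      then have "b * (A * exp (\<kappa> * T)) \<le> r" using A(1) by (simp add: le_divide_eq)
      then show ?thesis by (simp add: mult_ac)
    qed
    moreover have "D * exp (\<kappa> * T) \<le> 1"
    proof -
      have "b + L \<le> 2 * (1 / (2 * Dc * exp (\<kappa> * T)))" using small by (simp add: \<epsilon>_def)
      also have "\<dots> = 1 / (Dc * exp (\<kappa> * T))" by simp
      finally have "(b + L) * (Dc * exp (\<kappa> * T)) \<le> 1" using Dc by (simp add: le_divide_eq)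
      then show ?thesis by (simp add: D_def mult_ac)
    qed
    ultimately interpret upwind_scheme I len partner T \<Lambda> l1 l2 C r lmin lmax F b L \<Phi> y K \<beta> A \<kappa> D m0
      using \<beta>0 \<beta> A m0 by unfold_locales (auto simp: \<kappa>_def)
    obtain W and \<phi> :: "nat \<Rightarrow> nat" where W: "\<And>k. \<phi> k > Suc k"
      "\<And>k i t x. i \<in> I \<Longrightarrow> t \<in> {0..T} \<Longrightarrow> x \<in> {0..len i} \<Longrightarrow> \<bar>U (\<phi> k) i t x - W i t x\<bar> \<le> 1 / real (Suc k)"
      using limit_exists by metis
    interpret upwind_limit I len partner T \<Lambda> l1 l2 C r lmin lmax F b L \<Phi> y K \<beta> A \<kappa> D m0 W \<phi>
      using W by unfold_locales auto
    have "is_solution F \<Phi> y W"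
      unfolding is_solution_def
    proof (intro conjI)
      show "\<forall>i\<in>I. \<forall>t\<in>{0..T}. \<forall>x\<in>{0..len i}. \<bar>W i t x\<bar> \<le> r" using W_bound by blast
      show "\<exists>M\<ge>0. \<forall>i\<in>I. \<forall>t\<in>{0..T}. \<forall>t'\<in>{0..T}. \<forall>x\<in>{0..len i}. \<forall>x'\<in>{0..len i}.
          \<bar>W i t x - W i t' x'\<bar> \<le> M * (\<bar>t - t'\<bar> + \<bar>x - x'\<bar>)"
        using W_lip L1_ge(1) by (intro exI[of _ L1]) auto
      show "\<forall>i\<in>I. \<forall>x\<in>{0..len i}. W i 0 x = y i x" using W_init by blast
      show "\<forall>i\<in>I. \<forall>t\<in>{0..T}. W i t 0 = \<Phi> i t (\<lambda>k. W k t (len k))" using W_boundary by blast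
    qed (intro ballI allI impI W_along_characteristics[unfolded speed_def source_def]; blast)
    then show ?thesis by blast
  qed
  then show ?thesis using \<epsilon> by blast
qed

end

section \<open>Equations at a node\<close>

text \<open>Mass flow and enthalpy behave like this near rest, with the outgoing invariant, the
  unknown at a node, as first argument and the given incoming one as second.\<close>

definition incr_bilipschitz :: "real \<Rightarrow> real \<Rightarrow> real \<Rightarrow> (real \<Rightarrow> real \<Rightarrow> real) \<Rightarrow> bool" where
  "incr_bilipschitz r m1 m2 f \<longleftrightarrow> (\<forall>u u' v v'. \<bar>u\<bar> \<le> r \<longrightarrow> \<bar>u'\<bar> \<le> r \<longrightarrow> \<bar>v\<bar> \<le> r \<longrightarrow> \<bar>v'\<bar> \<le> r \<longrightarrow>
     \<bar>f u v - f u' v'\<bar> \<le> m2 * (\<bar>u - u'\<bar> + \<bar>v - v'\<bar>) \<and> (u' \<le> u \<longrightarrow> m1 * (u - u') \<le> f u v - f u' v))"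

context
  fixes r m1 m2 :: real
  assumes m: "0 < m1" "m1 \<le> m2" and r: "r > 0"
begin

lemma incr_bilipschitz_lip:
  assumes "incr_bilipschitz r m1 m2 f" "\<bar>u\<bar> \<le> r" "\<bar>u'\<bar> \<le> r" "\<bar>v\<bar> \<le> r" "\<bar>v'\<bar> \<le> r"
  shows "\<bar>f u v - f u' v'\<bar> \<le> m2 * (\<bar>u - u'\<bar> + \<bar>v - v'\<bar>)"
  using assms unfolding incr_bilipschitz_def by blast

lemma incr_bilipschitz_incr:
  assumes "incr_bilipschitz r m1 m2 f" "\<bar>u\<bar> \<le> r" "\<bar>u'\<bar> \<le> r" "\<bar>v\<bar> \<le> r" "u' \<le> u"
  shows "m1 * (u - u') \<le> f u v - f u' v"
  using assms unfolding incr_bilipschitz_def by blast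

lemma root_stable:
  assumes f: "incr_bilipschitz r m1 m2 f" and b: "\<bar>u\<bar> \<le> r" "\<bar>u'\<bar> \<le> r" "\<bar>v\<bar> \<le> r" "\<bar>v'\<bar> \<le> r"
  shows "m1 * \<bar>u - u'\<bar> \<le> \<bar>f u v - f u' v'\<bar> + m2 * \<bar>v - v'\<bar>"
proof -
  have 1: "\<bar>f u' v - f u' v'\<bar> \<le> m2 * \<bar>v - v'\<bar>" using incr_bilipschitz_lip[OF f b(2,2,3,4)] by simp
  have 2: "m1 * \<bar>u - u'\<bar> \<le> \<bar>f u v - f u' v\<bar>"
    using incr_bilipschitz_incr[OF f b(1,2,3)] incr_bilipschitz_incr[OF f b(2,1,3)] by (cases "u' \<le> u") auto
  show ?thesis using 1 2 by linarith
qed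

lemma root_mono:
  assumes f: "incr_bilipschitz r m1 m2 f" and b: "\<bar>u\<bar> \<le> r" "\<bar>u'\<bar> \<le> r" "\<bar>v\<bar> \<le> r" and le: "f u' v \<le> f u v"
  shows "u' \<le> u"
proof (rule ccontr)
  assume "\<not> u' \<le> u"
  then have "m1 * (u' - u) \<le> f u' v - f u v" "0 < m1 * (u' - u)"
    using incr_bilipschitz_incr[OF f b(2,1,3)] m by auto
  then show False using le by linarith
qed

text \<open>The slope \<open>m1\<close> makes \<open>f\<close> vary by at least
  \<open>m1 * r\<close> on either side of \<open>u = 0\<close>, enough to reach \<open>d\<close>
  despite the shift caused by \<open>v\<close>; then the intermediate value theorem applies.\<close>

lemma root_exists:
  assumes f: "incr_bilipschitz r m1 m2 f" and v: "\<bar>v\<bar> \<le> r" and d: "\<bar>d - f 0 0\<bar> + m2 * \<bar>v\<bar> \<le> m1 * r"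
  shows "\<exists>u. \<bar>u\<bar> \<le> r \<and> f u v = d"
proof -
  have c: "continuous_on {-r..r} (\<lambda>u. f u v)"
  proof (rule lipschitz_on_continuous_on[OF lipschitz_onI])
    fix x y assume "x \<in> {-r..r}" "y \<in> {-r..r}"
    then show "dist (f x v) (f y v) \<le> m2 * dist x y"
      using incr_bilipschitz_lip[OF f, of x y v v] v by (auto simp: dist_real_def abs_le_iff)
  qed (use m in simp)
  have 0: "\<bar>f 0 v - f 0 0\<bar> \<le> m2 * \<bar>v\<bar>" using incr_bilipschitz_lip[OF f _ _ v, of 0 0 0] r by simp
  have "m1 * r \<le> f r v - f 0 v" "m1 * r \<le> f 0 v - f (- r) v"
    using incr_bilipschitz_incr[OF f, of r 0 v] incr_bilipschitz_incr[OF f, of 0 "- r" v] v r by auto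
  then have "f (- r) v \<le> d" "d \<le> f r v" using 0 d by linarith+
  then obtain x where "- r \<le> x" "x \<le> r" "f x v = d"
    using IVT'[of "\<lambda>u. f u v" "- r" d r] c r by auto
  then show ?thesis by (auto simp: abs_le_iff)
qed

text \<open>For incoming perturbations of size \<open>\<delta>\<close>, an outgoing invariant drops
  by at most \<open>m2 / m1 * \<delta>\<close> when the common enthalpy does not fall, hence a mass
  flow by at most \<open>(m2 * m2 / m1 + m2) * \<delta>\<close>. By balance no mass flow can gain
  more than the losses of the other edges, and division by the slope \<open>m1\<close> returns to
  the invariants.\<close>

definition "junction_const k = real k * (m2 * m2 / m1 + m2) / m1"

text \<open>If the common enthalpy rises by the passage from \<open>(u', v')\<close> to \<open>(u, v)\<close>, no \<open>u e\<close> can drop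
  much; since the mass flows balance, no \<open>u e\<close> can rise much either.\<close>

lemma junction_stable_aux:
  assumes Q: "incr_bilipschitz r m1 m2 Q" and H: "incr_bilipschitz r m1 m2 H" and E: "finite E"
    and b: "\<And>e. e \<in> E \<Longrightarrow> \<bar>u e\<bar> \<le> r \<and> \<bar>u' e\<bar> \<le> r \<and> \<bar>v e\<bar> \<le> r \<and> \<bar>v' e\<bar> \<le> r \<and> \<bar>v e - v' e\<bar> \<le> \<delta>"
    and mass: "(\<Sum>e\<in>E. Q (u e) (v e)) = 0" "(\<Sum>e\<in>E. Q (u' e) (v' e)) = 0"
    and h: "\<And>e. e \<in> E \<Longrightarrow> H (u' e) (v' e) \<le> H (u e) (v e)"
    and e: "e \<in> E"
  shows "\<bar>u e - u' e\<bar> \<le> junction_const (card E) * \<delta>"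
proof -
  define B where "B = m2 * m2 / m1 + m2"
  have \<delta>: "\<delta> \<ge> 0" using b[OF e] by auto
  have B: "B \<ge> m2" "B \<ge> 0" using m by (auto simp: B_def)
  have drop: "u' f - u f \<le> m2 / m1 * \<delta>" if f: "f \<in> E" for f
  proof (cases "u' f \<le> u f")
    case True
    have "0 \<le> m2 / m1 * \<delta>" using m \<delta> by simp
    then show ?thesis using True by linarith
  next
    case False
    have "m1 * (u' f - u f) \<le> H (u' f) (v f) - H (u f) (v f)"
      using incr_bilipschitz_incr[OF H, of "u' f" "u f" "v f"] b[OF f] False by auto
    also have "\<dots> \<le> H (u' f) (v f) - H (u' f) (v' f)" using h[OF f] by linarith
    also have "\<dots> \<le> m2 * \<delta>"
    proof -
      have "\<bar>H (u' f) (v f) - H (u' f) (v' f)\<bar> \<le> m2 * \<bar>v f - v' f\<bar>"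
        using incr_bilipschitz_lip[OF H, of "u' f" "u' f" "v f" "v' f"] b[OF f] by simp
      also have "\<dots> \<le> m2 * \<delta>" using b[OF f] m by (intro mult_left_mono) auto
      finally show ?thesis by linarith
    qed
    finally show ?thesis using m by (simp add: field_simps)
  qed
  define D where "D f = Q (u f) (v f) - Q (u' f) (v' f)" for f
  have D_low: "D f \<ge> - (B * \<delta>)" and D_up: "m1 * (u f - u' f) \<le> D f + B * \<delta>" if f: "f \<in> E" for f
  proof -
    have 1: "\<bar>Q (u' f) (v f) - Q (u' f) (v' f)\<bar> \<le> m2 * \<delta>"
    proof -
      have "\<bar>Q (u' f) (v f) - Q (u' f) (v' f)\<bar> \<le> m2 * \<bar>v f - v' f\<bar>"
        using incr_bilipschitz_lip[OF Q, of "u' f" "u' f" "v f" "v' f"] b[OF f] by simp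
      also have "\<dots> \<le> m2 * \<delta>" using b[OF f] m by (intro mult_left_mono) auto
      finally show ?thesis .
    qed
    have Bd: "B * \<delta> = m2 * (m2 / m1 * \<delta>) + m2 * \<delta>" by (simp add: B_def algebra_simps)
    have p: "0 \<le> m2 * (m2 / m1 * \<delta>)" using m \<delta> by simp
    have "D f \<ge> - (B * \<delta>) \<and> m1 * (u f - u' f) \<le> D f + B * \<delta>"
    proof (cases "u' f \<le> u f")
      case True
      have "m1 * (u f - u' f) \<le> Q (u f) (v f) - Q (u' f) (v f)"
        using incr_bilipschitz_incr[OF Q, of "u f" "u' f" "v f"] b[OF f] True by auto
      moreover have "0 \<le> m1 * (u f - u' f)" using True m by simp
      ultimately show ?thesis using 1 p unfolding D_def Bd by linarith
    next
      case False
      have "\<bar>Q (u f) (v f) - Q (u' f) (v f)\<bar> \<le> m2 * (u' f - u f)"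
        using incr_bilipschitz_lip[OF Q, of "u f" "u' f" "v f" "v f"] b[OF f] False by simp
      also have "\<dots> \<le> m2 * (m2 / m1 * \<delta>)" using drop[OF f] m by (intro mult_left_mono) auto
      finally have "D f \<ge> - (B * \<delta>)" using 1 unfolding D_def Bd by linarith
      moreover have "m1 * (u f - u' f) \<le> 0" using False m by (simp add: mult_le_0_iff)
      ultimately show ?thesis by linarith
    qed
    then show "D f \<ge> - (B * \<delta>)" "m1 * (u f - u' f) \<le> D f + B * \<delta>" by auto
  qed
  \<comment> \<open>The mass flow at \<open>e\<close> gains exactly what the other edges lose, at
    most \<open>B * \<delta>\<close> on each of them.\<close>
  have "(\<Sum>f\<in>E. D f) = 0" unfolding D_def sum_subtractf mass by simp
  then have De: "D e = - (\<Sum>f\<in>E - {e}. D f)" using E e by (simp add: sum.remove)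
  have "(\<Sum>f\<in>E - {e}. - (B * \<delta>)) \<le> (\<Sum>f\<in>E - {e}. D f)" using D_low by (intro sum_mono) auto
  then have "D e \<le> (real (card E) - 1) * (B * \<delta>)"
  proof -
    have "real (card E - 1) = real (card E) - 1"
      using E e by (metis One_nat_def Suc_leI card_gt_0_iff empty_iff of_nat_1 of_nat_diff)
    then show ?thesis using De \<open>(\<Sum>f\<in>E - {e}. - (B * \<delta>)) \<le> _\<close> E e by simp
  qed
  then have "m1 * (u e - u' e) \<le> real (card E) * (B * \<delta>)" using D_up[OF e] by (simp add: left_diff_distrib)
  then have 1: "u e - u' e \<le> junction_const (card E) * \<delta>"
    using m by (simp add: junction_const_def B_def field_simps)
  have "card E \<ge> 1" using E e by (metis One_nat_def Suc_leI card_gt_0_iff empty_iff)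
  then have "m2 * 1 \<le> real (card E) * B" using mult_mono[of 1 "real (card E)" m2 B] B m by simp
  then have "m2 / m1 \<le> junction_const (card E)"
    unfolding junction_const_def B_def[symmetric] using m by (intro divide_right_mono) auto
  then have "m2 / m1 * \<delta> \<le> junction_const (card E) * \<delta>" using \<delta> by (rule mult_right_mono)
  then have "u' e - u e \<le> junction_const (card E) * \<delta>" using drop[OF e] by linarith
  then show ?thesis using 1 by linarith
qed

text \<open>One of the two common enthalpies is at least as large as the other; exchanging the two
  solutions reduces both cases to the one-sided estimate.\<close>

lemma junction_stable:
  assumes Q: "incr_bilipschitz r m1 m2 Q" and H: "incr_bilipschitz r m1 m2 H" and E: "finite E"
    and b: "\<And>e. e \<in> E \<Longrightarrow> \<bar>u e\<bar> \<le> r \<and> \<bar>u' e\<bar> \<le> r \<and> \<bar>v e\<bar> \<le> r \<and> \<bar>v' e\<bar> \<le> r \<and> \<bar>v e - v' e\<bar> \<le> \<delta>"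
    and mass: "(\<Sum>e\<in>E. Q (u e) (v e)) = 0" "(\<Sum>e\<in>E. Q (u' e) (v' e)) = 0"
    and h: "\<And>e f. e \<in> E \<Longrightarrow> f \<in> E \<Longrightarrow> H (u e) (v e) = H (u f) (v f)"
      "\<And>e f. e \<in> E \<Longrightarrow> f \<in> E \<Longrightarrow> H (u' e) (v' e) = H (u' f) (v' f)"
    and e: "e \<in> E"
  shows "\<bar>u e - u' e\<bar> \<le> junction_const (card E) * \<delta>"
proof (cases "H (u' e) (v' e) \<le> H (u e) (v e)")
  case True
  have "H (u' f) (v' f) \<le> H (u f) (v f)" if "f \<in> E" for f
    using True h(1)[OF e that] h(2)[OF e that] by simp
  then show ?thesis using b by (intro junction_stable_aux[OF Q H E _ mass _ e]) auto
next
  case False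
  have "H (u f) (v f) \<le> H (u' f) (v' f)" if "f \<in> E" for f
    using False h(1)[OF e that] h(2)[OF e that] by simp
  moreover have "\<bar>v' f - v f\<bar> \<le> \<delta>" if "f \<in> E" for f using b[OF that] by (simp add: abs_minus_commute)
  ultimately have "\<bar>u' e - u e\<bar> \<le> junction_const (card E) * \<delta>"
    using b by (intro junction_stable_aux[OF Q H E _ mass(2,1) _ e]) auto
  then show ?thesis by (simp add: abs_minus_commute)
qed

text \<open>Shooting in the common enthalpy \<open>h\<close>: on each edge \<open>h\<close>
  determines the outgoing invariant, and the total mass flow is a continuous function of
  \<open>h\<close> that passes through zero between \<open>H0 - \<eta>\<close> and
  \<open>H0 + \<eta>\<close>.\<close>

lemma junction_exists:
  assumes Q: "incr_bilipschitz r m1 m2 Q" and H: "incr_bilipschitz r m1 m2 H" and E: "finite E"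
    and Q0: "Q 0 0 = 0"
    and v: "\<And>e. e \<in> E \<Longrightarrow> \<bar>v e\<bar> \<le> s" and s: "s \<le> r" "(2 * m2 + m2 * m2 / m1) * s \<le> m1 * r"
  shows "\<exists>u. (\<forall>e\<in>E. \<bar>u e\<bar> \<le> r) \<and> (\<Sum>e\<in>E. Q (u e) (v e)) = 0 \<and> (\<forall>e\<in>E. \<forall>f\<in>E. H (u e) (v e) = H (u f) (v f))"
proof (cases "E = {}")
  case False
  then obtain e0 where "e0 \<in> E" by blast
  then have s0: "s \<ge> 0" using v by fastforce
  \<comment> \<open>Raising the enthalpy by \<open>\<eta>\<close> pushes every outgoing invariant to
    at least \<open>m2 / m1 * s\<close>. With the slope \<open>m1\<close>, its mass flow then
    outweighs the part due to the incoming invariant, which is at most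
    \<open>m2 * s\<close>.\<close>
  define \<eta> where "\<eta> = (m2 + m2 * m2 / m1) * s"
  define H0 where "H0 = H 0 0"
  have \<eta>: "\<eta> \<ge> 0" "\<eta> + m2 * s \<le> m1 * r" "m2 * s \<le> \<eta>"
    using s(2) m s0 by (auto simp: \<eta>_def algebra_simps)
  have vr: "\<bar>v e\<bar> \<le> r" if "e \<in> E" for e using v[OF that] s by linarith
  have m2v: "m2 * \<bar>v e\<bar> \<le> m2 * s" if "e \<in> E" for e using v[OF that] m by (intro mult_left_mono) auto
  have "\<exists>x. \<bar>x\<bar> \<le> r \<and> H x (v e) = h" if "e \<in> E" "h \<in> {H0 - \<eta>..H0 + \<eta>}" for e h
  proof (rule root_exists[OF H vr[OF that(1)]])
    have "\<bar>h - H 0 0\<bar> \<le> \<eta>" using that(2) by (auto simp: H0_def abs_le_iff)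
    then show "\<bar>h - H 0 0\<bar> + m2 * \<bar>v e\<bar> \<le> m1 * r" using m2v[OF that(1)] \<eta>(2) by linarith
  qed
  then obtain U where U: "\<And>e h. e \<in> E \<Longrightarrow> h \<in> {H0 - \<eta>..H0 + \<eta>} \<Longrightarrow> \<bar>U e h\<bar> \<le> r \<and> H (U e h) (v e) = h"
    by metis
  define S where "S h = (\<Sum>e\<in>E. Q (U e h) (v e))" for h
  have "continuous_on {H0 - \<eta>..H0 + \<eta>} S"
    unfolding S_def
  proof (intro continuous_on_sum)
    fix e assume e: "e \<in> E"
    show "continuous_on {H0 - \<eta>..H0 + \<eta>} (\<lambda>h. Q (U e h) (v e))"
    proof (rule lipschitz_on_continuous_on[OF lipschitz_onI])
      fix x y assume xy: "x \<in> {H0 - \<eta>..H0 + \<eta>}" "y \<in> {H0 - \<eta>..H0 + \<eta>}"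
      have "m1 * \<bar>U e x - U e y\<bar> \<le> \<bar>x - y\<bar>"
        using root_stable[OF H, of "U e x" "U e y" "v e" "v e"] U[OF e xy(1)] U[OF e xy(2)] vr[OF e] by simp
      then have "\<bar>U e x - U e y\<bar> \<le> \<bar>x - y\<bar> / m1" using m by (simp add: field_simps)
      then have "m2 * \<bar>U e x - U e y\<bar> \<le> m2 * (\<bar>x - y\<bar> / m1)" using m by (intro mult_left_mono) auto
      then show "dist (Q (U e x) (v e)) (Q (U e y) (v e)) \<le> (m2 / m1) * dist x y"
        using incr_bilipschitz_lip[OF Q, of "U e x" "U e y" "v e" "v e"] U[OF e xy(1)] U[OF e xy(2)] vr[OF e]
        by (simp add: dist_real_def)
    qed (use m in simp)
  qed
  moreover have "0 \<le> S (H0 + \<eta>)"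
    unfolding S_def
  proof (rule sum_nonneg)
    fix e assume e: "e \<in> E"
    define x where "x = U e (H0 + \<eta>)"
    have x: "\<bar>x\<bar> \<le> r" "H x (v e) = H0 + \<eta>" using U[OF e, of "H0 + \<eta>"] \<eta>(1) by (auto simp: x_def)
    have "\<bar>H 0 (v e) - H0\<bar> \<le> m2 * s"
      using incr_bilipschitz_lip[OF H _ _ vr[OF e], of 0 0 0] r m2v[OF e] by (simp add: H0_def)
    then have x0: "0 \<le> x" using root_mono[OF H x(1) _ vr[OF e], of 0] x(2) r \<eta>(3) by simp
    have "\<eta> \<le> m2 * (x + \<bar>v e\<bar>)"
      using incr_bilipschitz_lip[OF H x(1) _ vr[OF e], of 0 0] r x(2) x0 by (simp add: H0_def)
    then have "(m2 + m2 * m2 / m1) * s \<le> m2 * (x + s)" using m2v[OF e] by (simp add: \<eta>_def algebra_simps)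
    then have "m2 * (m2 / m1 * s) \<le> m2 * x" by (simp add: algebra_simps)
    then have "m2 / m1 * s \<le> x" by (rule mult_left_le_imp_le) (use m in simp)
    then have "m2 * s \<le> m1 * x" using m by (simp add: field_simps)
    moreover have "m1 * x \<le> Q x (v e) - Q 0 (v e)" using incr_bilipschitz_incr[OF Q x(1) _ vr[OF e] x0] r by simp
    moreover have "\<bar>Q 0 (v e)\<bar> \<le> m2 * s" using incr_bilipschitz_lip[OF Q _ _ vr[OF e], of 0 0 0] r m2v[OF e] Q0 by simp
    ultimately show "0 \<le> Q (U e (H0 + \<eta>)) (v e)" unfolding x_def[symmetric] by linarith
  qed
  moreover have "S (H0 - \<eta>) \<le> 0"
    unfolding S_def
  proof (rule sum_nonpos)
    fix e assume e: "e \<in> E"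
    define x where "x = U e (H0 - \<eta>)"
    have x: "\<bar>x\<bar> \<le> r" "H x (v e) = H0 - \<eta>" using U[OF e, of "H0 - \<eta>"] \<eta>(1) by (auto simp: x_def)
    have "\<bar>H 0 (v e) - H0\<bar> \<le> m2 * s"
      using incr_bilipschitz_lip[OF H _ _ vr[OF e], of 0 0 0] r m2v[OF e] by (simp add: H0_def)
    then have x0: "x \<le> 0" using root_mono[OF H _ x(1) vr[OF e], of 0] x(2) r \<eta>(3) by simp
    have "\<eta> \<le> m2 * (- x + \<bar>v e\<bar>)"
      using incr_bilipschitz_lip[OF H x(1) _ vr[OF e], of 0 0] r x(2) x0 by (simp add: H0_def)
    then have "(m2 + m2 * m2 / m1) * s \<le> m2 * (- x + s)" using m2v[OF e] by (simp add: \<eta>_def algebra_simps)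
    then have "m2 * (m2 / m1 * s) \<le> m2 * (- x)" by (simp add: algebra_simps)
    then have "m2 / m1 * s \<le> - x" by (rule mult_left_le_imp_le) (use m in simp)
    then have "m2 * s \<le> m1 * (- x)" using m by (simp add: field_simps)
    moreover have "m1 * (0 - x) \<le> Q 0 (v e) - Q x (v e)" using incr_bilipschitz_incr[OF Q _ x(1) vr[OF e] x0] r by simp
    moreover have "\<bar>Q 0 (v e)\<bar> \<le> m2 * s" using incr_bilipschitz_lip[OF Q _ _ vr[OF e], of 0 0 0] r m2v[OF e] Q0 by simp
    ultimately show "Q (U e (H0 - \<eta>)) (v e) \<le> 0" unfolding x_def[symmetric] by simp
  qed
  ultimately obtain h where h: "H0 - \<eta> \<le> h" "h \<le> H0 + \<eta>" "S h = 0"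
    using IVT'[of S "H0 - \<eta>" 0 "H0 + \<eta>"] \<eta>(1) by auto
  show ?thesis
    using U h by (intro exI[of _ "\<lambda>e. U e h"]) (auto simp: S_def)
qed auto

end

section \<open>Constants of the gas law\<close>

lemma increment_between:
  fixes f f' :: "real \<Rightarrow> real"
  assumes der: "\<And>x. x \<in> {a..b} \<Longrightarrow> (f has_real_derivative f' x) (at x within {a..b})"
    and bd: "\<And>x. x \<in> {a..b} \<Longrightarrow> l \<le> f' x \<and> f' x \<le> u"
    and xy: "x \<in> {a..b}" "y \<in> {a..b}" "x \<le> y"
  shows "l * (y - x) \<le> f y - f x" "f y - f x \<le> u * (y - x)"
proof -
  have "l * (y - x) \<le> f y - f x \<and> f y - f x \<le> u * (y - x)"
  proof (cases "x = y")
    case False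
    then have lt: "x < y" using xy by simp
    have sub: "{x..y} \<subseteq> {a..b}" using xy by auto
    have "\<exists>z\<in>{x<..<y}. f y - f x = f' z * (y - x)"
    proof (rule mvt_simple[OF lt])
      fix z assume "x \<le> z" "z \<le> y"
      then show "(f has_derivative (*) (f' z)) (at z within {x..y})"
        using der[of z] sub DERIV_subset[of f "f' z" z "{a..b}" "{x..y}"] xy by (auto simp: has_field_derivative_def)
    qed
    then obtain z where z: "z \<in> {x<..<y}" "f y - f x = f' z * (y - x)" by blast
    have "l \<le> f' z \<and> f' z \<le> u" using z xy by (intro bd) auto
    then show ?thesis unfolding z(2) using lt by (auto intro!: mult_right_mono)
  qed auto
  then show "l * (y - x) \<le> f y - f x" "f y - f x \<le> u * (y - x)" by auto
qed

lemma continuous_bounds: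
  fixes f :: "real \<Rightarrow> real"
  assumes "continuous_on {a..b} f" "a \<le> b"
  obtains l u where "\<And>x. x \<in> {a..b} \<Longrightarrow> l \<le> f x \<and> f x \<le> u" "l \<in> f ` {a..b}" "u \<in> f ` {a..b}"
proof -
  obtain x where x: "x \<in> {a..b}" "\<And>z. z \<in> {a..b} \<Longrightarrow> f z \<le> f x"
    using continuous_attains_sup[of "{a..b}" f] assms by auto
  obtain y where y: "y \<in> {a..b}" "\<And>z. z \<in> {a..b} \<Longrightarrow> f y \<le> f z"
    using continuous_attains_inf[of "{a..b}" f] assms by auto
  show thesis by (rule that[of "f y" "f x"]) (use x y in auto)
qed

lemma pressure_law_facts:
  assumes "pressure_law p" "x > 0"
  shows "deriv p x > 0" "(deriv p has_real_derivative deriv (deriv p) x) (at x)"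
    "isCont (deriv p) x" "isCont (deriv (deriv p)) x"
proof -
  show "deriv p x > 0" using assms by (simp add: pressure_law_def)
  have d: "(deriv ^^ k) p differentiable (at x)" for k
    using assms by (simp add: pressure_law_def smooth_on_def)
  have 1: "deriv p differentiable (at x)" using d[of 1] by simp
  have 2: "deriv (deriv p) differentiable (at x)" using d[of 2] by (simp add: numeral_2_eq_2)
  show "(deriv p has_real_derivative deriv (deriv p) x) (at x)"
    using 1 by (simp add: DERIV_deriv_iff_real_differentiable)
  show "isCont (deriv p) x" "isCont (deriv (deriv p)) x"
    using 1 2 differentiable_imp_continuous_within by blast+
qed

lemma Ptilde_increment:
  assumes p: "pressure_law p" and a: "0 < a" and ref: "\<rho>ref \<in> {a..b}"
    and bd: "\<And>s. s \<in> {a..b} \<Longrightarrow> l \<le> sqrt (deriv p s) / (sound_speed p \<rho>ref * s) \<and> sqrt (deriv p s) / (sound_speed p \<rho>ref * s) \<le> u"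
    and xy: "x \<in> {a..b}" "y \<in> {a..b}" "x \<le> y"
  shows "l * (y - x) \<le> Ptilde p \<rho>ref y - Ptilde p \<rho>ref x" "Ptilde p \<rho>ref y - Ptilde p \<rho>ref x \<le> u * (y - x)"
proof -
  define f where "f s = sqrt (deriv p s) / (sound_speed p \<rho>ref * s)" for s
  define G where "G x = integral {a..x} f" for x
  have c: "sound_speed p \<rho>ref \<noteq> 0"
    using pressure_law_facts(1)[OF p, of \<rho>ref] a ref by (simp add: sound_speed_def)
  have cont: "continuous_on {a..b} f"
    unfolding f_def
  proof (intro continuous_intros)
    show "continuous_on {a..b} (deriv p)"
      using pressure_law_facts(3)[OF p] a by (intro continuous_at_imp_continuous_on ballI) auto
  qed (use a c in auto)
  have G: "(G has_vector_derivative f x) (at x within {a..b})" if "x \<in> {a..b}" for x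
    unfolding G_def by (rule integral_has_vector_derivative[OF cont that])
  have PG: "Ptilde p \<rho>ref x = G x - G \<rho>ref" if x: "x \<in> {a..b}" for x
  proof -
    have sub: "{min \<rho>ref x..max \<rho>ref x} \<subseteq> {a..b}" using x ref by auto
    have "(LBINT s=ereal \<rho>ref..ereal x. f s) = G x - G \<rho>ref"
    proof (rule interval_integral_FTC_finite)
      show "continuous_on {min \<rho>ref x..max \<rho>ref x} f" by (rule continuous_on_subset[OF cont sub])
      fix z assume "min \<rho>ref x \<le> z" "z \<le> max \<rho>ref x"
      then have "z \<in> {a..b}" using sub by auto
      then show "(G has_vector_derivative f z) (at z within {min \<rho>ref x..max \<rho>ref x})"
        using G sub by (blast intro: has_vector_derivative_within_subset)
    qed
    then show ?thesis by (simp add: Ptilde_def f_def)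
  qed
  have der: "(G has_real_derivative f x) (at x within {a..b})" if "x \<in> {a..b}" for x
    using G[OF that] by (simp add: has_real_derivative_iff_has_vector_derivative)
  have bd': "l \<le> f x \<and> f x \<le> u" if "x \<in> {a..b}" for x using bd[OF that] by (simp add: f_def)
  show "l * (y - x) \<le> Ptilde p \<rho>ref y - Ptilde p \<rho>ref x" "Ptilde p \<rho>ref y - Ptilde p \<rho>ref x \<le> u * (y - x)"
    using increment_between[of a b G f l u x y, OF der bd' xy] PG[OF xy(1)] PG[OF xy(2)] by auto
qed

lemma Ptilde_integrand_bounds:
  assumes p: "pressure_law p" and a: "0 < a" and ab: "a \<le> b" and ref: "\<rho>ref > 0"
  obtains l u where "l > 0" "u > 0"
    "\<And>s. s \<in> {a..b} \<Longrightarrow> l \<le> sqrt (deriv p s) / (sound_speed p \<rho>ref * s) \<and> sqrt (deriv p s) / (sound_speed p \<rho>ref * s) \<le> u"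
proof -
  define f where "f s = sqrt (deriv p s) / (sound_speed p \<rho>ref * s)" for s
  have c: "sound_speed p \<rho>ref > 0"
    using pressure_law_facts(1)[OF p ref] by (simp add: sound_speed_def)
  have cont: "continuous_on {a..b} f"
    unfolding f_def
  proof (intro continuous_intros)
    show "continuous_on {a..b} (deriv p)"
      using pressure_law_facts(3)[OF p] a by (intro continuous_at_imp_continuous_on ballI) auto
  qed (use a c in auto)
  have pos: "f s > 0" if "s \<in> {a..b}" for s
    using that a c pressure_law_facts(1)[OF p, of s] by (simp add: f_def)
  obtain l u where "\<And>x. x \<in> {a..b} \<Longrightarrow> l \<le> f x \<and> f x \<le> u" "l \<in> f ` {a..b}" "u \<in> f ` {a..b}"
    using continuous_bounds[OF cont ab] by blast
  then show thesis using pos by (intro that[of l u]) (auto simp: f_def)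
qed

lemma Ptilde_strict_mono:
  assumes p: "pressure_law p" and ref: "\<rho>ref > 0" and xy: "0 < x" "x < y"
  shows "Ptilde p \<rho>ref x < Ptilde p \<rho>ref y"
proof -
  define a b where "a = min x \<rho>ref" and "b = max y \<rho>ref"
  have ab: "0 < a" "a \<le> b" "\<rho>ref \<in> {a..b}" "x \<in> {a..b}" "y \<in> {a..b}" using xy ref by (auto simp: a_def b_def)
  obtain l u where lu: "l > 0" "\<And>s. s \<in> {a..b} \<Longrightarrow> l \<le> sqrt (deriv p s) / (sound_speed p \<rho>ref * s) \<and> sqrt (deriv p s) / (sound_speed p \<rho>ref * s) \<le> u"
    using Ptilde_integrand_bounds[OF p ab(1,2) ref] by metis
  have "l * (y - x) \<le> Ptilde p \<rho>ref y - Ptilde p \<rho>ref x"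
    using Ptilde_increment(1)[OF p ab(1,3) lu(2) ab(4,5)] xy by simp
  moreover have "0 < l * (y - x)" using lu(1) xy by simp
  ultimately show ?thesis by linarith
qed

lemma Ptilde_inj: "pressure_law p \<Longrightarrow> \<rho>ref > 0 \<Longrightarrow> inj_on (Ptilde p \<rho>ref) {0<..}"
  by (rule linorder_inj_onI) (use Ptilde_strict_mono in fastforce)+

text \<open>Everything is controlled on the compact interval from \<open>\<rho>ref / 2\<close> to
  \<open>2 * \<rho>ref\<close>, where \<open>Ptilde\<close> is bilipschitz. The slope of
  \<open>deriv P\<close> at \<open>x\<close> is \<open>deriv p x / x\<close>, so its bounds come
  from \<open>p\<close> and hold for all potentials at once.\<close>

lemma density_bounds:
  assumes p: "pressure_law p" and ref: "\<rho>ref > 0"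
  obtains r k1 k2 where "r > 0" "0 < k1" "k1 \<le> k2"
    "\<And>z. \<bar>z\<bar> \<le> r \<Longrightarrow> z \<in> Ptilde p \<rho>ref ` {0<..}"
    "\<And>z. \<bar>z\<bar> \<le> r \<Longrightarrow> k1 \<le> Ptilde_inv p \<rho>ref z \<and> Ptilde_inv p \<rho>ref z \<le> k2"
    "\<And>z. \<bar>z\<bar> \<le> r \<Longrightarrow> k1 \<le> sqrt (deriv p (Ptilde_inv p \<rho>ref z)) \<and> sqrt (deriv p (Ptilde_inv p \<rho>ref z)) \<le> k2"
    "\<And>z z'. \<bar>z\<bar> \<le> r \<Longrightarrow> \<bar>z'\<bar> \<le> r \<Longrightarrow> \<bar>Ptilde_inv p \<rho>ref z - Ptilde_inv p \<rho>ref z'\<bar> \<le> k2 * \<bar>z - z'\<bar>"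
    "\<And>z z'. \<bar>z\<bar> \<le> r \<Longrightarrow> \<bar>z'\<bar> \<le> r \<Longrightarrow>
       \<bar>sqrt (deriv p (Ptilde_inv p \<rho>ref z)) - sqrt (deriv p (Ptilde_inv p \<rho>ref z'))\<bar> \<le> k2 * \<bar>z - z'\<bar>"
    "\<And>P z z'. pressure_potential p P \<Longrightarrow> \<bar>z\<bar> \<le> r \<Longrightarrow> \<bar>z'\<bar> \<le> r \<Longrightarrow> z' \<le> z \<Longrightarrow>
       k1 * (z - z') \<le> deriv P (Ptilde_inv p \<rho>ref z) - deriv P (Ptilde_inv p \<rho>ref z') \<and>
       deriv P (Ptilde_inv p \<rho>ref z) - deriv P (Ptilde_inv p \<rho>ref z') \<le> k2 * (z - z')"
proof -
  define a b where "a = \<rho>ref / 2" and "b = 2 * \<rho>ref"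
  have ab: "0 < a" "a \<le> b" "\<rho>ref \<in> {a..b}" "a \<in> {a..b}" "b \<in> {a..b}" using ref by (auto simp: a_def b_def)
  have xpos: "x > 0" if "x \<in> {a..b}" for x using that ab(1) by auto
  let ?Pt = "Ptilde p \<rho>ref" and ?Q = "Ptilde_inv p \<rho>ref"
  obtain l u where lu: "l > 0" "u > 0" "\<And>s. s \<in> {a..b} \<Longrightarrow> l \<le> sqrt (deriv p s) / (sound_speed p \<rho>ref * s) \<and> sqrt (deriv p s) / (sound_speed p \<rho>ref * s) \<le> u"
    using Ptilde_integrand_bounds[OF p ab(1,2) ref] by metis
  have incr: "l * (y - x) \<le> ?Pt y - ?Pt x" "?Pt y - ?Pt x \<le> u * (y - x)"
    if "x \<in> {a..b}" "y \<in> {a..b}" "x \<le> y" for x y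
    using Ptilde_increment[OF p ab(1,3) lu(3) that] by blast+
  have cont1: "continuous_on {a..b} (deriv p)" "continuous_on {a..b} (deriv (deriv p))"
    using pressure_law_facts[OF p] xpos by (auto intro!: continuous_at_imp_continuous_on)
  obtain d1 d2 where d: "\<And>x. x \<in> {a..b} \<Longrightarrow> d1 \<le> deriv p x \<and> deriv p x \<le> d2" "d1 \<in> deriv p ` {a..b}"
    using continuous_bounds[OF cont1(1) ab(2)] by metis
  have d1: "d1 > 0" using d(2) pressure_law_facts(1)[OF p] xpos by auto
  have d2: "d2 \<ge> d1" using d(1)[OF ab(3)] by linarith
  obtain e1 e2 where e: "\<And>x. x \<in> {a..b} \<Longrightarrow> e1 \<le> deriv (deriv p) x \<and> deriv (deriv p) x \<le> e2"
    using continuous_bounds[OF cont1(2) ab(2)] by metis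
  define e where "e = \<bar>e1\<bar> + \<bar>e2\<bar>"
  have e_bd: "- e \<le> deriv (deriv p) x \<and> deriv (deriv p) x \<le> e" if "x \<in> {a..b}" for x
    using e[OF that] by (auto simp: e_def)
  \<comment> \<open>\<open>Ptilde\<close> has slope at least \<open>l\<close> on an interval that
    extends \<open>\<rho>ref / 2\<close> to the left of its zero \<open>\<rho>ref\<close> and
    farther to the right, so it attains all values of modulus at most \<open>r\<close>
    there.\<close>
  define r where "r = l * \<rho>ref / 2"
  have ref0: "?Pt \<rho>ref = 0" by (simp add: Ptilde_def)
  have cPt: "continuous_on {a..b} ?Pt"
  proof (rule lipschitz_on_continuous_on[OF lipschitz_onI])
    show "0 \<le> u" using lu by simp
    fix x y assume "x \<in> {a..b}" "y \<in> {a..b}"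
    then show "dist (?Pt x) (?Pt y) \<le> u * dist x y"
    proof (induction x y rule: linorder_wlog)
      case (le x y)
      have "0 \<le> l * (y - x)" using lu le by simp
      then show ?case using incr[OF le(2,3,1)] le(1) by (simp add: dist_real_def)
    qed (simp add: dist_commute)
  qed
  have lo: "?Pt a \<le> - r" and hi: "r \<le> ?Pt b"
  proof -
    have "l * (\<rho>ref - a) = r" "l * (b - \<rho>ref) = 2 * r" "r \<ge> 0" using lu(1) ref by (simp_all add: r_def a_def b_def)
    then show "?Pt a \<le> - r" "r \<le> ?Pt b"
      using incr(1)[OF ab(4,3)] incr(1)[OF ab(3,5)] ab(3) ref0 by simp_all
  qed
  have Q: "?Q z \<in> {a..b} \<and> ?Pt (?Q z) = z" if z: "\<bar>z\<bar> \<le> r" for z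
  proof -
    obtain x where x: "x \<in> {a..b}" "?Pt x = z"
      using IVT'[of ?Pt a z b] lo hi z cPt ab(2) by (auto simp: abs_le_iff)
    have "?Q (?Pt x) = x"
      unfolding Ptilde_inv_def by (rule inv_into_f_f[OF Ptilde_inj[OF p ref]]) (use xpos[OF x(1)] in simp)
    then show ?thesis using x by simp
  qed
  have Q_incr: "?Q z' \<le> ?Q z" "l * (?Q z - ?Q z') \<le> z - z'" "z - z' \<le> u * (?Q z - ?Q z')"
    if z: "\<bar>z\<bar> \<le> r" "\<bar>z'\<bar> \<le> r" "z' \<le> z" for z z'
  proof -
    show 1: "?Q z' \<le> ?Q z"
    proof (rule ccontr)
      assume "\<not> ?Q z' \<le> ?Q z"
      then have "?Pt (?Q z) < ?Pt (?Q z')"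
        using Q[OF z(1)] by (intro Ptilde_strict_mono[OF p ref] xpos) auto
      then show False using Q[OF z(1)] Q[OF z(2)] z(3) by simp
    qed
    show "l * (?Q z - ?Q z') \<le> z - z'" "z - z' \<le> u * (?Q z - ?Q z')"
      using incr[of "?Q z'" "?Q z"] Q[OF z(1)] Q[OF z(2)] 1 by auto
  qed
  have Q_lip: "\<bar>?Q z - ?Q z'\<bar> \<le> 1 / l * \<bar>z - z'\<bar>" if "\<bar>z\<bar> \<le> r" "\<bar>z'\<bar> \<le> r" for z z'
    using that
  proof (induction z z' rule: linorder_wlog)
    case (le z z')
    then show ?case using Q_incr[of z' z] lu(1) by (simp add: field_simps)
  qed (simp add: abs_minus_commute)
  define sd where "sd = sqrt d1"
  have sq: "sd > 0" using d1 by (simp add: sd_def)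
  have sqrt_lip: "\<bar>sqrt (deriv p (?Q z)) - sqrt (deriv p (?Q z'))\<bar> \<le> e / sd / l * \<bar>z - z'\<bar>"
    if z: "\<bar>z\<bar> \<le> r" "\<bar>z'\<bar> \<le> r" for z z'
  proof -
    have D: "\<bar>deriv p x - deriv p y\<bar> \<le> e * \<bar>x - y\<bar>" if "x \<in> {a..b}" "y \<in> {a..b}" for x y
      using that
    proof (induction x y rule: linorder_wlog)
      case (le x y)
      have "(deriv p has_real_derivative deriv (deriv p) z) (at z within {a..b})" if "z \<in> {a..b}" for z
        using pressure_law_facts(2)[OF p xpos[OF that]] by (rule has_field_derivative_at_within)
      from increment_between[OF this e_bd le(2,3,1)] show ?case using le(1) by (simp add: abs_le_iff algebra_simps)
    qed (simp add: abs_minus_commute)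
    let ?x = "deriv p (?Q z)" and ?y = "deriv p (?Q z')"
    have xy: "?x \<ge> d1" "?y \<ge> d1" using d(1) Q z by auto
    then have s: "sqrt ?x \<ge> sd" "sqrt ?y \<ge> sd" by (auto simp: sd_def)
    have "\<bar>sqrt ?x - sqrt ?y\<bar> * sd \<le> \<bar>sqrt ?x - sqrt ?y\<bar> * (sqrt ?x + sqrt ?y)"
      using s sq by (intro mult_left_mono) linarith+
    also have "\<dots> = \<bar>(sqrt ?x - sqrt ?y) * (sqrt ?x + sqrt ?y)\<bar>" using s sq by (simp add: abs_mult)
    also have "(sqrt ?x - sqrt ?y) * (sqrt ?x + sqrt ?y) = ?x - ?y"
      using xy d1 by (simp add: algebra_simps flip: real_sqrt_mult)
    also have "\<bar>?x - ?y\<bar> \<le> e * \<bar>?Q z - ?Q z'\<bar>" using D Q z by auto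
    also have "\<dots> \<le> e * (1 / l * \<bar>z - z'\<bar>)" using Q_lip[OF z] by (intro mult_left_mono) (auto simp: e_def)
    finally have "\<bar>sqrt ?x - sqrt ?y\<bar> \<le> e * (1 / l * \<bar>z - z'\<bar>) / sd" using pos_le_divide_eq[OF sq] by blast
    then show ?thesis by (simp add: divide_inverse mult_ac)
  qed
  \<comment> \<open>Lower bounds for the density, for the sound speed and for the slope of
    \<open>deriv P\<close> composed with the inverse of \<open>Ptilde\<close>; \<open>k2\<close>
    collects the upper bounds and the Lipschitz constants.\<close>
  define k1 where "k1 = Min {a, sqrt d1, d1 / b / u}"
  define k2 where "k2 = Max {a, b, sqrt d2, 1 / l, e / sd / l, d2 / a / l}"
  have k1: "k1 > 0" "k1 \<le> a" "k1 \<le> sqrt d1" "k1 \<le> d1 / b / u"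
    using ab d1 lu ref by (auto simp: k1_def b_def)
  have k2: "b \<le> k2" "sqrt d2 \<le> k2" "1 / l \<le> k2" "e / sd / l \<le> k2" "d2 / a / l \<le> k2"
    by (auto simp: k2_def)
  show thesis
  proof (rule that[of r k1 k2])
    show "r > 0" using lu ref by (simp add: r_def)
    show "0 < k1" "k1 \<le> k2" using k1 k2 ab by auto
    fix z assume z: "\<bar>z\<bar> \<le> r"
    have Qz: "?Q z \<in> {a..b}" "?Pt (?Q z) = z" using Q[OF z] by auto
    show "z \<in> ?Pt ` {0<..}" by (rule image_eqI[of _ _ "?Q z"]) (use Qz xpos in auto)
    show "k1 \<le> ?Q z \<and> ?Q z \<le> k2" using Qz k1 k2 by auto
    have "sqrt d1 \<le> sqrt (deriv p (?Q z))" "sqrt (deriv p (?Q z)) \<le> sqrt d2" using d(1)[OF Qz(1)] by auto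
    then show "k1 \<le> sqrt (deriv p (?Q z)) \<and> sqrt (deriv p (?Q z)) \<le> k2" using k1 k2 by linarith
    fix z' assume z': "\<bar>z'\<bar> \<le> r"
    have "1 / l * \<bar>z - z'\<bar> \<le> k2 * \<bar>z - z'\<bar>" by (rule mult_right_mono[OF k2(3)]) simp
    moreover have "e / sd / l * \<bar>z - z'\<bar> \<le> k2 * \<bar>z - z'\<bar>" by (rule mult_right_mono[OF k2(4)]) simp
    ultimately show "\<bar>?Q z - ?Q z'\<bar> \<le> k2 * \<bar>z - z'\<bar>"
      "\<bar>sqrt (deriv p (?Q z)) - sqrt (deriv p (?Q z'))\<bar> \<le> k2 * \<bar>z - z'\<bar>"
      using Q_lip[OF z z'] sqrt_lip[OF z z'] by linarith+
    fix P assume P: "pressure_potential p P" and le: "z' \<le> z"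
    have der: "(deriv P has_real_derivative deriv p x / x) (at x within {a..b})" if "x \<in> {a..b}" for x
    proof -
      have "(deriv ^^ 1) P differentiable (at x)" and "deriv p x = x * deriv (deriv P) x"
        using P xpos[OF that] unfolding pressure_potential_def smooth_on_def by (blast, simp)
      then have "(deriv P has_real_derivative deriv p x / x) (at x)"
        using xpos[OF that] by (simp add: DERIV_deriv_iff_real_differentiable[symmetric])
      then show ?thesis by (rule has_field_derivative_at_within)
    qed
    have bd: "d1 / b \<le> deriv p x / x \<and> deriv p x / x \<le> d2 / a" if "x \<in> {a..b}" for x
      using d(1)[OF that] that ab(1) d1 d2 by (auto intro!: frac_le)
    have Qz': "?Q z' \<in> {a..b}" using Q[OF z'] by auto
    note Qi = Q_incr[OF z z' le]
    note Pi = increment_between[OF der bd Qz' Qz(1) Qi(1)]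
    have "k1 * (z - z') \<le> d1 / b / u * (z - z')" using k1 le by (intro mult_right_mono) auto
    also have "\<dots> \<le> d1 / b / u * (u * (?Q z - ?Q z'))"
      using Qi(3) d1 ab lu ref by (intro mult_left_mono) (auto simp: b_def)
    also have "\<dots> = d1 / b * (?Q z - ?Q z')" using lu by simp
    finally have 1: "k1 * (z - z') \<le> deriv P (?Q z) - deriv P (?Q z')" using Pi(1) by linarith
    have "d2 / a * (?Q z - ?Q z') = d2 / a / l * (l * (?Q z - ?Q z'))" using lu by simp
    also have "\<dots> \<le> d2 / a / l * (z - z')" using Qi(2) d1 d2 ab lu by (intro mult_left_mono) auto
    also have "\<dots> \<le> k2 * (z - z')" using k2 le by (intro mult_right_mono) auto
    finally have "deriv P (?Q z) - deriv P (?Q z') \<le> k2 * (z - z')" using Pi(2) by linarith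
    with 1 show "k1 * (z - z') \<le> deriv P (?Q z) - deriv P (?Q z') \<and>
       deriv P (?Q z) - deriv P (?Q z') \<le> k2 * (z - z')" by blast
  qed
qed

text \<open>At rest, mass flow and enthalpy increase strictly with the first invariant and the plus
  speed is positive. The contributions that could spoil this are of the order of the velocity, hence
  of \<open>r\<close>, and \<open>r\<close> is so small that they consume at most half of each
  margin.\<close>

lemma gas_constants:
  assumes p: "pressure_law p" and ref: "\<rho>ref > 0"
  obtains r m1 m2 lmin lmax C where "r > 0" "0 < m1" "m1 \<le> m2" "0 < lmin" "lmin \<le> lmax" "C \<ge> 0"
    "incr_bilipschitz r m1 m2 (\<lambda>u v. mass_flow p \<rho>ref (u, v))"
    "\<And>P. pressure_potential p P \<Longrightarrow> incr_bilipschitz r m1 m2 (\<lambda>u v. enthalpy p P \<rho>ref (u, v))"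
    "\<And>u v. \<bar>u\<bar> \<le> r \<Longrightarrow> \<bar>v\<bar> \<le> r \<Longrightarrow> (u, v) \<in> physical_states p \<rho>ref"
    "\<And>u v. \<bar>u\<bar> \<le> r \<Longrightarrow> \<bar>v\<bar> \<le> r \<Longrightarrow> lmin \<le> lambda_plus p \<rho>ref (u, v) \<and> lambda_plus p \<rho>ref (u, v) \<le> lmax"
    "\<And>u v u' v'. \<bar>u\<bar> \<le> r \<Longrightarrow> \<bar>v\<bar> \<le> r \<Longrightarrow> \<bar>u'\<bar> \<le> r \<Longrightarrow> \<bar>v'\<bar> \<le> r \<Longrightarrow>
       \<bar>lambda_plus p \<rho>ref (u, v) - lambda_plus p \<rho>ref (u', v')\<bar> \<le> C * (\<bar>u - u'\<bar> + \<bar>v - v'\<bar>)"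
proof (rule density_bounds[OF p ref])
  fix r0 k1 k2 :: real
  assume r0: "r0 > 0" and k: "0 < k1" "k1 \<le> k2"
    and phys: "\<And>z. \<bar>z\<bar> \<le> r0 \<Longrightarrow> z \<in> Ptilde p \<rho>ref ` {0<..}"
    and Qb: "\<And>z. \<bar>z\<bar> \<le> r0 \<Longrightarrow> k1 \<le> Ptilde_inv p \<rho>ref z \<and> Ptilde_inv p \<rho>ref z \<le> k2"
    and ab: "\<And>z. \<bar>z\<bar> \<le> r0 \<Longrightarrow> k1 \<le> sqrt (deriv p (Ptilde_inv p \<rho>ref z)) \<and> sqrt (deriv p (Ptilde_inv p \<rho>ref z)) \<le> k2"
    and Ql: "\<And>z z'. \<bar>z\<bar> \<le> r0 \<Longrightarrow> \<bar>z'\<bar> \<le> r0 \<Longrightarrow> \<bar>Ptilde_inv p \<rho>ref z - Ptilde_inv p \<rho>ref z'\<bar> \<le> k2 * \<bar>z - z'\<bar>"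
    and al: "\<And>z z'. \<bar>z\<bar> \<le> r0 \<Longrightarrow> \<bar>z'\<bar> \<le> r0 \<Longrightarrow>
       \<bar>sqrt (deriv p (Ptilde_inv p \<rho>ref z)) - sqrt (deriv p (Ptilde_inv p \<rho>ref z'))\<bar> \<le> k2 * \<bar>z - z'\<bar>"
    and Pl: "\<And>P z z'. pressure_potential p P \<Longrightarrow> \<bar>z\<bar> \<le> r0 \<Longrightarrow> \<bar>z'\<bar> \<le> r0 \<Longrightarrow> z' \<le> z \<Longrightarrow>
       k1 * (z - z') \<le> deriv P (Ptilde_inv p \<rho>ref z) - deriv P (Ptilde_inv p \<rho>ref z') \<and>
       deriv P (Ptilde_inv p \<rho>ref z) - deriv P (Ptilde_inv p \<rho>ref z') \<le> k2 * (z - z')"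
  define c where "c = sound_speed p \<rho>ref"
  have c: "c > 0" using pressure_law_facts(1)[OF p ref] by (simp add: c_def sound_speed_def)
  define Q where "Q = Ptilde_inv p \<rho>ref"
  \<comment> \<open>The three quotients serve, in this order, the slope of the mass flow, the
    positivity of the speed and the slope of the enthalpy.\<close>
  define r where "r = Min {r0, k1 / (2 * k2), k1 / (2 * c), k1 / (2 * c\<^sup>2)}"
  have r: "r > 0" "r \<le> r0" "r \<le> k1 / (2 * k2)" "r \<le> k1 / (2 * c)" "r \<le> k1 / (2 * c\<^sup>2)"
    using r0 k c by (auto simp: r_def)
  have rk: "k2 * r \<le> k1 / 2" "c * r \<le> k1 / 2" "c\<^sup>2 * r \<le> k1 / 2"
    using r(3-5) k c by (simp_all add: le_divide_eq mult.commute mult.left_commute split: if_splits)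
  have k2: "k2 > 0" using k by simp
  define m1 where "m1 = min (c * k1 / 4) (k1 / 4)"
  define m2 where "m2 = Max {m1, c / 2 * (k2 + k2 * r), c\<^sup>2 * r / 2 + k2 / 2}"
  have m1: "m1 > 0" "m1 \<le> c * k1 / 4" "m1 \<le> k1 / 4" using k c by (auto simp: m1_def)
  have m2: "m1 \<le> m2" "c / 2 * (k2 + k2 * r) \<le> m2" "c\<^sup>2 * r / 2 + k2 / 2 \<le> m2"
    unfolding m2_def by (rule Max_ge; simp)+
  have half: "\<bar>(u + v) / 2\<bar> \<le> r0" if "\<bar>u\<bar> \<le> r" "\<bar>v\<bar> \<le> r" for u v :: real
    using that r(2) by (auto simp: abs_le_iff)
  have halfd: "\<bar>(u + v) / 2 - (u' + v') / 2\<bar> \<le> (\<bar>u - u'\<bar> + \<bar>v - v'\<bar>) / 2" for u v u' v' :: real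
  proof -
    have eq: "(u + v) / 2 - (u' + v') / 2 = ((u - u') + (v - v')) / 2" by (simp add: field_simps)
    show ?thesis unfolding eq abs_divide using abs_triangle_ineq[of "u - u'" "v - v'"] by simp
  qed
  define h where "h = c / 2"
  have h: "h > 0" using c by (simp add: h_def)
  have M: "mass_flow p \<rho>ref (u, v) = Q ((u + v) / 2) * (h * (u - v))" for u v
    by (simp add: mass_flow_def density_def velocity_def Q_def c_def h_def)
  have H: "enthalpy p P \<rho>ref (u, v) = c\<^sup>2 / 8 * (u - v)\<^sup>2 + deriv P (Q ((u + v) / 2))" for P u v
    by (simp add: enthalpy_def density_def velocity_def Q_def c_def power_mult_distrib power_divide)
  have Lp: "lambda_plus p \<rho>ref (u, v) = c / 2 * (u - v) + sqrt (deriv p (Q ((u + v) / 2)))" for u v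
    by (simp add: lambda_plus_def density_def velocity_def Q_def c_def)
  show thesis
  proof (rule that[of r m1 m2 "k1 / 2" "k2 + k1 / 2" "c / 2 + k2 / 2"])
    show "incr_bilipschitz r m1 m2 (\<lambda>u v. mass_flow p \<rho>ref (u, v))"
      unfolding incr_bilipschitz_def M
    proof (intro allI impI conjI)
      fix u u' v v' assume b: "\<bar>u\<bar> \<le> r" "\<bar>u'\<bar> \<le> r" "\<bar>v\<bar> \<le> r" "\<bar>v'\<bar> \<le> r"
      define z z' s where "z = (u + v) / 2" and "z' = (u' + v') / 2" and "s = \<bar>u - u'\<bar> + \<bar>v - v'\<bar>"
      have zr: "\<bar>z\<bar> \<le> r0" "\<bar>z'\<bar> \<le> r0" using half b by (auto simp: z_def z'_def)
      have "\<bar>Q z - Q z'\<bar> \<le> k2 * \<bar>z - z'\<bar>" using Ql[OF zr] by (simp add: Q_def)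
      also have "\<dots> \<le> k2 * (s / 2)" using halfd[of u v u' v'] k2 by (intro mult_left_mono) (auto simp: z_def z'_def s_def)
      finally have dQ: "\<bar>Q z - Q z'\<bar> \<le> k2 * (s / 2)" .
      have "Q z * (h * (u - v)) - Q z' * (h * (u' - v'))
         = h * (Q z * ((u - u') - (v - v')) + (Q z - Q z') * (u' - v'))" by (simp add: algebra_simps)
      then have "\<bar>Q z * (h * (u - v)) - Q z' * (h * (u' - v'))\<bar>
         = h * \<bar>Q z * ((u - u') - (v - v')) + (Q z - Q z') * (u' - v')\<bar>" using h by (simp add: abs_mult)
      also have "\<dots> \<le> h * (k2 * s + k2 * (s / 2) * (2 * r))"
      proof (rule mult_left_mono)
        have "\<bar>Q z * ((u - u') - (v - v'))\<bar> \<le> k2 * s"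
          unfolding abs_mult using Qb[OF zr(1)] k by (intro mult_mono) (auto simp: Q_def s_def)
        moreover have "\<bar>(Q z - Q z') * (u' - v')\<bar> \<le> k2 * (s / 2) * (2 * r)"
          unfolding abs_mult using dQ b k2 by (intro mult_mono) (auto simp: s_def)
        ultimately show "\<bar>Q z * ((u - u') - (v - v')) + (Q z - Q z') * (u' - v')\<bar> \<le> k2 * s + k2 * (s / 2) * (2 * r)"
          by linarith
      qed (use h in simp)
      also have "\<dots> = c / 2 * (k2 + k2 * r) * s" by (simp add: h_def algebra_simps)
      also have "\<dots> \<le> m2 * s" using m2(2) by (intro mult_right_mono) (auto simp: s_def)
      finally show "\<bar>Q ((u + v) / 2) * (h * (u - v)) - Q ((u' + v') / 2) * (h * (u' - v'))\<bar>
         \<le> m2 * (\<bar>u - u'\<bar> + \<bar>v - v'\<bar>)" unfolding z_def z'_def s_def .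
    next
      fix u u' v :: real assume b: "\<bar>u\<bar> \<le> r" "\<bar>u'\<bar> \<le> r" "\<bar>v\<bar> \<le> r" and le: "u' \<le> u"
      define z z' where "z = (u + v) / 2" and "z' = (u' + v) / 2"
      have zr: "\<bar>z\<bar> \<le> r0" "\<bar>z'\<bar> \<le> r0" using half b by (auto simp: z_def z'_def)
      have dz: "\<bar>z - z'\<bar> = (u - u') / 2" using le by (simp add: z_def z'_def field_simps)
      have dQ: "\<bar>Q z - Q z'\<bar> \<le> k2 * ((u - u') / 2)" using Ql[OF zr] unfolding Q_def dz .
      have "\<bar>(Q z - Q z') * (u' - v)\<bar> \<le> k2 * ((u - u') / 2) * (2 * r)"
        unfolding abs_mult using dQ b k2 le by (intro mult_mono) auto
      also have "\<dots> = (k2 * r) * (u - u')" by simp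
      also have "\<dots> \<le> k1 / 2 * (u - u')" using rk le by (intro mult_right_mono) auto
      finally have 1: "\<bar>(Q z - Q z') * (u' - v)\<bar> \<le> k1 / 2 * (u - u')" .
      have 2: "k1 * (u - u') \<le> Q z * (u - u')" using Qb[OF zr(1)] le by (intro mult_right_mono) (auto simp: Q_def)
      have "m1 * (u - u') \<le> c * k1 / 4 * (u - u')" using m1 le by (intro mult_right_mono) auto
      also have "\<dots> = h * (k1 / 2 * (u - u'))" by (simp add: h_def)
      also have "\<dots> \<le> h * (Q z * (u - u') + (Q z - Q z') * (u' - v))"
        using 1 2 h by (intro mult_left_mono) auto
      also have "\<dots> = Q z * (h * (u - v)) - Q z' * (h * (u' - v))" by (simp add: algebra_simps)
      finally show "m1 * (u - u') \<le> Q ((u + v) / 2) * (h * (u - v)) - Q ((u' + v) / 2) * (h * (u' - v))"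
        unfolding z_def z'_def .
    qed
  next
    fix P assume P: "pressure_potential p P"
    have Pabs: "\<bar>deriv P (Q z) - deriv P (Q z')\<bar> \<le> k2 * \<bar>z - z'\<bar>" if "\<bar>z\<bar> \<le> r0" "\<bar>z'\<bar> \<le> r0" for z z'
      using that
    proof (induction z z' rule: linorder_wlog)
      case (le z z')
      have "0 \<le> k1 * (z' - z)" using k le by simp
      then show ?case using Pl[OF P le(3,2,1)] le(1) by (simp add: Q_def)
    qed (simp add: abs_minus_commute)
    have sqd: "(u - v)\<^sup>2 - (u' - v')\<^sup>2 = ((u - u') - (v - v')) * ((u - v) + (u' - v'))" for u v u' v' :: real
      by (simp add: power2_eq_square algebra_simps)
    have sq: "\<bar>c\<^sup>2 / 8 * (u - v)\<^sup>2 - c\<^sup>2 / 8 * (u' - v')\<^sup>2\<bar> \<le> c\<^sup>2 * r / 2 * (\<bar>u - u'\<bar> + \<bar>v - v'\<bar>)"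
      if "\<bar>u\<bar> \<le> r" "\<bar>u'\<bar> \<le> r" "\<bar>v\<bar> \<le> r" "\<bar>v'\<bar> \<le> r" for u u' v v'
    proof -
      have "\<bar>(u - v)\<^sup>2 - (u' - v')\<^sup>2\<bar> \<le> (\<bar>u - u'\<bar> + \<bar>v - v'\<bar>) * (4 * r)"
        unfolding sqd abs_mult using that by (intro mult_mono) auto
      then have "c\<^sup>2 / 8 * \<bar>(u - v)\<^sup>2 - (u' - v')\<^sup>2\<bar> \<le> c\<^sup>2 / 8 * ((\<bar>u - u'\<bar> + \<bar>v - v'\<bar>) * (4 * r))"
        by (intro mult_left_mono) auto
      moreover have "\<bar>c\<^sup>2 / 8 * (u - v)\<^sup>2 - c\<^sup>2 / 8 * (u' - v')\<^sup>2\<bar> = c\<^sup>2 / 8 * \<bar>(u - v)\<^sup>2 - (u' - v')\<^sup>2\<bar>"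
        unfolding right_diff_distrib[symmetric] abs_mult by simp
      moreover have "c\<^sup>2 / 8 * ((\<bar>u - u'\<bar> + \<bar>v - v'\<bar>) * (4 * r)) = c\<^sup>2 * r / 2 * (\<bar>u - u'\<bar> + \<bar>v - v'\<bar>)" by simp
      ultimately show ?thesis by linarith
    qed
    show "incr_bilipschitz r m1 m2 (\<lambda>u v. enthalpy p P \<rho>ref (u, v))"
      unfolding incr_bilipschitz_def H
    proof (intro allI impI conjI)
      fix u u' v v' assume b: "\<bar>u\<bar> \<le> r" "\<bar>u'\<bar> \<le> r" "\<bar>v\<bar> \<le> r" "\<bar>v'\<bar> \<le> r"
      define z z' s where "z = (u + v) / 2" and "z' = (u' + v') / 2" and "s = \<bar>u - u'\<bar> + \<bar>v - v'\<bar>"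
      have zr: "\<bar>z\<bar> \<le> r0" "\<bar>z'\<bar> \<le> r0" using half b by (auto simp: z_def z'_def)
      have "\<bar>deriv P (Q z) - deriv P (Q z')\<bar> \<le> k2 * \<bar>z - z'\<bar>" by (rule Pabs[OF zr])
      also have "\<dots> \<le> k2 * (s / 2)" using halfd[of u v u' v'] k2 by (intro mult_left_mono) (auto simp: z_def z'_def s_def)
      finally have "\<bar>c\<^sup>2 / 8 * (u - v)\<^sup>2 + deriv P (Q z) - (c\<^sup>2 / 8 * (u' - v')\<^sup>2 + deriv P (Q z'))\<bar>
         \<le> c\<^sup>2 * r / 2 * s + k2 * (s / 2)" using sq[OF b] unfolding s_def by linarith
      also have "\<dots> = (c\<^sup>2 * r / 2 + k2 / 2) * s" by (simp add: algebra_simps)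
      also have "\<dots> \<le> m2 * s" using m2(3) by (intro mult_right_mono) (auto simp: s_def)
      finally show "\<bar>c\<^sup>2 / 8 * (u - v)\<^sup>2 + deriv P (Q ((u + v) / 2)) - (c\<^sup>2 / 8 * (u' - v')\<^sup>2 + deriv P (Q ((u' + v') / 2)))\<bar>
         \<le> m2 * (\<bar>u - u'\<bar> + \<bar>v - v'\<bar>)" unfolding z_def z'_def s_def .
    next
      fix u u' v :: real assume b: "\<bar>u\<bar> \<le> r" "\<bar>u'\<bar> \<le> r" "\<bar>v\<bar> \<le> r" and le: "u' \<le> u"
      define z z' where "z = (u + v) / 2" and "z' = (u' + v) / 2"
      have zr: "\<bar>z\<bar> \<le> r0" "\<bar>z'\<bar> \<le> r0" using half b by (auto simp: z_def z'_def)
      have dz: "z' \<le> z" "z - z' = (u - u') / 2" using le by (auto simp: z_def z'_def field_simps)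
      have 1: "k1 * ((u - u') / 2) \<le> deriv P (Q z) - deriv P (Q z')"
        using Pl[OF P zr dz(1)] unfolding dz(2) Q_def by blast
      have "c\<^sup>2 * r * (u - u') \<le> k1 / 2 * (u - u')" using rk le by (intro mult_right_mono) auto
      then have 2: "\<bar>c\<^sup>2 / 8 * (u - v)\<^sup>2 - c\<^sup>2 / 8 * (u' - v)\<^sup>2\<bar> \<le> k1 / 4 * (u - u')"
        using sq[OF b b(3)] le by simp
      have "m1 * (u - u') \<le> k1 / 4 * (u - u')" using m1 le by (intro mult_right_mono) auto
      then show "m1 * (u - u') \<le> c\<^sup>2 / 8 * (u - v)\<^sup>2 + deriv P (Q ((u + v) / 2))
          - (c\<^sup>2 / 8 * (u' - v)\<^sup>2 + deriv P (Q ((u' + v) / 2)))"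
        using 1 2 unfolding z_def z'_def by linarith
    qed
  next
    fix u v :: real assume b: "\<bar>u\<bar> \<le> r" "\<bar>v\<bar> \<le> r"
    note zr = half[OF b]
    show "(u, v) \<in> physical_states p \<rho>ref" using phys[OF zr] by (simp add: physical_states_def)
    have "\<bar>c / 2 * (u - v)\<bar> \<le> c / 2 * (2 * r)" unfolding abs_mult using b c by (intro mult_mono) auto
    then have "\<bar>c / 2 * (u - v)\<bar> \<le> k1 / 2" using rk by simp
    then show "k1 / 2 \<le> lambda_plus p \<rho>ref (u, v) \<and> lambda_plus p \<rho>ref (u, v) \<le> k2 + k1 / 2"
      unfolding Lp using ab[OF zr] unfolding Q_def by linarith
    fix u' v' :: real assume b': "\<bar>u'\<bar> \<le> r" "\<bar>v'\<bar> \<le> r"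
    define s where "s = \<bar>u - u'\<bar> + \<bar>v - v'\<bar>"
    have "\<bar>sqrt (deriv p (Q ((u + v) / 2))) - sqrt (deriv p (Q ((u' + v') / 2)))\<bar> \<le> k2 * \<bar>(u + v) / 2 - (u' + v') / 2\<bar>"
      unfolding Q_def by (rule al[OF zr half[OF b']])
    also have "\<dots> \<le> k2 * (s / 2)" using halfd[of u v u' v'] k2 by (intro mult_left_mono) (auto simp: s_def)
    finally have 1: "\<bar>sqrt (deriv p (Q ((u + v) / 2))) - sqrt (deriv p (Q ((u' + v') / 2)))\<bar> \<le> k2 * (s / 2)" .
    have "h * (u - v) - h * (u' - v') = h * ((u - u') - (v - v'))" by (simp add: algebra_simps)
    then have "\<bar>c / 2 * (u - v) - c / 2 * (u' - v')\<bar> = c / 2 * \<bar>(u - u') - (v - v')\<bar>"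
      using h unfolding h_def[symmetric] by (simp add: abs_mult)
    also have "\<dots> \<le> c / 2 * s" using c by (intro mult_left_mono) (auto simp: s_def)
    finally have "\<bar>lambda_plus p \<rho>ref (u, v) - lambda_plus p \<rho>ref (u', v')\<bar> \<le> c / 2 * s + k2 * (s / 2)"
      unfolding Lp using 1 by linarith
    then show "\<bar>lambda_plus p \<rho>ref (u, v) - lambda_plus p \<rho>ref (u', v')\<bar> \<le> (c / 2 + k2 / 2) * (\<bar>u - u'\<bar> + \<bar>v - v'\<bar>)"
      unfolding s_def[symmetric] by (simp add: distrib_right)
  qed (use r(1) m1(1) m2(1) k c k2 in simp_all)
qed

section \<open>Node conditions on the network\<close>

text \<open>Every edge is viewed from the node: \<open>u\<close> are the invariants leaving it,
  \<open>v\<close> those arriving, and \<open>M (u e) (v e)\<close> is the mass flow from the node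
  into the edge. Hence the sign \<open>- orientation G e \<nu>\<close> at the prescribed mass flow
  and the unsigned sum at a junction.\<close>

definition node_cond ::
  "(real \<Rightarrow> real \<Rightarrow> real) \<Rightarrow> (real \<Rightarrow> real \<Rightarrow> real) \<Rightarrow> ('v,'e) pre_digraph \<Rightarrow> ('v,'e) boundary_data \<Rightarrow>
   'v \<Rightarrow> real \<Rightarrow> ('e \<Rightarrow> real) \<Rightarrow> ('e \<Rightarrow> real) \<Rightarrow> bool" where
  "node_cond M H G bd \<nu> t v u \<longleftrightarrow>
     (if \<nu> \<in> boundary_nodes G then
        \<forall>e\<in>incident_edges G \<nu>.
          case bd of
            Invariant_Data w \<Rightarrow> u e = w \<nu> e t
          | Physical_Data b \<Rightarrow>
              (case b \<nu> of
                 Mass_Flow mb \<Rightarrow> M (u e) (v e) = - orientation G e \<nu> * mb t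
               | Enthalpy hb \<Rightarrow> H (u e) (v e) = hb t)
      else (\<Sum>e\<in>incident_edges G \<nu>. M (u e) (v e)) = 0 \<and>
        (\<forall>e\<in>incident_edges G \<nu>. \<forall>f\<in>incident_edges G \<nu>. H (u e) (v e) = H (u f) (v f)))"

lemma node_cond_cong:
  assumes "\<And>e. e \<in> incident_edges G \<nu> \<Longrightarrow> u e = u' e"
  shows "node_cond M H G bd \<nu> t v u \<longleftrightarrow> node_cond M H G bd \<nu> t v u'"
  unfolding node_cond_def using assms
  by (simp cong: sum.cong ball_cong split: boundary_data.split node_data.split)

text \<open>\<open>V (e, True)\<close> and \<open>V (e, False)\<close> are \<open>S\<^sub>+\<close> and \<open>S\<^sub>-\<close> on the edge \<open>e\<close>, both as functions of the
  distance to the end of \<open>e\<close> where the respective invariant enters the edge.\<close>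

definition states :: "('e \<Rightarrow> real) \<Rightarrow> ('e \<times> bool \<Rightarrow> real \<Rightarrow> real) \<Rightarrow> 'e \<Rightarrow> real \<Rightarrow> state" where
  "states len V e x = (V (e, True) x, V (e, False) (len e - x))"

definition invariants :: "('e \<Rightarrow> real) \<Rightarrow> ('e \<Rightarrow> real \<Rightarrow> state) \<Rightarrow> 'e \<times> bool \<Rightarrow> real \<Rightarrow> real" where
  "invariants len W i x = (if snd i then fst (W (fst i) x) else snd (W (fst i) (len (fst i) - x)))"

lemma states_invariants: "states len (invariants len W) e x = W e x"
  by (simp add: states_def invariants_def)

definition outgoing :: "('v,'e) pre_digraph \<Rightarrow> ('e \<times> bool \<Rightarrow> real) \<Rightarrow> 'v \<Rightarrow> 'e \<Rightarrow> real" where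
  "outgoing G a \<nu> e = a (e, tail G e = \<nu>)"

definition incoming :: "('v,'e) pre_digraph \<Rightarrow> ('e \<times> bool \<Rightarrow> real) \<Rightarrow> 'v \<Rightarrow> 'e \<Rightarrow> real" where
  "incoming G a \<nu> e = a (e, tail G e \<noteq> \<nu>)"

abbreviation (input) "ends len V \<equiv> (\<lambda>i. V i (len (fst i)))"
abbreviation (input) "starts V \<equiv> (\<lambda>i. V i 0)"

lemma node_state_states:
  "node_state G len (states len V) e \<nu> =
     (if tail G e = \<nu> then (outgoing G (starts V) \<nu> e, incoming G (ends len V) \<nu> e)
      else (incoming G (ends len V) \<nu> e, outgoing G (starts V) \<nu> e))"
  by (simp add: node_state_def states_def outgoing_def incoming_def)

section \<open>Reversal of an edge\<close>

lemma density_swap: "density p \<rho>ref (v, u) = density p \<rho>ref (u, v)"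
  by (simp add: density_def add.commute)

lemma velocity_swap: "velocity p \<rho>ref (v, u) = - velocity p \<rho>ref (u, v)"
  by (simp add: velocity_def right_diff_distrib diff_divide_distrib)

lemma mass_flow_swap: "mass_flow p \<rho>ref (v, u) = - mass_flow p \<rho>ref (u, v)"
  by (simp only: mass_flow_def density_swap[of p \<rho>ref v u] velocity_swap[of p \<rho>ref v u] mult_minus_right)

lemma enthalpy_swap: "enthalpy p P \<rho>ref (v, u) = enthalpy p P \<rho>ref (u, v)"
  by (simp only: enthalpy_def density_swap[of p \<rho>ref v u] velocity_swap[of p \<rho>ref v u] power2_minus)

text \<open>Exchanging the invariants means reversing the edge: the density is even and the velocity
  odd. Seen from its own entry, the minus family therefore travels with the plus speed.\<close>

lemma lambda_minus_swap: "lambda_minus p \<rho>ref (v, u) = - lambda_plus p \<rho>ref (u, v)"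
  by (simp add: lambda_minus_def lambda_plus_def density_swap[of p \<rho>ref v u] velocity_swap[of p \<rho>ref v u])

lemma friction_swap: "friction p \<gamma> \<rho>ref (v, u) = - friction p \<gamma> \<rho>ref (u, v)"
proof -
  have "v - u = - (u - v)" by simp
  then show ?thesis by (simp only: friction_def fst_conv snd_conv abs_minus_cancel mult_minus_right)
qed

abbreviation (input) "M_law p \<rho>ref \<equiv> (\<lambda>u v. mass_flow p \<rho>ref (u, v))"
abbreviation (input) "H_law p P \<rho>ref \<equiv> (\<lambda>u v. enthalpy p P \<rho>ref (u, v))"

lemma node_mass_flow:
  "mass_flow p \<rho>ref (node_state G len (states len V) e \<nu>) * orientation G e \<nu>
    = - mass_flow p \<rho>ref (outgoing G (starts V) \<nu> e, incoming G (ends len V) \<nu> e)"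
  unfolding node_state_states
  using mass_flow_swap[of p \<rho>ref "incoming G (ends len V) \<nu> e" "outgoing G (starts V) \<nu> e"]
  by (simp add: orientation_def)

lemma node_enthalpy:
  "enthalpy p P \<rho>ref (node_state G len (states len V) e \<nu>)
    = enthalpy p P \<rho>ref (outgoing G (starts V) \<nu> e, incoming G (ends len V) \<nu> e)"
  unfolding node_state_states
  using enthalpy_swap[of p P \<rho>ref "incoming G (ends len V) \<nu> e" "outgoing G (starts V) \<nu> e"] by simp

lemma node_cond_inner:
  assumes "\<nu> \<in> inner_nodes G"
  shows "node_cond (M_law p \<rho>ref) (H_law p P \<rho>ref) G bd \<nu> t (incoming G (ends len V) \<nu>) (outgoing G (starts V) \<nu>)
    \<longleftrightarrow> coupling_condition p P \<rho>ref G len (states len V) \<nu>"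
  using assms unfolding node_cond_def coupling_condition_def node_mass_flow node_enthalpy inner_nodes_def
  by (simp add: sum_negf)

lemma node_cond_boundary:
  assumes "\<nu> \<in> boundary_nodes G"
  shows "node_cond (M_law p \<rho>ref) (H_law p P \<rho>ref) G bd \<nu> t (incoming G (ends len V) \<nu>) (outgoing G (starts V) \<nu>)
    \<longleftrightarrow> boundary_condition p P \<rho>ref G len bd t (states len V) \<nu>"
proof -
  have o: "orientation G e \<nu> = 1 \<or> orientation G e \<nu> = - 1" for e by (simp add: orientation_def)
  have 1: "M_law p \<rho>ref (outgoing G (starts V) \<nu> e) (incoming G (ends len V) \<nu> e) = - (orientation G e \<nu> * x)
     \<longleftrightarrow> mass_flow p \<rho>ref (node_state G len (states len V) e \<nu>) = x" for e x
    using node_mass_flow[of p \<rho>ref G len V e \<nu>] o[of e] by auto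
  have 2: "out_invariant G len (states len V) e \<nu> = outgoing G (starts V) \<nu> e" for e
    by (simp add: out_invariant_def outgoing_def states_def)
  show ?thesis
    using assms unfolding node_cond_def boundary_condition_def 2 node_enthalpy
    by (auto split: boundary_data.splits node_data.splits simp: 1)
qed

text \<open>Two radii are used: the incoming invariants stay below \<open>r'\<close>, which is so
  small that the outgoing ones can be found below \<open>r\<close>, where the bounds of the gas law
  hold.\<close>

locale gas_nodes =
  fixes p P :: "real \<Rightarrow> real" and \<rho>ref T :: real and G :: "('v,'e) pre_digraph" and len :: "'e \<Rightarrow> real"
    and r m1 m2 r' B L S :: real and bd :: "('v,'e) boundary_data"
  assumes net: "pipe_network G len"
    and M: "incr_bilipschitz r m1 m2 (M_law p \<rho>ref)" and H: "incr_bilipschitz r m1 m2 (H_law p P \<rho>ref)"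
    and r: "r > 0" and m: "0 < m1" "m1 \<le> m2"
    and r': "r' \<le> r" "(2 * m2 + m2 * m2 / m1) * r' \<le> m1 * r"
    and S: "0 < S" "S \<le> r'" and B: "B \<le> r'"
    and bd: "admissible_boundary_data p P \<rho>ref T G B L S bd"
begin

abbreviation "cond \<equiv> node_cond (M_law p \<rho>ref) (H_law p P \<rho>ref) G bd"

text \<open>One term for each kind of node: prescribed invariant, prescribed mass flow or enthalpy,
  junction. The number of all edges bounds the number of those that meet at a node.\<close>

definition "K = 1 + (1 + m2) / m1 + junction_const m1 m2 (card (arcs G))"

lemma finite_inc: "finite (incident_edges G \<nu>)" "incident_edges G \<nu> \<subseteq> arcs G"
proof -
  have "finite (arcs G)" using net unfolding pipe_network_def by (meson fin_digraph.finite_arcs)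
  then show "finite (incident_edges G \<nu>)" by (rule finite_subset[rotated]) (auto simp: incident_edges_def)
qed (auto simp: incident_edges_def)

lemma junction_const_le: "junction_const m1 m2 (card (incident_edges G \<nu>)) \<le> junction_const m1 m2 (card (arcs G))"
proof -
  have "finite (arcs G)" using net unfolding pipe_network_def by (meson fin_digraph.finite_arcs)
  then have "card (incident_edges G \<nu>) \<le> card (arcs G)" using finite_inc(2) by (intro card_mono)
  then show ?thesis
    unfolding junction_const_def[OF m r] using m by (intro divide_right_mono mult_right_mono) auto
qed

lemma K_ge: "K \<ge> 1" "K \<ge> 1 / m1" "K \<ge> m2 / m1" "K \<ge> junction_const m1 m2 (card (incident_edges G \<nu>))"
proof -
  have j: "junction_const m1 m2 (card (arcs G)) \<ge> 0" unfolding junction_const_def[OF m r] using m by simp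
  have "(1 + m2) / m1 = 1 / m1 + m2 / m1" by (simp add: add_divide_distrib)
  moreover have "1 / m1 \<ge> 0" "m2 / m1 \<ge> 0" using m by auto
  ultimately show "K \<ge> 1" "K \<ge> 1 / m1" "K \<ge> m2 / m1" "K \<ge> junction_const m1 m2 (card (incident_edges G \<nu>))"
    using j junction_const_le[of \<nu>] unfolding K_def by linarith+
qed

lemma M_zero: "M_law p \<rho>ref 0 0 = 0"
  by (simp add: mass_flow_def velocity_def)

text \<open>The admissible ranges of the prescribed mass flow and enthalpy are bounded by the values
  of these functions at the outgoing invariants \<open>- S / 4\<close> and \<open>S / 4\<close> with
  incoming invariant zero; so the data are close to their values at rest.\<close>

lemma between_bound:
  assumes f: "incr_bilipschitz r m1 m2 f" and d: "f (- S / 4) 0 \<le> d" "d \<le> f (S / 4) 0"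
  shows "\<bar>d - f 0 0\<bar> \<le> m2 * (S / 4)"
proof -
  have "\<bar>f (S / 4) 0 - f 0 0\<bar> \<le> m2 * (S / 4)" "\<bar>f (- S / 4) 0 - f 0 0\<bar> \<le> m2 * (S / 4)"
    using incr_bilipschitz_lip[OF m r f, of "S / 4" 0 0 0] incr_bilipschitz_lip[OF m r f, of "- S / 4" 0 0 0] S r r' by auto
  then show ?thesis using d by linarith
qed

lemma mass_data:
  assumes "\<nu> \<in> boundary_nodes G" "e \<in> incident_edges G \<nu>" "bd = Physical_Data b" "b \<nu> = Mass_Flow mb"
  shows "L-lipschitz_on {0..T} mb"
    "t \<in> {0..T} \<Longrightarrow> \<bar>(- orientation G e \<nu> * mb t) - M_law p \<rho>ref 0 0\<bar> \<le> m2 * (S / 4)"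
proof -
  have a: "L-lipschitz_on {0..T} mb \<and> (\<forall>t\<in>{0..T}.
     Ptilde_inv p \<rho>ref (- S / 8) * (- (sound_speed p \<rho>ref / 8) * S) \<le> - orientation G e \<nu> * mb t \<and>
     - orientation G e \<nu> * mb t \<le> Ptilde_inv p \<rho>ref (S / 8) * (sound_speed p \<rho>ref / 8) * S)"
    using bd assms unfolding admissible_boundary_data_def Let_def by fastforce
  then show "L-lipschitz_on {0..T} mb" by blast
  assume "t \<in> {0..T}"
  then show "\<bar>(- orientation G e \<nu> * mb t) - M_law p \<rho>ref 0 0\<bar> \<le> m2 * (S / 4)"
    using a by (intro between_bound[OF M]) (auto simp: mass_flow_def density_def velocity_def mult_ac)
qed

lemma enthalpy_data:
  assumes "\<nu> \<in> boundary_nodes G" "e \<in> incident_edges G \<nu>" "bd = Physical_Data b" "b \<nu> = Enthalpy hb"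
  shows "L-lipschitz_on {0..T} hb"
    "t \<in> {0..T} \<Longrightarrow> \<bar>hb t - H_law p P \<rho>ref 0 0\<bar> \<le> m2 * (S / 4)"
proof -
  have a: "L-lipschitz_on {0..T} hb \<and> (\<forall>t\<in>{0..T}.
     (sound_speed p \<rho>ref)\<^sup>2 / 8 * (- S / 4)\<^sup>2 + deriv P (Ptilde_inv p \<rho>ref (- S / 8)) \<le> hb t \<and>
     hb t \<le> (sound_speed p \<rho>ref)\<^sup>2 / 8 * (S / 4)\<^sup>2 + deriv P (Ptilde_inv p \<rho>ref (S / 8)))"
    using bd assms unfolding admissible_boundary_data_def Let_def by fastforce
  then show "L-lipschitz_on {0..T} hb" by blast
  assume "t \<in> {0..T}"
  then show "\<bar>hb t - H_law p P \<rho>ref 0 0\<bar> \<le> m2 * (S / 4)"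
    using a by (intro between_bound[OF H]) (auto simp: enthalpy_def density_def velocity_def power2_eq_square mult_ac)
qed

lemma invariant_data:
  assumes "\<nu> \<in> boundary_nodes G" "e \<in> incident_edges G \<nu>" "bd = Invariant_Data w"
  shows "L-lipschitz_on {0..T} (w \<nu> e)" "t \<in> {0..T} \<Longrightarrow> \<bar>w \<nu> e t\<bar> \<le> B"
  using bd assms unfolding admissible_boundary_data_def Let_def by fastforce+

lemma cond_exists:
  assumes t: "t \<in> {0..T}" and v: "\<And>e. e \<in> incident_edges G \<nu> \<Longrightarrow> \<bar>v e\<bar> \<le> r'"
  shows "\<exists>u. (\<forall>e\<in>incident_edges G \<nu>. \<bar>u e\<bar> \<le> r) \<and> cond \<nu> t v u"
proof (cases "\<nu> \<in> boundary_nodes G")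
  case False
  then show ?thesis
    using junction_exists[OF m r M H finite_inc(1) M_zero v r'] by (simp add: node_cond_def)
next
  case True
  have root: "\<exists>x. \<bar>x\<bar> \<le> r \<and> f x (v e) = d"
    if f: "incr_bilipschitz r m1 m2 f" and e: "e \<in> incident_edges G \<nu>" and d: "\<bar>d - f 0 0\<bar> \<le> m2 * (S / 4)" for f e d
  proof (rule root_exists[OF m r f])
    show "\<bar>v e\<bar> \<le> r" using v[OF e] r' by linarith
    have "m2 * (S / 4) \<le> m2 * r'" using S m by (intro mult_left_mono) auto
    moreover have "m2 * \<bar>v e\<bar> \<le> m2 * r'" using v[OF e] m by (intro mult_left_mono) auto
    moreover have "0 \<le> m2 * m2 / m1 * r'" using m S by simp
    ultimately show "\<bar>d - f 0 0\<bar> + m2 * \<bar>v e\<bar> \<le> m1 * r" using d r'(2) by (simp add: algebra_simps)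
  qed
  have "\<exists>x. \<bar>x\<bar> \<le> r \<and> (case bd of Invariant_Data w \<Rightarrow> x = w \<nu> e t
      | Physical_Data b \<Rightarrow> (case b \<nu> of Mass_Flow mb \<Rightarrow> M_law p \<rho>ref x (v e) = - orientation G e \<nu> * mb t
         | Enthalpy hb \<Rightarrow> H_law p P \<rho>ref x (v e) = hb t))" if e: "e \<in> incident_edges G \<nu>" for e
  proof (cases bd)
    case (Invariant_Data w)
    have "\<bar>w \<nu> e t\<bar> \<le> r" using invariant_data(2)[OF True e Invariant_Data t] B r' by linarith
    then show ?thesis using Invariant_Data by auto
  next
    case (Physical_Data b)
    show ?thesis
    proof (cases "b \<nu>")
      case (Mass_Flow mb)
      show ?thesis using root[OF M e mass_data(2)[OF True e Physical_Data Mass_Flow t]] Physical_Data Mass_Flow by simp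
    next
      case (Enthalpy hb)
      show ?thesis using root[OF H e enthalpy_data(2)[OF True e Physical_Data Enthalpy t]] Physical_Data Enthalpy by simp
    qed
  qed
  then obtain u where "\<And>e. e \<in> incident_edges G \<nu> \<Longrightarrow> \<bar>u e\<bar> \<le> r \<and> (case bd of Invariant_Data w \<Rightarrow> u e = w \<nu> e t
      | Physical_Data b \<Rightarrow> (case b \<nu> of Mass_Flow mb \<Rightarrow> M_law p \<rho>ref (u e) (v e) = - orientation G e \<nu> * mb t
         | Enthalpy hb \<Rightarrow> H_law p P \<rho>ref (u e) (v e) = hb t))" by metis
  then show ?thesis using True by (intro exI[of _ u]) (auto simp: node_cond_def)
qed

lemma root_stable_K:
  assumes f: "incr_bilipschitz r m1 m2 f" and b: "\<bar>u\<bar> \<le> r" "\<bar>u'\<bar> \<le> r" "\<bar>v\<bar> \<le> r" "\<bar>v'\<bar> \<le> r"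
    and v: "\<bar>v - v'\<bar> \<le> \<delta>" and d: "\<bar>f u v - f u' v'\<bar> \<le> c * d"
    and cK: "c / m1 \<le> K" and d0: "d \<ge> 0"
  shows "\<bar>u - u'\<bar> \<le> K * (\<delta> + d)"
proof -
  have \<delta>: "\<delta> \<ge> 0" using v by linarith
  have "m1 * \<bar>u - u'\<bar> \<le> \<bar>f u v - f u' v'\<bar> + m2 * \<bar>v - v'\<bar>" by (rule root_stable[OF m r f b])
  also have "\<dots> \<le> c * d + m2 * \<delta>" using d v m by (intro add_mono mult_left_mono) auto
  finally have "\<bar>u - u'\<bar> \<le> (c * d + m2 * \<delta>) / m1" using m by (simp add: le_divide_eq mult.commute)
  also have "\<dots> = c / m1 * d + m2 / m1 * \<delta>" by (simp add: add_divide_distrib)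
  also have "\<dots> \<le> K * d + K * \<delta>" using cK K_ge(3) d0 \<delta> by (intro add_mono mult_right_mono) auto
  finally show ?thesis by (simp add: algebra_simps)
qed

lemma cond_stable:
  assumes t: "t \<in> {0..T}" "t' \<in> {0..T}" and c: "cond \<nu> t v u" "cond \<nu> t' v' u'"
    and b: "\<And>e. e \<in> incident_edges G \<nu> \<Longrightarrow> \<bar>u e\<bar> \<le> r \<and> \<bar>u' e\<bar> \<le> r \<and> \<bar>v e\<bar> \<le> r \<and> \<bar>v' e\<bar> \<le> r \<and> \<bar>v e - v' e\<bar> \<le> \<delta>"
    and L: "L \<ge> 0" and e: "e \<in> incident_edges G \<nu>"
  shows "\<bar>u e - u' e\<bar> \<le> K * (\<delta> + L * \<bar>t - t'\<bar>)"
proof -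
  have \<delta>: "\<delta> \<ge> 0" using b[OF e] by linarith
  have Lt: "0 \<le> L * \<bar>t - t'\<bar>" using L by simp
  have K1: "1 / m1 \<le> K" by (rule K_ge)
  show ?thesis
  proof (cases "\<nu> \<in> boundary_nodes G")
    case False
    have "\<bar>u e - u' e\<bar> \<le> junction_const m1 m2 (card (incident_edges G \<nu>)) * \<delta>"
    proof (rule junction_stable[OF m r M H finite_inc(1), where u = u and u' = u' and v = v and v' = v',
        OF _ _ _ _ _ e])
      show "(\<Sum>e\<in>incident_edges G \<nu>. M_law p \<rho>ref (u e) (v e)) = 0"
        "(\<Sum>e\<in>incident_edges G \<nu>. M_law p \<rho>ref (u' e) (v' e)) = 0"
        using c unfolding node_cond_def if_not_P[OF False] by blast+
      show "H_law p P \<rho>ref (u e) (v e) = H_law p P \<rho>ref (u f) (v f)"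
        "H_law p P \<rho>ref (u' e) (v' e) = H_law p P \<rho>ref (u' f) (v' f)"
        if "e \<in> incident_edges G \<nu>" "f \<in> incident_edges G \<nu>" for e f
        using c that unfolding node_cond_def if_not_P[OF False] by blast+
    qed (rule b)
    then show ?thesis
      by (rule order_trans[OF _ mult_mono[OF K_ge(4)]]) (use K_ge(1) \<delta> Lt in simp_all)
  next
    case True
    have lip: "\<bar>f t - f t'\<bar> \<le> L * \<bar>t - t'\<bar>" if "L-lipschitz_on {0..T} f" for f :: "real \<Rightarrow> real"
      using lipschitz_onD[OF that t] by (simp add: dist_real_def)
    show ?thesis
    proof (cases bd)
      case (Invariant_Data w)
      have "\<bar>u e - u' e\<bar> = \<bar>w \<nu> e t - w \<nu> e t'\<bar>" using c True e Invariant_Data by (simp add: node_cond_def)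
      also have "\<dots> \<le> L * \<bar>t - t'\<bar>" by (rule lip[OF invariant_data(1)[OF True e Invariant_Data]])
      also have "\<dots> \<le> 1 * (\<delta> + L * \<bar>t - t'\<bar>)" using \<delta> by simp
      also have "\<dots> \<le> K * (\<delta> + L * \<bar>t - t'\<bar>)" using K_ge(1) \<delta> Lt by (intro mult_right_mono) auto
      finally show ?thesis .
    next
      case (Physical_Data bb)
      show ?thesis
      proof (cases "bb \<nu>")
        case (Mass_Flow mb)
        have "\<bar>M_law p \<rho>ref (u e) (v e) - M_law p \<rho>ref (u' e) (v' e)\<bar> = \<bar>orientation G e \<nu>\<bar> * \<bar>mb t - mb t'\<bar>"
          using c True e Physical_Data Mass_Flow by (simp add: node_cond_def abs_minus_commute abs_mult flip: right_diff_distrib)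
        also have "\<dots> = \<bar>mb t - mb t'\<bar>" by (simp add: orientation_def)
        also have "\<dots> \<le> 1 * (L * \<bar>t - t'\<bar>)" using lip[OF mass_data(1)[OF True e Physical_Data Mass_Flow]] by simp
        finally show ?thesis using b[OF e] Lt K1 by (intro root_stable_K[OF M]) auto
      next
        case (Enthalpy hb)
        have "\<bar>H_law p P \<rho>ref (u e) (v e) - H_law p P \<rho>ref (u' e) (v' e)\<bar> = \<bar>hb t - hb t'\<bar>"
          using c True e Physical_Data Enthalpy by (simp add: node_cond_def)
        also have "\<dots> \<le> 1 * (L * \<bar>t - t'\<bar>)" using lip[OF enthalpy_data(1)[OF True e Physical_Data Enthalpy]] by simp
        finally show ?thesis using b[OF e] Lt K1 by (intro root_stable_K[OF H]) auto
      qed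
    qed
  qed
qed

text \<open>Stability used for comparison with the state at rest, which satisfies the junction
  conditions; at a boundary node the data deviate from rest by the order of
  \<open>max B S\<close>.\<close>

lemma cond_bound:
  assumes t: "t \<in> {0..T}" and c: "cond \<nu> t v u"
    and b: "\<And>e. e \<in> incident_edges G \<nu> \<Longrightarrow> \<bar>u e\<bar> \<le> r \<and> \<bar>v e\<bar> \<le> s" and s: "s \<le> r"
    and e: "e \<in> incident_edges G \<nu>"
  shows "\<bar>u e\<bar> \<le> K * (s + max B S)"
proof -
  have s0: "s \<ge> 0" using b[OF e] by linarith
  have mx: "0 \<le> max B S" using S by simp
  have vr: "\<bar>v e\<bar> \<le> r" if "e \<in> incident_edges G \<nu>" for e using b[OF that] s by linarith
  show ?thesis
  proof (cases "\<nu> \<in> boundary_nodes G")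
    case False
    have "\<bar>u e - 0\<bar> \<le> junction_const m1 m2 (card (incident_edges G \<nu>)) * s"
    proof (rule junction_stable[OF m r M H finite_inc(1), where v = v and v' = "\<lambda>_. 0" and u = u and u' = "\<lambda>_. 0", OF _ _ _ _ _ e])
      show "(\<Sum>e\<in>incident_edges G \<nu>. M_law p \<rho>ref (u e) (v e)) = 0"
        using c unfolding node_cond_def if_not_P[OF False] by blast
      show "(\<Sum>e\<in>incident_edges G \<nu>. M_law p \<rho>ref 0 0) = 0" using M_zero by simp
      show "H_law p P \<rho>ref (u e) (v e) = H_law p P \<rho>ref (u f) (v f)"
        if "e \<in> incident_edges G \<nu>" "f \<in> incident_edges G \<nu>" for e f
        using c that unfolding node_cond_def if_not_P[OF False] by blast
    qed (use b vr r in auto)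
    then have "\<bar>u e - 0\<bar> \<le> K * (s + max B S)"
      by (rule order_trans[OF _ mult_mono[OF K_ge(4)]]) (use K_ge(1) s0 mx in simp_all)
    then show ?thesis by simp
  next
    case True
    have root: "\<bar>u e\<bar> \<le> K * (s + max B S)"
      if f: "incr_bilipschitz r m1 m2 f" and d: "\<bar>f (u e) (v e) - f 0 0\<bar> \<le> m2 * (S / 4)" for f
    proof -
      have "m2 * (S / 4) \<le> m2 * max B S" using m S by (intro mult_left_mono) auto
      then have "\<bar>f (u e) (v e) - f 0 0\<bar> \<le> m2 * max B S" using d by linarith
      then have "\<bar>u e - 0\<bar> \<le> K * (s + max B S)"
        using b[OF e] vr[OF e] r mx K_ge(3) by (intro root_stable_K[OF f, where v' = 0]) auto
      then show ?thesis by simp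
    qed
    show ?thesis
    proof (cases bd)
      case (Invariant_Data w)
      have "\<bar>u e\<bar> = \<bar>w \<nu> e t\<bar>" using c True e Invariant_Data by (simp add: node_cond_def)
      also have "\<dots> \<le> 1 * (s + max B S)" using invariant_data(2)[OF True e Invariant_Data t] s0 by simp
      also have "\<dots> \<le> K * (s + max B S)" using K_ge(1) s0 mx by (intro mult_right_mono) auto
      finally show ?thesis .
    next
      case (Physical_Data bb)
      show ?thesis
      proof (cases "bb \<nu>")
        case (Mass_Flow mb)
        have eq: "M_law p \<rho>ref (u e) (v e) = - orientation G e \<nu> * mb t"
          using c True e Physical_Data Mass_Flow by (simp add: node_cond_def)
        show ?thesis by (rule root[OF M], unfold eq, rule mass_data(2)[OF True e Physical_Data Mass_Flow t])
      next
        case (Enthalpy hb)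
        have eq: "H_law p P \<rho>ref (u e) (v e) = hb t"
          using c True e Physical_Data Enthalpy by (simp add: node_cond_def)
        show ?thesis by (rule root[OF H], unfold eq, rule enthalpy_data(2)[OF True e Physical_Data Enthalpy t])
      qed
    qed
  qed
qed

section \<open>From exit values to entry values\<close>

definition node_solution where
  "node_solution \<nu> t v = (SOME u. (\<forall>e\<in>incident_edges G \<nu>. \<bar>u e\<bar> \<le> r) \<and> cond \<nu> t v u)"

definition start :: "'e \<times> bool \<Rightarrow> 'v" where
  "start i = (if snd i then tail G (fst i) else head G (fst i))"

text \<open>The \<open>\<Phi>\<close> of the scheme: the node conditions are solved at the node
  where \<open>i\<close> enters its edge, with the exit values \<open>a\<close> as incoming
  invariants, and the component on that edge is returned.\<close>

definition reflect :: "'e \<times> bool \<Rightarrow> real \<Rightarrow> ('e \<times> bool \<Rightarrow> real) \<Rightarrow> real" where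
  "reflect i t a = node_solution (start i) t (incoming G a (start i)) (fst i)"

definition "I = arcs G \<times> (UNIV :: bool set)"

lemma node_solution:
  assumes "t \<in> {0..T}" "\<And>e. e \<in> incident_edges G \<nu> \<Longrightarrow> \<bar>v e\<bar> \<le> r'"
  shows "cond \<nu> t v (node_solution \<nu> t v)" "\<And>e. e \<in> incident_edges G \<nu> \<Longrightarrow> \<bar>node_solution \<nu> t v e\<bar> \<le> r"
  using someI_ex[OF cond_exists[OF assms]] unfolding node_solution_def by auto

lemma start_inc: "i \<in> I \<Longrightarrow> fst i \<in> incident_edges G (start i)"
  by (auto simp: I_def start_def incident_edges_def)

text \<open>Without loops the node at which an index starts determines its direction on the
  edge.\<close>

lemma start_dir: "i \<in> I \<Longrightarrow> (tail G (fst i) = start i) = snd i"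
proof -
  assume i: "i \<in> I"
  have "loopfree_digraph G" using net by (simp add: pipe_network_def)
  then have "tail G (fst i) \<noteq> head G (fst i)"
    using i by (auto simp: I_def loopfree_digraph_def loopfree_digraph_axioms_def)
  then show ?thesis by (auto simp: start_def)
qed

lemma incoming_I: "e \<in> incident_edges G \<nu> \<Longrightarrow> (e, tail G e \<noteq> \<nu>) \<in> I"
  by (auto simp: I_def incident_edges_def)

lemma reflect_bound:
  assumes i: "i \<in> I" and t: "t \<in> {0..T}" and a: "\<And>k. k \<in> I \<Longrightarrow> \<bar>a k\<bar> \<le> s" and s: "s \<le> r'"
  shows "\<bar>reflect i t a\<bar> \<le> K * (s + max B S)"
proof -
  have v: "\<bar>incoming G a (start i) e\<bar> \<le> s" if "e \<in> incident_edges G (start i)" for e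
    using a[OF incoming_I[OF that]] by (simp add: incoming_def)
  then have v': "\<bar>incoming G a (start i) e\<bar> \<le> r'" if "e \<in> incident_edges G (start i)" for e
    using s that by fastforce
  show ?thesis
    unfolding reflect_def
  proof (rule cond_bound[OF t _ _ _ start_inc[OF i]])
    show "cond (start i) t (incoming G a (start i)) (node_solution (start i) t (incoming G a (start i)))"
      by (rule node_solution(1)[OF t], rule v')
    show "s \<le> r" using s r' by linarith
    fix e assume e: "e \<in> incident_edges G (start i)"
    show "\<bar>node_solution (start i) t (incoming G a (start i)) e\<bar> \<le> r \<and> \<bar>incoming G a (start i) e\<bar> \<le> s"
      by (rule conjI[OF node_solution(2)[OF t _ e] v[OF e]], rule v')
  qed
qed

lemma reflect_lip:
  assumes i: "i \<in> I" and t: "t \<in> {0..T}" "t' \<in> {0..T}" and L: "L \<ge> 0"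
    and a: "\<And>k. k \<in> I \<Longrightarrow> \<bar>a k\<bar> \<le> r'" "\<And>k. k \<in> I \<Longrightarrow> \<bar>a' k\<bar> \<le> r'" "\<And>k. k \<in> I \<Longrightarrow> \<bar>a k - a' k\<bar> \<le> \<delta>"
  shows "\<bar>reflect i t a - reflect i t' a'\<bar> \<le> K * (\<delta> + L * \<bar>t - t'\<bar>)"
proof -
  have v: "\<bar>incoming G a (start i) e\<bar> \<le> r'" "\<bar>incoming G a' (start i) e\<bar> \<le> r'"
    "\<bar>incoming G a (start i) e - incoming G a' (start i) e\<bar> \<le> \<delta>" if "e \<in> incident_edges G (start i)" for e
    using a[OF incoming_I[OF that]] by (simp_all add: incoming_def)
  have n: "cond (start i) t (incoming G a (start i)) (node_solution (start i) t (incoming G a (start i)))"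
    "cond (start i) t' (incoming G a' (start i)) (node_solution (start i) t' (incoming G a' (start i)))"
    by (rule node_solution(1)[OF t(1)], rule v, assumption, rule node_solution(1)[OF t(2)], rule v, assumption)
  show ?thesis
    unfolding reflect_def
  proof (rule cond_stable[OF t n _ L start_inc[OF i]])
    fix e assume e: "e \<in> incident_edges G (start i)"
    show "\<bar>node_solution (start i) t (incoming G a (start i)) e\<bar> \<le> r \<and>
      \<bar>node_solution (start i) t' (incoming G a' (start i)) e\<bar> \<le> r \<and>
      \<bar>incoming G a (start i) e\<bar> \<le> r \<and> \<bar>incoming G a' (start i) e\<bar> \<le> r \<and>
      \<bar>incoming G a (start i) e - incoming G a' (start i) e\<bar> \<le> \<delta>"
    proof (intro conjI)
      show "\<bar>node_solution (start i) t (incoming G a (start i)) e\<bar> \<le> r"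
        by (rule node_solution(2)[OF t(1) _ e]) (rule v)
      show "\<bar>node_solution (start i) t' (incoming G a' (start i)) e\<bar> \<le> r"
        by (rule node_solution(2)[OF t(2) _ e]) (rule v)
    qed (use v[OF e] r'(1) in linarith)+
  qed
qed

text \<open>All indices that start at \<open>\<nu>\<close> take their values from the same
  \<open>node_solution\<close>, so together these values satisfy the node conditions.\<close>

lemma reflect_cond:
  assumes t: "t \<in> {0..T}" and a: "\<And>k. k \<in> I \<Longrightarrow> \<bar>a k\<bar> \<le> r'" and o: "\<And>k. k \<in> I \<Longrightarrow> o' k = reflect k t a"
    and \<nu>: "\<nu> \<in> verts G"
  shows "cond \<nu> t (incoming G a \<nu>) (outgoing G o' \<nu>)"
proof -
  have v: "\<bar>incoming G a \<nu> e\<bar> \<le> r'" if "e \<in> incident_edges G \<nu>" for e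
    using a[OF incoming_I[OF that]] by (simp add: incoming_def)
  have eq: "outgoing G o' \<nu> e = node_solution \<nu> t (incoming G a \<nu>) e" if e: "e \<in> incident_edges G \<nu>" for e
  proof -
    have "(e, tail G e = \<nu>) \<in> I" using e by (auto simp: I_def incident_edges_def)
    moreover have "start (e, tail G e = \<nu>) = \<nu>" using e by (auto simp: start_def incident_edges_def)
    ultimately show ?thesis using o[of "(e, tail G e = \<nu>)"] by (simp add: outgoing_def reflect_def)
  qed
  have "cond \<nu> t (incoming G a \<nu>) (outgoing G o' \<nu>)
    \<longleftrightarrow> cond \<nu> t (incoming G a \<nu>) (node_solution \<nu> t (incoming G a \<nu>))"
    by (rule node_cond_cong, rule eq)
  moreover have "cond \<nu> t (incoming G a \<nu>) (node_solution \<nu> t (incoming G a \<nu>))"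
    by (rule node_solution(1)[OF t], rule v)
  ultimately show ?thesis by blast
qed

text \<open>Stability with equal times and equal incoming values leaves no difference between two
  solutions. This identifies compatible initial data with the solution picked by the choice
  operator.\<close>

lemma reflect_unique:
  assumes t: "t \<in> {0..T}" and a: "\<And>k. k \<in> I \<Longrightarrow> \<bar>a k\<bar> \<le> r'" "\<And>k. k \<in> I \<Longrightarrow> \<bar>o' k\<bar> \<le> r'" and L: "L \<ge> 0"
    and c: "cond (start i) t (incoming G a (start i)) (outgoing G o' (start i))" and i: "i \<in> I"
  shows "o' i = reflect i t a"
proof -
  have v: "\<bar>incoming G a (start i) e\<bar> \<le> r'" if "e \<in> incident_edges G (start i)" for e
    using a[OF incoming_I[OF that]] by (simp add: incoming_def)
  have u: "\<bar>outgoing G o' (start i) e\<bar> \<le> r'" if "e \<in> incident_edges G (start i)" for e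
  proof -
    have "(e, tail G e = start i) \<in> I" using finite_inc(2) that unfolding I_def by blast
    from a(2)[OF this] show ?thesis unfolding outgoing_def .
  qed
  have n: "cond (start i) t (incoming G a (start i)) (node_solution (start i) t (incoming G a (start i)))"
    by (rule node_solution(1)[OF t], rule v)
  have "\<bar>outgoing G o' (start i) (fst i) - node_solution (start i) t (incoming G a (start i)) (fst i)\<bar>
     \<le> K * (0 + L * \<bar>t - t\<bar>)"
  proof (rule cond_stable[OF t t c n _ L start_inc[OF i]])
    fix e assume e: "e \<in> incident_edges G (start i)"
    show "\<bar>outgoing G o' (start i) e\<bar> \<le> r \<and>
      \<bar>node_solution (start i) t (incoming G a (start i)) e\<bar> \<le> r \<and>
      \<bar>incoming G a (start i) e\<bar> \<le> r \<and> \<bar>incoming G a (start i) e\<bar> \<le> r \<and>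
      \<bar>incoming G a (start i) e - incoming G a (start i) e\<bar> \<le> 0"
    proof (intro conjI)
      show "\<bar>node_solution (start i) t (incoming G a (start i)) e\<bar> \<le> r"
        by (rule node_solution(2)[OF t _ e]) (rule v)
    qed (use u[OF e] v[OF e] r'(1) in simp_all)
  qed
  moreover have "outgoing G o' (start i) (fst i) = o' i"
    using start_dir[OF i] by (cases i) (simp add: outgoing_def)
  ultimately show ?thesis by (simp add: reflect_def)
qed

end

section \<open>The observer system in direction coordinates\<close>

definition defect :: "('e \<Rightarrow> real) \<Rightarrow> ('e \<Rightarrow> real \<Rightarrow> real \<Rightarrow> state) \<Rightarrow> 'e \<times> bool \<Rightarrow> real \<Rightarrow> real \<Rightarrow> real" where
  "defect len R i t x =
     (if snd i then fst (R (fst i) t x) - snd (R (fst i) t x)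
      else snd (R (fst i) t (len (fst i) - x)) - fst (R (fst i) t (len (fst i) - x)))"

text \<open>For the minus family the two invariants change places. Friction and observation error
  are odd under this exchange, so both equations have the same form in the own invariant
  \<open>u\<close> and the opposite one \<open>v\<close>.\<close>

definition observer_source :: "real \<Rightarrow> real \<Rightarrow> ('e \<times> bool \<Rightarrow> real \<Rightarrow> real \<Rightarrow> real) \<Rightarrow>
    'e \<times> bool \<Rightarrow> real \<Rightarrow> real \<Rightarrow> real \<Rightarrow> real \<Rightarrow> real" where
  "observer_source \<gamma>c \<mu> D i t x u v = - (\<gamma>c * \<bar>u - v\<bar> * (u - v)) + \<mu> / 2 * (D i t x - (u - v))"

lemma abs_times_lip:
  fixes a b :: real
  assumes "\<bar>a\<bar> \<le> s" "\<bar>b\<bar> \<le> s"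
  shows "\<bar>\<bar>a\<bar> * a - \<bar>b\<bar> * b\<bar> \<le> 2 * s * \<bar>a - b\<bar>"
proof -
  have "\<bar>a\<bar> * a - \<bar>b\<bar> * b = \<bar>a\<bar> * (a - b) + (\<bar>a\<bar> - \<bar>b\<bar>) * b" by (simp add: algebra_simps)
  also have "\<bar>\<dots>\<bar> \<le> \<bar>\<bar>a\<bar> * (a - b)\<bar> + \<bar>(\<bar>a\<bar> - \<bar>b\<bar>) * b\<bar>" by (rule abs_triangle_ineq)
  also have "\<dots> = \<bar>a\<bar> * \<bar>a - b\<bar> + \<bar>\<bar>a\<bar> - \<bar>b\<bar>\<bar> * \<bar>b\<bar>" by (simp add: abs_mult)
  also have "\<dots> \<le> s * \<bar>a - b\<bar> + \<bar>a - b\<bar> * s"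
    using assms by (intro add_mono mult_mono) auto
  finally show ?thesis by simp
qed

text \<open>The friction is quadratic, so its Lipschitz constant \<open>4 * \<gamma>c * r\<close>
  comes from arguments of size \<open>2 * r\<close>. The bound \<open>2 * d\<close> reflects that
  \<open>D\<close> will be a difference of two observed invariants; the factor
  \<open>\<mu> / 2\<close> reduces it to \<open>\<mu> * d\<close>.\<close>

lemma observer_source_lip:
  fixes u v u' v' :: real
  assumes \<gamma>c: "\<gamma>c \<ge> 0" "\<mu> \<ge> 0" and b: "\<bar>u\<bar> \<le> r" "\<bar>v\<bar> \<le> r" "\<bar>u'\<bar> \<le> r" "\<bar>v'\<bar> \<le> r"
    and D: "\<bar>D i t x - D i t' x'\<bar> \<le> 2 * d"
    and C: "C \<ge> 4 * \<gamma>c * r + \<mu>"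
  shows "\<bar>observer_source \<gamma>c \<mu> D i t x u v - observer_source \<gamma>c \<mu> D i t' x' u' v'\<bar> \<le> C * (\<bar>u - u'\<bar> + \<bar>v - v'\<bar> + d)"
proof -
  define a a' s where "a = u - v" and "a' = u' - v'" and "s = \<bar>u - u'\<bar> + \<bar>v - v'\<bar>"
  have ab: "\<bar>a\<bar> \<le> 2 * r" "\<bar>a'\<bar> \<le> 2 * r" "\<bar>a - a'\<bar> \<le> s" using b by (auto simp: a_def a'_def s_def)
  have d: "d \<ge> 0" and s: "s \<ge> 0" using D by (auto simp: s_def)
  have r: "r \<ge> 0" using b by linarith
  have "\<bar>\<bar>a\<bar> * a - \<bar>a'\<bar> * a'\<bar> \<le> 2 * (2 * r) * \<bar>a - a'\<bar>" by (rule abs_times_lip[OF ab(1,2)])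
  also have "\<dots> \<le> 2 * (2 * r) * s" using ab r by (intro mult_left_mono) auto
  finally have hX: "\<gamma>c * \<bar>\<bar>a\<bar> * a - \<bar>a'\<bar> * a'\<bar> \<le> \<gamma>c * (2 * (2 * r) * s)" using \<gamma>c by (intro mult_left_mono)
  have hY: "\<mu> / 2 * \<bar>(D i t x - D i t' x') - (a - a')\<bar> \<le> \<mu> / 2 * (2 * d + s)"
    using \<gamma>c D ab by (intro mult_left_mono) auto
  define X Y where "X = \<gamma>c * (\<bar>a\<bar> * a - \<bar>a'\<bar> * a')" and "Y = \<mu> / 2 * ((D i t x - D i t' x') - (a - a'))"
  have eq: "observer_source \<gamma>c \<mu> D i t x u v - observer_source \<gamma>c \<mu> D i t' x' u' v' = - X + Y"
    by (simp add: observer_source_def a_def a'_def X_def Y_def right_diff_distrib mult.assoc)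
  have "\<bar>X\<bar> \<le> \<gamma>c * (2 * (2 * r) * s)"
    unfolding X_def abs_mult[of \<gamma>c] using hX \<gamma>c by simp
  moreover have "\<bar>Y\<bar> \<le> \<mu> / 2 * (2 * d + s)"
    unfolding Y_def abs_mult[of "\<mu> / 2"] using hY \<gamma>c by simp
  ultimately have "\<bar>observer_source \<gamma>c \<mu> D i t x u v - observer_source \<gamma>c \<mu> D i t' x' u' v'\<bar>
     \<le> \<gamma>c * (2 * (2 * r) * s) + \<mu> / 2 * (2 * d + s)" unfolding eq by linarith
  also have "\<dots> = (4 * \<gamma>c * r + \<mu> / 2) * s + \<mu> * d" by (simp add: algebra_simps)
  also have "\<dots> \<le> C * s + C * d"
  proof (intro add_mono mult_right_mono)
    have "0 \<le> 4 * \<gamma>c * r" using \<gamma>c r by simp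
    then show "4 * \<gamma>c * r + \<mu> / 2 \<le> C" "\<mu> \<le> C" using C \<gamma>c by linarith+
  qed (use s d in auto)
  finally show ?thesis by (simp add: s_def algebra_simps)
qed

lemma observer_source_bound:
  fixes u v :: real
  assumes \<gamma>c: "\<gamma>c \<ge> 0" "\<mu> \<ge> 0" and b: "\<bar>u\<bar> \<le> s" "\<bar>v\<bar> \<le> s" "s \<le> r"
    and D: "\<bar>D i t x\<bar> \<le> 2 * d" and C: "C \<ge> 4 * \<gamma>c * r + \<mu>"
  shows "\<bar>observer_source \<gamma>c \<mu> D i t x u v\<bar> \<le> C * (s + d)"
proof -
  define a where "a = u - v"
  have s: "s \<ge> 0" and d: "d \<ge> 0" using b D by linarith+
  have a: "\<bar>a\<bar> \<le> 2 * s" using b by (auto simp: a_def)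
  have "\<bar>\<bar>a\<bar> * a\<bar> \<le> (2 * r) * (2 * s)" unfolding abs_mult using a b s by (intro mult_mono) auto
  then have hX: "\<gamma>c * \<bar>\<bar>a\<bar> * a\<bar> \<le> \<gamma>c * ((2 * r) * (2 * s))" using \<gamma>c by (intro mult_left_mono)
  have hY: "\<mu> / 2 * \<bar>D i t x - a\<bar> \<le> \<mu> / 2 * (2 * d + 2 * s)"
    using \<gamma>c D a by (intro mult_left_mono) auto
  define X Y where "X = \<gamma>c * (\<bar>a\<bar> * a)" and "Y = \<mu> / 2 * (D i t x - a)"
  have eq: "observer_source \<gamma>c \<mu> D i t x u v = - X + Y"
    by (simp add: observer_source_def a_def X_def Y_def mult.assoc)
  have "\<bar>X\<bar> \<le> \<gamma>c * ((2 * r) * (2 * s))"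
    unfolding X_def abs_mult[of \<gamma>c] using hX \<gamma>c by simp
  moreover have "\<bar>Y\<bar> \<le> \<mu> / 2 * (2 * d + 2 * s)"
    unfolding Y_def abs_mult[of "\<mu> / 2"] using hY \<gamma>c by simp
  ultimately have "\<bar>observer_source \<gamma>c \<mu> D i t x u v\<bar> \<le> \<gamma>c * ((2 * r) * (2 * s)) + \<mu> / 2 * (2 * d + 2 * s)"
    unfolding eq by linarith
  also have "\<dots> = (4 * \<gamma>c * r + \<mu>) * s + \<mu> * d" by (simp add: algebra_simps)
  also have "\<dots> \<le> C * s + C * d"
  proof (intro add_mono mult_right_mono)
    have "0 \<le> 4 * \<gamma>c * r" using \<gamma>c b s by simp
    then show "\<mu> \<le> C" using C by linarith
  qed (use s d C in auto)
  finally show ?thesis by (simp add: algebra_simps)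
qed

text \<open>The regularity of the observed solution that is used; for \<open>\<mu> = 0\<close> it is replaced by \<open>0\<close>.\<close>

definition tame_on :: "real \<Rightarrow> real \<Rightarrow> real \<Rightarrow> real \<Rightarrow> (real \<Rightarrow> real \<Rightarrow> state) \<Rightarrow> bool" where
  "tame_on T l B L U \<longleftrightarrow> continuous_on ({0..T} \<times> {0..l}) (\<lambda>(t, x). U t x) \<and> bounded_by B T l U \<and> lipschitz_in_space L T l U"

lemma defect_tame:
  assumes R: "tame_on T (len (fst i)) B L (R (fst i))" and x: "x \<in> {0..len (fst i)}"
  shows "t \<in> {0..T} \<Longrightarrow> \<bar>defect len R i t x\<bar> \<le> 2 * B"
    "t \<in> {0..T} \<Longrightarrow> x' \<in> {0..len (fst i)} \<Longrightarrow> \<bar>defect len R i t x - defect len R i t x'\<bar> \<le> 2 * (L * \<bar>x - x'\<bar>)"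
    "continuous_on {0..T} (\<lambda>t. defect len R i t x)"
proof -
  let ?l = "len (fst i)" and ?U = "R (fst i)"
  have x2: "?l - x \<in> {0..?l}" using x by auto
  have b: "\<bar>fst (?U t x) - snd (?U t x)\<bar> \<le> 2 * B" if "t \<in> {0..T}" "x \<in> {0..?l}" for t x
  proof -
    have "\<bar>fst (?U t x)\<bar> \<le> B \<and> \<bar>snd (?U t x)\<bar> \<le> B" using R that unfolding tame_on_def bounded_by_def by blast
    then show ?thesis by linarith
  qed
  have l: "\<bar>(fst (?U t x) - snd (?U t x)) - (fst (?U t x') - snd (?U t x'))\<bar> \<le> 2 * (L * \<bar>x - x'\<bar>)"
    if t: "t \<in> {0..T}" and xx: "x \<in> {0..?l}" "x' \<in> {0..?l}" for t x x'
  proof -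
    have "L-lipschitz_on {0..?l} (\<lambda>x. fst (?U t x))" "L-lipschitz_on {0..?l} (\<lambda>x. snd (?U t x))"
      using R t unfolding tame_on_def lipschitz_in_space_def by blast+
    from lipschitz_onD[OF this(1) xx] lipschitz_onD[OF this(2) xx] show ?thesis by (simp add: dist_real_def)
  qed
  have c: "continuous_on {0..T} (\<lambda>t. fst (?U t x) - snd (?U t x))" if xx: "x \<in> {0..?l}" for x
  proof -
    have c0: "continuous_on ({0..T} \<times> {0..?l}) (\<lambda>(t, x). ?U t x)" using R unfolding tame_on_def by blast
    have p: "continuous_on {0..T} (\<lambda>t. (t, x))" by (intro continuous_intros)
    have "continuous_on {0..T} ((\<lambda>(t, x). ?U t x) \<circ> (\<lambda>t. (t, x)))"
      by (rule continuous_on_compose[OF p continuous_on_subset[OF c0]]) (use xx in auto)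
    then have "continuous_on {0..T} (\<lambda>t. ?U t x)" by (simp add: o_def)
    then show ?thesis by (intro continuous_intros)
  qed
  show "\<bar>defect len R i t x\<bar> \<le> 2 * B" if t: "t \<in> {0..T}"
    using b[OF t x] b[OF t x2] by (simp add: defect_def abs_minus_commute)
  show "\<bar>defect len R i t x - defect len R i t x'\<bar> \<le> 2 * (L * \<bar>x - x'\<bar>)" if t: "t \<in> {0..T}" and x': "x' \<in> {0..?l}"
  proof (cases "snd i")
    case True
    then show ?thesis using l[OF t x x'] by (simp add: defect_def)
  next
    case False
    have x2': "?l - x' \<in> {0..?l}" using x' by auto
    have "\<bar>(?l - x) - (?l - x')\<bar> = \<bar>x - x'\<bar>" by simp
    then show ?thesis using l[OF t x2 x2'] False unfolding defect_def by (simp only: if_False)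
  qed
  have "continuous_on {0..T} (\<lambda>t. - (fst (?U t (?l - x)) - snd (?U t (?l - x))))"
    by (rule continuous_on_minus[OF c[OF x2]])
  then show "continuous_on {0..T} (\<lambda>t. defect len R i t x)"
    using c[OF x] by (cases "snd i") (simp_all add: defect_def)
qed

lemma friction_eq: "friction p \<gamma> \<rho>ref (u, v) = \<gamma> * (sound_speed p \<rho>ref / 4) * \<bar>u - v\<bar> * (u - v)"
  by (simp add: friction_def)

text \<open>A characteristic of the minus family, measured from the other end of the edge, becomes a
  curve with the plus speed of the exchanged pair. The observed solution is compared only in the
  product with \<open>\<mu> / 2\<close>, so the assumption \<open>R\<close> also fits the substitute
  used for \<open>\<mu> = 0\<close>.\<close>

lemma edge_equations_from_invariants:
  fixes V :: "'e \<times> bool \<Rightarrow> real \<Rightarrow> real \<Rightarrow> real" and len :: "'e \<Rightarrow> real" and e :: 'e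
  defines "S \<equiv> \<lambda>t x. states len (\<lambda>i. V i t) e x"
  assumes V: "\<And>d J \<xi> s. is_interval J \<Longrightarrow> J \<subseteq> {0..T} \<Longrightarrow>
      (\<And>s. s \<in> J \<Longrightarrow> \<xi> s \<in> {0..len e} \<and>
         (\<xi> has_real_derivative lambda_plus p \<rho>ref (V (e, d) s (\<xi> s), V (e, \<not> d) s (len e - \<xi> s))) (at s within J)) \<Longrightarrow>
      s \<in> J \<Longrightarrow>
      ((\<lambda>s. V (e, d) s (\<xi> s)) has_real_derivative
         observer_source (\<gamma> * (sound_speed p \<rho>ref / 4)) \<mu> (defect len R') (e, d) s (\<xi> s)
           (V (e, d) s (\<xi> s)) (V (e, \<not> d) s (len e - \<xi> s))) (at s within J)"
    and R: "\<And>t x. \<mu> / 2 * defect len R' (e, True) t x = \<mu> / 2 * (fst (R t x) - snd (R t x))"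
  shows "edge_equations p \<gamma> \<rho>ref T (len e)
     (\<lambda>t x. \<mu> / 2 * (fst (R t x) - snd (R t x) - (fst (S t x) - snd (S t x)))) S"
  unfolding edge_equations_def
proof (intro conjI ballI allI impI)
  fix x t J \<xi> s
  assume ch: "is_characteristic T (len e) (lambda_plus p \<rho>ref) S x t J \<xi>" and s: "s \<in> J"
  have "((\<lambda>s. V (e, True) s (\<xi> s)) has_real_derivative
         observer_source (\<gamma> * (sound_speed p \<rho>ref / 4)) \<mu> (defect len R') (e, True) s (\<xi> s)
           (V (e, True) s (\<xi> s)) (V (e, \<not> True) s (len e - \<xi> s))) (at s within J)"
    by (rule V) (use ch s in \<open>auto simp: is_characteristic_def S_def states_def\<close>)
  moreover have "observer_source (\<gamma> * (sound_speed p \<rho>ref / 4)) \<mu> (defect len R') (e, True) s (\<xi> s)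
           (V (e, True) s (\<xi> s)) (V (e, \<not> True) s (len e - \<xi> s))
      = - friction p \<gamma> \<rho>ref (S s (\<xi> s)) + \<mu> / 2 * (fst (R s (\<xi> s)) - snd (R s (\<xi> s)) - (fst (S s (\<xi> s)) - snd (S s (\<xi> s))))"
    using R[of s "\<xi> s"] by (simp add: observer_source_def S_def states_def friction_eq right_diff_distrib[of "\<mu> / 2"])
  ultimately show "((\<lambda>r. fst (S r (\<xi> r))) has_real_derivative
      - friction p \<gamma> \<rho>ref (S s (\<xi> s)) + \<mu> / 2 * (fst (R s (\<xi> s)) - snd (R s (\<xi> s)) - (fst (S s (\<xi> s)) - snd (S s (\<xi> s)))))
      (at s within J)"
    by (simp add: S_def states_def)
next
  fix x t J \<xi> s
  assume ch: "is_characteristic T (len e) (lambda_minus p \<rho>ref) S x t J \<xi>" and s: "s \<in> J"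
  define \<zeta> where "\<zeta> s = len e - \<xi> s" for s
  have "((\<lambda>s. V (e, False) s (\<zeta> s)) has_real_derivative
         observer_source (\<gamma> * (sound_speed p \<rho>ref / 4)) \<mu> (defect len R') (e, False) s (\<zeta> s)
           (V (e, False) s (\<zeta> s)) (V (e, \<not> False) s (len e - \<zeta> s))) (at s within J)"
  proof (rule V)
    fix s assume s: "s \<in> J"
    have x: "\<xi> s \<in> {0..len e}" and d: "(\<xi> has_real_derivative lambda_minus p \<rho>ref (S s (\<xi> s))) (at s within J)"
      using ch s by (auto simp: is_characteristic_def)
    have "(\<zeta> has_real_derivative 0 - lambda_minus p \<rho>ref (S s (\<xi> s))) (at s within J)"
      unfolding \<zeta>_def by (rule DERIV_diff[OF DERIV_const d])
    moreover have "0 - lambda_minus p \<rho>ref (S s (\<xi> s))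
        = lambda_plus p \<rho>ref (V (e, False) s (\<zeta> s), V (e, \<not> False) s (len e - \<zeta> s))"
      using lambda_minus_swap[of p \<rho>ref "V (e, True) s (\<xi> s)" "V (e, False) s (\<zeta> s)"]
      by (simp add: S_def states_def \<zeta>_def)
    ultimately show "\<zeta> s \<in> {0..len e} \<and> (\<zeta> has_real_derivative
        lambda_plus p \<rho>ref (V (e, False) s (\<zeta> s), V (e, \<not> False) s (len e - \<zeta> s))) (at s within J)"
      using x by (simp add: \<zeta>_def)
  qed (use ch s in \<open>auto simp: is_characteristic_def\<close>)
  moreover have "observer_source (\<gamma> * (sound_speed p \<rho>ref / 4)) \<mu> (defect len R') (e, False) s (\<zeta> s)
           (V (e, False) s (\<zeta> s)) (V (e, \<not> False) s (len e - \<zeta> s))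
      = friction p \<gamma> \<rho>ref (S s (\<xi> s)) - \<mu> / 2 * (fst (R s (\<xi> s)) - snd (R s (\<xi> s)) - (fst (S s (\<xi> s)) - snd (S s (\<xi> s))))"
  proof -
    define u v where "u = V (e, False) s (\<zeta> s)" and "v = V (e, True) s (\<xi> s)"
    have D: "\<mu> / 2 * defect len R' (e, False) s (\<zeta> s) = - (\<mu> / 2 * (fst (R s (\<xi> s)) - snd (R s (\<xi> s))))"
      unfolding R[symmetric] by (simp add: defect_def \<zeta>_def algebra_simps)
    have "V (e, \<not> False) s (len e - \<zeta> s) = v" "S s (\<xi> s) = (v, u)"
      by (simp_all add: S_def states_def \<zeta>_def u_def v_def)
    moreover have "k * \<delta> = - (k * w) \<Longrightarrow> k * (\<delta> - (u - v)) = - (k * (w - (v - u)))" for k \<delta> w :: real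
      by (simp add: algebra_simps)
    note this[OF D]
    moreover have "friction p \<gamma> \<rho>ref (v, u) = - (\<gamma> * (sound_speed p \<rho>ref / 4) * \<bar>u - v\<bar> * (u - v))"
      by (rule trans[OF friction_swap arg_cong[where f = uminus, OF friction_eq]])
    ultimately show ?thesis
      unfolding observer_source_def u_def[symmetric] by (simp only: fst_conv snd_conv)
  qed
  ultimately show "((\<lambda>r. snd (S r (\<xi> r))) has_real_derivative
      friction p \<gamma> \<rho>ref (S s (\<xi> s)) - \<mu> / 2 * (fst (R s (\<xi> s)) - snd (R s (\<xi> s)) - (fst (S s (\<xi> s)) - snd (S s (\<xi> s)))))
      (at s within J)"
    by (simp add: S_def states_def \<zeta>_def)
qed

section \<open>The existence theorem\<close>

lemma finite_length_bounds:
  assumes "finite A" "\<forall>e\<in>A. len e > (0::real)"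
  obtains l1 l2 where "0 < l1" "l1 \<le> l2" "\<And>e. e \<in> A \<Longrightarrow> l1 \<le> len e \<and> len e \<le> l2"
\<comment> \<open>The inserted 1 keeps minimum and maximum defined for a network without
  edges.\<close>
proof (rule that[of "Min (insert 1 (len ` A))" "Max (insert 1 (len ` A))"])
  have "Min (insert 1 (len ` A)) \<le> 1" "1 \<le> Max (insert 1 (len ` A))" using assms by auto
  then show "Min (insert 1 (len ` A)) \<le> Max (insert 1 (len ` A))" by linarith
qed (use assms in auto)

context gas_nodes begin

text \<open>The observed solution enters the source with size \<open>S\<close> and slope
  \<open>LR\<close>, so for the scheme it is one more datum; hence the two maxima. The compatibility
  at time zero comes from uniqueness at the nodes.\<close>

lemma upwind_data:
  fixes y :: "'e \<Rightarrow> real \<Rightarrow> state" and R :: "'e \<Rightarrow> real \<Rightarrow> real \<Rightarrow> state"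
  assumes flux: "upwind_flux I (\<lambda>i. len (fst i)) (\<lambda>i. (fst i, \<not> snd i)) T \<Lambda> l1 l2 C r' lmin lmax"
    and \<gamma>c: "\<gamma>c \<ge> 0" "\<mu> \<ge> 0" "C \<ge> 4 * \<gamma>c * r' + \<mu>"
    and pos: "0 < B" "0 < L" "0 < LR"
    and R: "\<And>e. e \<in> arcs G \<Longrightarrow> tame_on T (len e) S LR (R e)"
    and y: "admissible_initial_data p P \<rho>ref G len B L bd y"
  shows "upwind_data I (\<lambda>i. len (fst i)) (\<lambda>i. (fst i, \<not> snd i)) T \<Lambda> l1 l2 C r' lmin lmax
    (observer_source \<gamma>c \<mu> (defect len R)) (max B S) (max L LR) reflect (invariants len y) K"
proof -
  interpret upwind_flux I "\<lambda>i. len (fst i)" "\<lambda>i. (fst i, \<not> snd i)" T \<Lambda> l1 l2 C r' lmin lmax by (rule flux)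
  have arc: "fst i \<in> arcs G" if "i \<in> I" for i using that by (auto simp: I_def)
  have lenp: "0 < len (fst i)" if "i \<in> I" for i using len(1) len(3)[OF that] by linarith
  have T0: "0 \<in> {0..T}" using T by simp
  have yb: "\<bar>invariants len y i x\<bar> \<le> B" if i: "i \<in> I" and x: "x \<in> {0..len (fst i)}" for i x
  proof -
    have b: "\<bar>fst (y (fst i) z)\<bar> \<le> B \<and> \<bar>snd (y (fst i) z)\<bar> \<le> B" if "z \<in> {0..len (fst i)}" for z
      using y arc[OF i] that unfolding admissible_initial_data_def by blast
    have "len (fst i) - x \<in> {0..len (fst i)}" using x by simp
    then show ?thesis using b[OF x] b[of "len (fst i) - x"] by (simp add: invariants_def)
  qed
  have y_lip: "\<bar>invariants len y i x - invariants len y i x'\<bar> \<le> L * \<bar>x - x'\<bar>"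
    if i: "i \<in> I" and x: "x \<in> {0..len (fst i)}" "x' \<in> {0..len (fst i)}" for i x x'
  proof -
    have "L-lipschitz_on {0..len (fst i)} (\<lambda>x. fst (y (fst i) x))" "L-lipschitz_on {0..len (fst i)} (\<lambda>x. snd (y (fst i) x))"
      using y arc[OF i] unfolding admissible_initial_data_def by blast+
    note l = this[THEN lipschitz_onD]
    have "len (fst i) - x \<in> {0..len (fst i)}" "len (fst i) - x' \<in> {0..len (fst i)}" using x by simp_all
    from l(1)[OF x] l(2)[OF this] show ?thesis
      by (cases "snd i") (simp_all add: invariants_def dist_real_def abs_minus_commute)
  qed
  have y_cond: "cond \<nu> 0 (incoming G (ends len (invariants len y)) \<nu>) (outgoing G (starts (invariants len y)) \<nu>)"
    if \<nu>: "\<nu> \<in> verts G" for \<nu>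
  proof (cases "\<nu> \<in> boundary_nodes G")
    case True
    have "boundary_condition p P \<rho>ref G len bd 0 (states len (invariants len y)) \<nu>"
      using y True unfolding admissible_initial_data_def states_invariants by blast
    then show ?thesis by (rule iffD2[OF node_cond_boundary[OF True]])
  next
    case False
    then have inner: "\<nu> \<in> inner_nodes G" using \<nu> by (simp add: inner_nodes_def)
    have "coupling_condition p P \<rho>ref G len (states len (invariants len y)) \<nu>"
      using y inner unfolding admissible_initial_data_def states_invariants by blast
    then show ?thesis by (rule iffD2[OF node_cond_inner[OF inner]])
  qed
  have start: "start i \<in> verts G" if "i \<in> I" for i
  proof -
    have "fin_digraph G" using net by (simp add: pipe_network_def)
    then have "wf_digraph G" by (rule fin_digraph.axioms(1))
    then show ?thesis using arc[OF that] unfolding start_def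
      by (simp add: wf_digraph.tail_in_verts wf_digraph.head_in_verts)
  qed
  show ?thesis
  proof (unfold_locales, goal_cases)
    case (1 i t x u s v)
    have "\<bar>defect len R i t x\<bar> \<le> 2 * S" by (rule defect_tame(1)[where len = len and R = R and i = i, OF R[OF arc[OF 1(1)]] 1(3,2)])
    then have "\<bar>observer_source \<gamma>c \<mu> (defect len R) i t x u v\<bar> \<le> C * (s + S)"
      by (rule observer_source_bound[OF \<gamma>c(1,2) 1(4,5,6) _ \<gamma>c(3)])
    also have "\<dots> \<le> C * (s + max B S)" using C by (intro mult_left_mono) auto
    finally show ?case .
  next
    case (2 i t x x' u v u' v')
    have "\<bar>defect len R i t x - defect len R i t x'\<bar> \<le> 2 * (LR * \<bar>x - x'\<bar>)"
      by (rule defect_tame(2)[where len = len and R = R and i = i, OF R[OF arc[OF 2(1)]] 2(3,2,4)])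
    then have "\<bar>observer_source \<gamma>c \<mu> (defect len R) i t x u v - observer_source \<gamma>c \<mu> (defect len R) i t x' u' v'\<bar>
       \<le> C * (\<bar>u - u'\<bar> + \<bar>v - v'\<bar> + LR * \<bar>x - x'\<bar>)"
      by (rule observer_source_lip[OF \<gamma>c(1,2) 2(5,6,7,8) _ \<gamma>c(3)])
    also have "\<dots> \<le> C * (\<bar>u - u'\<bar> + \<bar>v - v'\<bar> + max L LR * \<bar>x - x'\<bar>)"
      using C by (intro mult_left_mono add_left_mono mult_right_mono) auto
    finally show ?case .
  next
    case (3 i x u v)
    show ?case
      unfolding observer_source_def
      by (intro continuous_intros defect_tame(3)[where len = len and R = R and i = i, OF R[OF arc[OF 3(1)]] 3(2)])
  next
    case 4 then show ?case using S by simp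
  next
    case 5 then show ?case using pos by simp
  next
    case (6 i t g s)
    then show ?case by (intro reflect_bound) auto
  next
    case (7 i t t' g g' s)
    have "\<bar>reflect i t g - reflect i t' g'\<bar> \<le> K * (s + L * \<bar>t - t'\<bar>)"
      using 7 pos by (intro reflect_lip) auto
    also have "\<dots> \<le> K * (s + max L LR * \<bar>t - t'\<bar>)"
      using K_ge(1) by (intro mult_left_mono add_left_mono mult_right_mono) auto
    finally show ?case .
  next
    case (8 i x)
    then show ?case using yb[of i x] by simp
  next
    case (9 i x x')
    have "L * \<bar>x - x'\<bar> \<le> max L LR * \<bar>x - x'\<bar>" by (intro mult_right_mono) auto
    then show ?case using y_lip[OF 9] by linarith
  next
    case (10 i)
    show ?case
    proof (rule reflect_unique[OF T0 _ _ _ y_cond[OF start[OF 10]] 10])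
      fix k assume k: "k \<in> I"
      show "\<bar>invariants len y k (len (fst k))\<bar> \<le> r'" "\<bar>invariants len y k 0\<bar> \<le> r'"
        using yb[OF k, of "len (fst k)"] yb[OF k, of 0] lenp[OF k] B by simp_all
    qed (use pos in simp)
  next
    case 11 then show ?case using K_ge(1) by simp
  qed
qed

lemma solution_from_invariants:
  fixes V :: "'e \<times> bool \<Rightarrow> real \<Rightarrow> real \<Rightarrow> real" and R R' :: "'e \<Rightarrow> real \<Rightarrow> real \<Rightarrow> state"
  assumes flux: "upwind_flux I (\<lambda>i. len (fst i)) (\<lambda>i. (fst i, \<not> snd i)) T (\<lambda>u v. lambda_plus p \<rho>ref (u, v)) l1 l2 C r' lmin lmax"
    and V: "upwind_flux.is_solution I (\<lambda>i. len (fst i)) (\<lambda>i. (fst i, \<not> snd i)) T (\<lambda>u v. lambda_plus p \<rho>ref (u, v)) r'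
      (observer_source (\<gamma> * (sound_speed p \<rho>ref / 4)) \<mu> (defect len R')) reflect (invariants len y) V"
    and phys: "\<And>u v. \<bar>u\<bar> \<le> r' \<Longrightarrow> \<bar>v\<bar> \<le> r' \<Longrightarrow> (u, v) \<in> physical_states p \<rho>ref"
    and R: "\<And>e t x. \<mu> / 2 * defect len R' (e, True) t x = \<mu> / 2 * (fst (R e t x) - snd (R e t x))"
  defines "Sol \<equiv> \<lambda>e t x. states len (\<lambda>i. V i t) e x"
  shows "observer_solution p P \<gamma> \<rho>ref T G len \<mu> R bd y Sol" "\<And>e. e \<in> arcs G \<Longrightarrow> bounded_by r' T (len e) (Sol e)"
proof -
  interpret upwind_flux I "\<lambda>i. len (fst i)" "\<lambda>i. (fst i, \<not> snd i)" T "\<lambda>u v. lambda_plus p \<rho>ref (u, v)" l1 l2 C r' lmin lmax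
    by (rule flux)
  note sol = V[unfolded is_solution_def]
  note sol1 = conjunct1[OF sol] and sol2 = conjunct1[OF conjunct2[OF sol]]
    and sol3 = conjunct1[OF conjunct2[OF conjunct2[OF sol]]]
    and sol4 = conjunct1[OF conjunct2[OF conjunct2[OF conjunct2[OF sol]]]]
    and sol5 = conjunct2[OF conjunct2[OF conjunct2[OF conjunct2[OF sol]]]]
  have eI: "(e, d) \<in> I" if "e \<in> arcs G" for e d using that by (simp add: I_def)
  have lenp: "0 < len e" if "e \<in> arcs G" for e using len(1) len(3)[OF eI[OF that, of True]] by simp
  have Vb: "\<bar>V i t x\<bar> \<le> r'" if "i \<in> I" "t \<in> {0..T}" "x \<in> {0..len (fst i)}" for i t x
    using sol1 that by blast
  obtain Mc where Mc: "Mc \<ge> 0" "\<And>i t t' x x'. i \<in> I \<Longrightarrow> t \<in> {0..T} \<Longrightarrow> t' \<in> {0..T} \<Longrightarrow> x \<in> {0..len (fst i)} \<Longrightarrow> x' \<in> {0..len (fst i)} \<Longrightarrow>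
       \<bar>V i t x - V i t' x'\<bar> \<le> Mc * (\<bar>t - t'\<bar> + \<bar>x - x'\<bar>)"
    using sol2 by blast
  have V0: "V i 0 x = invariants len y i x" if "i \<in> I" "x \<in> {0..len (fst i)}" for i x
    using sol3 that by blast
  have Vbd: "V i t 0 = reflect i t (\<lambda>k. V k t (len (fst k)))" if "i \<in> I" "t \<in> {0..T}" for i t
    using sol4 that by blast
  show bdd: "bounded_by r' T (len e) (Sol e)" if e: "e \<in> arcs G" for e
    unfolding bounded_by_def Sol_def states_def
    using Vb[OF eI[OF e]] by simp
  have cond: "cond \<nu> t (incoming G (ends len (\<lambda>i. V i t)) \<nu>) (outgoing G (starts (\<lambda>i. V i t)) \<nu>)"
    if \<nu>: "\<nu> \<in> verts G" and t: "t \<in> {0..T}" for \<nu> t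
  proof (rule reflect_cond[OF t _ _ \<nu>])
    fix k assume k: "k \<in> I"
    have "0 < len (fst k)" using k lenp by (auto simp: I_def)
    then show "\<bar>V k t (len (fst k))\<bar> \<le> r'" using Vb[OF k t, of "len (fst k)"] by simp
    show "V k t 0 = reflect k t (\<lambda>k. V k t (len (fst k)))" by (rule Vbd[OF k t])
  qed
  show "observer_solution p P \<gamma> \<rho>ref T G len \<mu> R bd y Sol"
    unfolding observer_solution_def network_solution_def
  proof (intro conjI ballI)
    fix e assume e: "e \<in> arcs G"
    have Slip: "\<bar>fst (Sol e t x) - fst (Sol e t' x')\<bar> \<le> Mc * (\<bar>t - t'\<bar> + \<bar>x - x'\<bar>)"
      "\<bar>snd (Sol e t x) - snd (Sol e t' x')\<bar> \<le> Mc * (\<bar>t - t'\<bar> + \<bar>x - x'\<bar>)"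
      if "t \<in> {0..T}" "t' \<in> {0..T}" "x \<in> {0..len e}" "x' \<in> {0..len e}" for t t' x x'
      using Mc(2)[OF eI[OF e, of True] that(1,2), of x x'] Mc(2)[OF eI[OF e, of False] that(1,2), of "len e - x" "len e - x'"] that(3,4)
      by (simp_all add: Sol_def states_def abs_minus_commute)
    have comp: "continuous_on ({0..T} \<times> {0..len e}) (\<lambda>z. f (Sol e (fst z) (snd z)))"
      if f: "\<And>t t' x x'. t \<in> {0..T} \<Longrightarrow> t' \<in> {0..T} \<Longrightarrow> x \<in> {0..len e} \<Longrightarrow> x' \<in> {0..len e} \<Longrightarrow>
        \<bar>f (Sol e t x) - f (Sol e t' x')\<bar> \<le> Mc * (\<bar>t - t'\<bar> + \<bar>x - x'\<bar>)" for f :: "state \<Rightarrow> real"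
    proof (rule lipschitz_on_continuous_on[OF lipschitz_onI])
      fix z z' :: "real \<times> real" assume z: "z \<in> {0..T} \<times> {0..len e}" "z' \<in> {0..T} \<times> {0..len e}"
      have "\<bar>fst z - fst z'\<bar> + \<bar>snd z - snd z'\<bar> \<le> 2 * dist z z'"
        using dist_fst_le[of z z'] dist_snd_le[of z z'] by (simp add: dist_real_def)
      then have "Mc * (\<bar>fst z - fst z'\<bar> + \<bar>snd z - snd z'\<bar>) \<le> Mc * (2 * dist z z')"
        using Mc(1) by (intro mult_left_mono)
      then show "dist (f (Sol e (fst z) (snd z))) (f (Sol e (fst z') (snd z'))) \<le> (2 * Mc) * dist z z'"
        using f[of "fst z" "fst z'" "snd z" "snd z'"] z by (auto simp: dist_real_def mult_ac)
    qed (use Mc in simp)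
    have "continuous_on ({0..T} \<times> {0..len e}) (\<lambda>z. (fst (Sol e (fst z) (snd z)), snd (Sol e (fst z) (snd z))))"
      by (intro continuous_on_Pair comp Slip)
    then show "continuous_on ({0..T} \<times> {0..len e}) (\<lambda>(t, x). Sol e t x)"
      by (simp add: case_prod_beta')
    show "\<exists>L. lipschitz_in_space L T (len e) (Sol e)"
      unfolding lipschitz_in_space_def
    proof (intro exI[of _ Mc] ballI conjI lipschitz_onI)
      fix t x x' assume "t \<in> {0..T}" "x \<in> {0..len e}" "x' \<in> {0..len e}"
      then show "dist (fst (Sol e t x)) (fst (Sol e t x')) \<le> Mc * dist x x'"
        "dist (snd (Sol e t x)) (snd (Sol e t x')) \<le> Mc * dist x x'"
        using Slip[of t t x x'] by (simp_all add: dist_real_def)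
    qed (use Mc in simp_all)
    show "Sol e t x \<in> physical_states p \<rho>ref" if "t \<in> {0..T}" "x \<in> {0..len e}" for t x
      unfolding Sol_def states_def using Vb[OF eI[OF e] that(1)] that by (intro phys) simp_all
    show "edge_equations p \<gamma> \<rho>ref T (len e)
      (\<lambda>t x. \<mu> / 2 * (fst (R e t x) - snd (R e t x) - (fst (Sol e t x) - snd (Sol e t x)))) (Sol e)"
      unfolding Sol_def
    proof (rule edge_equations_from_invariants[OF _ R])
      fix d J \<xi> s
      assume "is_interval J" "J \<subseteq> {0..T}" "s \<in> J"
        "\<And>s. s \<in> J \<Longrightarrow> \<xi> s \<in> {0..len e} \<and>
         (\<xi> has_real_derivative lambda_plus p \<rho>ref (V (e, d) s (\<xi> s), V (e, \<not> d) s (len e - \<xi> s))) (at s within J)"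
      moreover have "\<forall>J \<xi>. is_interval J \<longrightarrow> J \<subseteq> {0..T} \<longrightarrow>
         (\<forall>s\<in>J. \<xi> s \<in> {0..len e} \<and>
          (\<xi> has_real_derivative lambda_plus p \<rho>ref (V (e, d) s (\<xi> s), V (e, \<not> d) s (len e - \<xi> s))) (at s within J)) \<longrightarrow>
         (\<forall>s\<in>J. ((\<lambda>s. V (e, d) s (\<xi> s)) has_real_derivative
           observer_source (\<gamma> * (sound_speed p \<rho>ref / 4)) \<mu> (defect len R') (e, d) s (\<xi> s)
             (V (e, d) s (\<xi> s)) (V (e, \<not> d) s (len e - \<xi> s))) (at s within J))"
        using bspec[OF sol5 eI[OF e, of d]] unfolding fst_conv snd_conv .
      ultimately show "((\<lambda>s. V (e, d) s (\<xi> s)) has_real_derivative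
           observer_source (\<gamma> * (sound_speed p \<rho>ref / 4)) \<mu> (defect len R') (e, d) s (\<xi> s)
             (V (e, d) s (\<xi> s)) (V (e, \<not> d) s (len e - \<xi> s))) (at s within J)"
        by blast
    qed
    show "Sol e 0 x = y e x" if x: "x \<in> {0..len e}" for x
      using V0[OF eI[OF e, of True], of x] V0[OF eI[OF e, of False], of "len e - x"] x
      by (simp add: Sol_def states_def invariants_def)
  next
    fix \<nu> t assume \<nu>: "\<nu> \<in> inner_nodes G" and t: "t \<in> {0..T}"
    have "\<nu> \<in> verts G" using \<nu> by (simp add: inner_nodes_def)
    from iffD1[OF node_cond_inner[OF \<nu>] cond[OF this t]]
    show "coupling_condition p P \<rho>ref G len (\<lambda>e. Sol e t) \<nu>" unfolding Sol_def .
  next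
    fix \<nu> t assume \<nu>: "\<nu> \<in> boundary_nodes G" and t: "t \<in> boundary_times T bd"
    have t': "t \<in> {0..T}" using t by (auto simp: boundary_times_def split: boundary_data.splits)
    have "\<nu> \<in> verts G" using \<nu> by (simp add: boundary_nodes_def)
    from iffD1[OF node_cond_boundary[OF \<nu>] cond[OF this t']]
    show "boundary_condition p P \<rho>ref G len bd t (\<lambda>e. Sol e t) \<nu>" unfolding Sol_def .
  qed
qed

end

text \<open>The radius \<open>r'\<close> in which the scheme runs serves as
  \<open>C\<^sub>T\<close>. The bounds on values have to lie below both \<open>r'\<close> and the
  threshold \<open>\<epsilon>\<close>, the Lipschitz constants below
  \<open>\<epsilon>\<close>.\<close>

theorem theorem3p7:
  fixes p :: "real \<Rightarrow> real" and \<gamma> \<rho>ref T \<mu> :: real and n :: nat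
    and G :: "('v,'e) pre_digraph" and len :: "'e \<Rightarrow> real"
  assumes "pressure_law p" and "\<gamma> \<ge> 0" and "\<rho>ref > 0"
    and "T > 0" and "\<mu> \<ge> 0"
    and "pipe_network G len"
    and "\<forall>\<nu>\<in>inner_nodes G. card (incident_edges G \<nu>) \<le> n"
  shows "\<exists>C\<^sub>T>0. \<exists>c\<^sub>1>0. \<exists>c\<^sub>2>0. \<exists>c\<^sub>3>0. \<exists>c\<^sub>4>0.
    \<forall>P. pressure_potential p P \<longrightarrow>
    (\<forall>B\<^sub>m\<^sub>a\<^sub>x L\<^sub>I S\<^sub>m\<^sub>a\<^sub>x L\<^sub>R.
      0 < B\<^sub>m\<^sub>a\<^sub>x \<and> B\<^sub>m\<^sub>a\<^sub>x \<le> c\<^sub>1 \<and> 0 < L\<^sub>I \<and> L\<^sub>I \<le> c\<^sub>2 \<and> 0 < S\<^sub>m\<^sub>a\<^sub>x \<and> S\<^sub>m\<^sub>a\<^sub>x \<le> c\<^sub>3 \<and> 0 < L\<^sub>R \<and> L\<^sub>R \<le> c\<^sub>4 \<longrightarrow>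
      (\<forall>bd y z R.
        admissible_boundary_data p P \<rho>ref T G B\<^sub>m\<^sub>a\<^sub>x L\<^sub>I S\<^sub>m\<^sub>a\<^sub>x bd \<and>
        admissible_initial_data p P \<rho>ref G len B\<^sub>m\<^sub>a\<^sub>x L\<^sub>I bd y \<and>
        (\<mu> > 0 \<longrightarrow> unique_original_solution p P \<gamma> \<rho>ref T G len S\<^sub>m\<^sub>a\<^sub>x L\<^sub>R bd z R) \<longrightarrow>
        (\<exists>S. observer_solution p P \<gamma> \<rho>ref T G len \<mu> R bd y S \<and>
             (\<forall>e\<in>arcs G. bounded_by C\<^sub>T T (len e) (S e)))))"
proof (rule gas_constants[OF assms(1,3)])
  fix r m1 m2 lmin lmax C0 :: real
  assume r: "r > 0" and m: "0 < m1" "m1 \<le> m2" and lam: "0 < lmin" "lmin \<le> lmax" and C0: "C0 \<ge> 0"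
    and M: "incr_bilipschitz r m1 m2 (\<lambda>u v. mass_flow p \<rho>ref (u, v))"
    and H: "\<And>P. pressure_potential p P \<Longrightarrow> incr_bilipschitz r m1 m2 (\<lambda>u v. enthalpy p P \<rho>ref (u, v))"
    and phys: "\<And>u v. \<bar>u\<bar> \<le> r \<Longrightarrow> \<bar>v\<bar> \<le> r \<Longrightarrow> (u, v) \<in> physical_states p \<rho>ref"
    and lp: "\<And>u v. \<bar>u\<bar> \<le> r \<Longrightarrow> \<bar>v\<bar> \<le> r \<Longrightarrow> lmin \<le> lambda_plus p \<rho>ref (u, v) \<and> lambda_plus p \<rho>ref (u, v) \<le> lmax"
    and lip: "\<And>u v u' v'. \<bar>u\<bar> \<le> r \<Longrightarrow> \<bar>v\<bar> \<le> r \<Longrightarrow> \<bar>u'\<bar> \<le> r \<Longrightarrow> \<bar>v'\<bar> \<le> r \<Longrightarrow>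
       \<bar>lambda_plus p \<rho>ref (u, v) - lambda_plus p \<rho>ref (u', v')\<bar> \<le> C0 * (\<bar>u - u'\<bar> + \<bar>v - v'\<bar>)"
  \<comment> \<open>The largest radius for incoming invariants that the existence lemma for
    junctions admits; it does not exceed \<open>r\<close> because
    \<open>m1 \<le> m2\<close>.\<close>
  define r' where "r' = m1 * r / (2 * m2 + m2 * m2 / m1)"
  have "0 \<le> m2 * m2 / m1" using m by simp
  then have den: "2 * m2 + m2 * m2 / m1 > 0" "m1 \<le> 2 * m2 + m2 * m2 / m1"
    using m by linarith+
  have r': "r' > 0" "r' \<le> r" "(2 * m2 + m2 * m2 / m1) * r' \<le> m1 * r"
    using den m r by (auto simp: r'_def divide_le_eq mult.commute intro!: mult_left_mono)
  define \<gamma>c where "\<gamma>c = \<gamma> * (sound_speed p \<rho>ref / 4)"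
  have "sound_speed p \<rho>ref \<ge> 0"
    using pressure_law_facts(1)[OF assms(1,3)] by (simp add: sound_speed_def)
  then have \<gamma>c: "\<gamma>c \<ge> 0" using assms(2) by (simp add: \<gamma>c_def)
  \<comment> \<open>One constant for the Lipschitz bound of the speed and for size and slope of the
    source.\<close>
  define C where "C = max C0 (4 * \<gamma>c * r' + \<mu>)"
  have C: "C0 \<le> C" "4 * \<gamma>c * r' + \<mu> \<le> C" by (auto simp: C_def)
  \<comment> \<open>The node constant \<open>K\<close> written out: it enters the choice of
    \<open>\<epsilon>\<close>, which precedes the potential and the data on which the locale
    \<open>gas_nodes\<close> depends.\<close>
  define Kc where "Kc = 1 + (1 + m2) / m1 + junction_const m1 m2 (card (arcs G))"
  have Kc: "Kc \<ge> 0" unfolding Kc_def junction_const_def[OF m r] using m by simp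
  let ?I = "arcs G \<times> (UNIV :: bool set)" and ?len = "\<lambda>i. len (fst i)"
    and ?partner = "\<lambda>i :: 'e \<times> bool. (fst i, \<not> snd i)" and ?\<Lambda> = "\<lambda>u v. lambda_plus p \<rho>ref (u, v)"
  have fin: "finite (arcs G)" and lenpos: "\<forall>e\<in>arcs G. len e > 0"
    using assms(6) unfolding pipe_network_def by (blast intro: fin_digraph.finite_arcs)+
  obtain l1 l2 where l: "0 < l1" "l1 \<le> l2" "\<And>e. e \<in> arcs G \<Longrightarrow> l1 \<le> len e \<and> len e \<le> l2"
    using finite_length_bounds[OF fin lenpos] by metis
  have flux: "upwind_flux ?I ?len ?partner T ?\<Lambda> l1 l2 C r' lmin lmax"
  proof unfold_locales
    fix u v :: real assume uv: "\<bar>u\<bar> \<le> r'" "\<bar>v\<bar> \<le> r'"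
    then show "lmin \<le> lambda_plus p \<rho>ref (u, v) \<and> lambda_plus p \<rho>ref (u, v) \<le> lmax"
      using r'(2) by (intro lp) linarith+
    fix u' v' :: real assume uv': "\<bar>u'\<bar> \<le> r'" "\<bar>v'\<bar> \<le> r'"
    have "\<bar>lambda_plus p \<rho>ref (u, v) - lambda_plus p \<rho>ref (u', v')\<bar> \<le> C0 * (\<bar>u - u'\<bar> + \<bar>v - v'\<bar>)"
      using uv uv' r'(2) by (intro lip) linarith+
    also have "\<dots> \<le> C * (\<bar>u - u'\<bar> + \<bar>v - v'\<bar>)" using C by (intro mult_right_mono) auto
    finally show "\<bar>lambda_plus p \<rho>ref (u, v) - lambda_plus p \<rho>ref (u', v')\<bar> \<le> C * (\<bar>u - u'\<bar> + \<bar>v - v'\<bar>)" .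
  qed (use fin l lam C C0 assms(4) in auto)
  obtain \<epsilon> where \<epsilon>: "\<epsilon> > 0" "\<And>b L F \<Phi> y. b \<le> \<epsilon> \<Longrightarrow> L \<le> \<epsilon> \<Longrightarrow>
      upwind_data ?I ?len ?partner T ?\<Lambda> l1 l2 C r' lmin lmax F b L \<Phi> y Kc \<Longrightarrow>
      \<exists>W. upwind_flux.is_solution ?I ?len ?partner T ?\<Lambda> r' F \<Phi> y W"
    using upwind_flux.semiglobal_existence[OF flux Kc r'(1)] by blast
  have ph: "(u, v) \<in> physical_states p \<rho>ref" if "\<bar>u\<bar> \<le> r'" "\<bar>v\<bar> \<le> r'" for u v
    using that r'(2) by (intro phys) linarith+
  have main: "\<exists>S. observer_solution p P \<gamma> \<rho>ref T G len \<mu> R bd y S \<and> (\<forall>e\<in>arcs G. bounded_by r' T (len e) (S e))"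
    if P: "pressure_potential p P"
      and Bp: "0 < B" "B \<le> min \<epsilon> r'" and Lp: "0 < L" "L \<le> \<epsilon>" and Sp: "0 < Sm" "Sm \<le> min \<epsilon> r'" and LRp: "0 < LR" "LR \<le> \<epsilon>"
      and bd: "admissible_boundary_data p P \<rho>ref T G B L Sm bd"
      and y: "admissible_initial_data p P \<rho>ref G len B L bd y"
      and R: "\<mu> > 0 \<longrightarrow> unique_original_solution p P \<gamma> \<rho>ref T G len Sm LR bd z R"
    for P B L Sm LR bd y z R
  proof -
    interpret gas_nodes p P \<rho>ref T G len r m1 m2 r' B L Sm bd
      by unfold_locales (use assms(6) M H[OF P] r m r' Sp Bp bd in auto)
    \<comment> \<open>For \<open>\<mu> = 0\<close> the function \<open>R\<close> is arbitrary; zero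
      is a regular substitute, and the products with \<open>\<mu> / 2\<close> agree.\<close>
    define R' where "R' = (if \<mu> > 0 then R else (\<lambda>e t x. (0, 0)))"
    have "upwind_data I ?len ?partner T ?\<Lambda> l1 l2 C r' lmin lmax
      (observer_source \<gamma>c \<mu> (defect len R')) (max B Sm) (max L LR) reflect (invariants len y) K"
    proof (rule upwind_data[OF flux[folded I_def] \<gamma>c assms(5) C(2) Bp(1) Lp(1) LRp(1) _ y])
      fix e assume e: "e \<in> arcs G"
      show "tame_on T (len e) Sm LR (R' e)"
      proof (cases "\<mu> > 0")
        case True
        then show ?thesis
          using R e unfolding tame_on_def R'_def unique_original_solution_def original_solution_def network_solution_def Let_def
          by simp
      next
        case False
        then show ?thesis using Sp LRp
          by (auto simp: tame_on_def R'_def bounded_by_def lipschitz_in_space_def case_prod_beta' intro!: lipschitz_onI)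
      qed
    qed
    then have "upwind_data ?I ?len ?partner T ?\<Lambda> l1 l2 C r' lmin lmax
      (observer_source \<gamma>c \<mu> (defect len R')) (max B Sm) (max L LR) reflect (invariants len y) Kc"
      unfolding I_def K_def Kc_def .
    then have "\<exists>V. upwind_flux.is_solution ?I ?len ?partner T ?\<Lambda> r'
       (observer_source \<gamma>c \<mu> (defect len R')) reflect (invariants len y) V"
      by (rule \<epsilon>(2)[rotated 2]) (use Bp Lp Sp LRp in simp_all)
    then obtain V where V: "upwind_flux.is_solution ?I ?len ?partner T ?\<Lambda> r'
       (observer_source \<gamma>c \<mu> (defect len R')) reflect (invariants len y) V" ..
    have R'_eq: "\<mu> / 2 * defect len R' (e, True) t x = \<mu> / 2 * (fst (R e t x) - snd (R e t x))" for e t x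
      using assms(5) by (simp add: defect_def R'_def)
    note sol = solution_from_invariants[OF flux[folded I_def] V[folded I_def, unfolded \<gamma>c_def] ph R'_eq]
    show ?thesis using sol by blast
  qed
  show ?thesis
  proof (intro exI conjI)
    show "r' > 0" "min \<epsilon> r' > 0" "\<epsilon> > 0" "min \<epsilon> r' > 0" "\<epsilon> > 0" using r'(1) \<epsilon>(1) by auto
  qed (use main in blast)
qed

end
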